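(* Let $X$ be a smooth projective irreducible variety over $\mathbb{C}$, $\mathcal{X}$ a primitive double scheme with $\mathcal{X}_{red}=X$ and associated line bundle $L$, and $H\subset X$ a hypersurface. With the notation of the context, let $A\in H^1(X,T_X\otimes L)$ be the element represented by the family $(D_{ij})$ defining $\mathcal{X}$, let $\mathbb{A}\in H^1(X,T_X\otimes L\otimes\mathcal{O}_X(H))$ be the element represented by the family $(E_{ij})$ defining the blowing-up $B_{H,\mathcal{X}}$ of $\mathcal{X}$ along $H$, and let $\phi_H:H^1(X,T_X\otimes L)\to H^1(X,T_X\otimes L\otimes\mathcal{O}_X(H))$ be the canonical map (induced by the canonical section of $\mathcal{O}_X(H)$). Then $\mathbb{A}=\phi_H(A)$.
   Context: Schemes are noetherian separated schemes over $\mathbb{C}$. A primitive double scheme is a Cohen-Macaulay scheme $\mathcal{X}$ such that $X=\mathcal{X}_{red}$ is a smooth connected variety, every closed point of $X$ has an open neighborhood in $\mathcal{X}$ isomorphic to a closed subscheme of a smooth variety of dimension $\dim(X)+1$, and the ideal sheaf $\mathcal{I}_X$ of $X$ in $\mathcal{X}$ satisfies $\mathcal{I}_X\neq 0$, $\mathcal{I}_X^2=0$. Then $L=\mathcal{I}_X$ is a line bundle on $X$, the line bundle associated to $\mathcal{X}$. A hypersurface $H\subset X$ is a closed subscheme whose ideal sheaf in $X$ is invertible. $\mathbf{Z}_2=\mathrm{Spec}(\mathbb{C}[t]/(t^2))$; for $U\subset X$ open, $U^{(2)}$ is the corresponding open subscheme of $\mathcal{X}$. Let $(U_i)_{i\in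 I}$ be an affine open cover of $X$ such that there are isomorphisms $\delta_i:U_i^{(2)}\to U_i\times\mathbf{Z}_2$ inducing the identity on $U_i$, and such that the ideal of $H\cap U_i$ is generated by $x_i\in\mathcal{O}_X(U_i)$. Put $\delta_{ij}^*=\delta_i^{*-1}\delta_j^*$, an automorphism of $\mathcal{O}_X(U_{ij})[t]/(t^2)$, with $\delta_{ij}^*(u)=u+D_{ij}(u)t$ for $u\in\mathcal{O}_X(U_{ij})$ and $\delta_{ij}^*(t)=\alpha_{ij}t$. Here $D_{ij}$ is a derivation of $\mathcal{O}_X(U_{ij})$, i.e. a section of $T_X$ over $U_{ij}$, $(\alpha_{ij})$ is a cocycle defining $L$, and $D_{ij}+\alpha_{ij}D_{jk}=D_{ik}$. If $\alpha_i:L_{|U_i}\to\mathcal{O}_{U_i}$ are trivializations with $\alpha_{ij}=\alpha_i\alpha_j^{-1}$, the family $(D_{ij})$ represents the class in $H^1(X,T_X\otimes L)$ of the usual Čech cocycle $(D_{ij}\otimes\alpha_i^{-1}(1))$. For $0\ne x\in\mathcal{O}_X(U)$ let $\chi_x$ be the endomorphism of $\mathcal{O}_X(U)[t]/(t^2)$ with $\chi_x(a)=a$ for $a\in\mathcal{O}_X(U)$ and $\chi_x(t)=xt$. The blowing-up $B_{H,\mathcal{X}}$ is the primitive double scheme with reduced scheme $X$ and associated line bundle $L\otimes\mathcal{O}_X(H)$ obtained by gluing the $U_i\times\mathbf{Z}_2$ with the automorphisms $\gamma_{ij}$ of $U_{ij}\times\mathbf{Z}_2$ such that $\gamma_{ij}^*\circ\chi_{x_j}=\chi_{x_i}\circ\delta_{ij}^*$.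 $E_{ij}$ is the derivation of $\mathcal{O}_X(U_{ij})$ such that $\gamma_{ij}^*(u)=u+E_{ij}(u)t$ for $u\in\mathcal{O}_X(U_{ij})$. The family $(E_{ij})$ represents in the same way a class in $H^1(X,T_X\otimes L\otimes\mathcal{O}_X(H))$, with respect to the cocycle $(\alpha_{ij}x_i/x_j)$ of $L\otimes\mathcal{O}_X(H)$. *)

theory Defs
  imports
    "HOL-Analysis.Analysis"
    "HOL-Algebra.Free_Abelian_Groups"
    "HOL-Algebra.Generated_Groups"
    "HOL-Algebra.Generated_Rings"
    "HOL-Algebra.Ring_Divisibility"
    "HOL-Library.Extended_Nat"
begin

section \<open>Ringed spaces over the complex numbers\<close>

definition type_ring :: "'a::comm_ring_1 set \<Rightarrow> 'a ring" where
  "type_ring S = \<lparr>carrier = S, mult = (*), one = 1, ring.zero = 0, ring.add = (+)\<rparr>"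

record ('a, 'r) cspace =
  pts :: "'a topology"
  sec :: "'a set \<Rightarrow> 'r ring"
  res :: "'a set \<Rightarrow> 'a set \<Rightarrow> 'r \<Rightarrow> 'r"
  cst :: "'a set \<Rightarrow> complex \<Rightarrow> 'r"

text \<open>\<open>sec X U\<close> is the ring of sections over \<open>U\<close>, \<open>res X U V\<close> the restriction from \<open>U\<close> to \<open>V\<close>, and
  \<open>cst X U\<close> the structure map of the \<open>\<complex>\<close>-algebra \<open>sec X U\<close>. Only open \<open>U\<close>, \<open>V\<close> are relevant.\<close>

definition opens_in :: "('a, 'r) cspace \<Rightarrow> 'a set \<Rightarrow> 'a set set" where
  "opens_in X U = {V. openin (pts X) V \<and> V \<subseteq> U}"

abbreviation points :: "('a, 'r) cspace \<Rightarrow> 'a set" where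
  "points X \<equiv> topspace (pts X)"

definition ringed_cspace :: "('a, 'r) cspace \<Rightarrow> bool" where
  "ringed_cspace X \<longleftrightarrow>
    (\<forall>U. openin (pts X) U \<longrightarrow>
       cring (sec X U) \<and> cst X U \<in> ring_hom (type_ring UNIV) (sec X U) \<and>
       (\<forall>s\<in>carrier (sec X U). res X U U s = s) \<and>
       (\<forall>V\<in>opens_in X U. res X U V \<in> ring_hom (sec X U) (sec X V) \<and>
          (\<forall>c. res X U V (cst X U c) = cst X V c) \<and>
          (\<forall>W\<in>opens_in X V. \<forall>s\<in>carrier (sec X U). res X V W (res X U V s) = res X U W s))) \<and>
    (\<forall>\<U> s. (\<forall>U\<in>\<U>. openin (pts X) U \<and> s U \<in> carrier (sec X U)) \<and>
       (\<forall>U\<in>\<U>. \<forall>V\<in>\<U>. res X U (U \<inter> V) (s U) = res X V (U \<inter> V) (s V)) \<longrightarrow>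
       (\<exists>!t. t \<in> carrier (sec X (\<Union>\<U>)) \<and> (\<forall>U\<in>\<U>. res X (\<Union>\<U>) U t = s U)))"

definition open_sub :: "('a, 'r) cspace \<Rightarrow> 'a set \<Rightarrow> ('a, 'r) cspace" where
  "open_sub X U = X\<lparr>pts := subtopology (pts X) U\<rparr>"

text \<open>The germ at \<open>p\<close> of the section \<open>s\<close> over \<open>U\<close>, for any presheaf with section sets \<open>S\<close> and
  restrictions \<open>r\<close> on the topology \<open>T\<close>.\<close>

definition germ ::
  "'a topology \<Rightarrow> ('a set \<Rightarrow> 's set) \<Rightarrow> ('a set \<Rightarrow> 'a set \<Rightarrow> 's \<Rightarrow> 's) \<Rightarrow>
    'a \<Rightarrow> 'a set \<Rightarrow> 's \<Rightarrow> ('a set \<times> 's) set" where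
  "germ T S r p U s = {(V, t). openin T V \<and> p \<in> V \<and> t \<in> S V \<and>
     (\<exists>W. openin T W \<and> p \<in> W \<and> W \<subseteq> U \<inter> V \<and> r U W s = r V W t)}"

definition rgerm :: "('a, 'r) cspace \<Rightarrow> 'a \<Rightarrow> 'a set \<Rightarrow> 'r \<Rightarrow> ('a set \<times> 'r) set" where
  "rgerm X = germ (pts X) (\<lambda>U. carrier (sec X U)) (res X)"

text \<open>In the operations on classes below, the sets united are all equal, so that the union is the
  class of any representative.\<close>

definition local_ring :: "('a, 'r) cspace \<Rightarrow> 'a \<Rightarrow> ('a set \<times> 'r) set ring" where
  "local_ring X p =
    \<lparr>carrier = {rgerm X p U s | U s. openin (pts X) U \<and> p \<in> U \<and> s \<in> carrier (sec X U)},
     mult = (\<lambda>A B. \<Union>(U, s)\<in>A. \<Union>(V, t)\<in>B.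
        rgerm X p (U \<inter> V) (res X U (U \<inter> V) s \<otimes>\<^bsub>sec X (U \<inter> V)\<^esub> res X V (U \<inter> V) t)),
     one = rgerm X p (points X) \<one>\<^bsub>sec X (points X)\<^esub>,
     ring.zero = rgerm X p (points X) \<zero>\<^bsub>sec X (points X)\<^esub>,
     ring.add = (\<lambda>A B. \<Union>(U, s)\<in>A. \<Union>(V, t)\<in>B.
        rgerm X p (U \<inter> V) (res X U (U \<inter> V) s \<oplus>\<^bsub>sec X (U \<inter> V)\<^esub> res X V (U \<inter> V) t))\<rparr>"

definition preim :: "('a, 'r) cspace \<Rightarrow> ('a \<Rightarrow> 'c) \<Rightarrow> 'c set \<Rightarrow> 'a set" where
  "preim X f V = {p \<in> points X. f p \<in> V}"

text \<open>Morphisms of ringed spaces over \<open>\<complex>\<close>. No locality condition on stalks is imposed: the notion is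
  only used for isomorphisms and for closed immersions, whose maps on stalks are surjective and
  hence local as soon as the stalks are local rings.\<close>

definition morphism ::
  "('a, 'r) cspace \<Rightarrow> ('c, 's) cspace \<Rightarrow> ('a \<Rightarrow> 'c) \<Rightarrow> ('c set \<Rightarrow> 's \<Rightarrow> 'r) \<Rightarrow> bool" where
  "morphism X Y f fs \<longleftrightarrow> continuous_map (pts X) (pts Y) f \<and>
    (\<forall>V. openin (pts Y) V \<longrightarrow>
       fs V \<in> ring_hom (sec Y V) (sec X (preim X f V)) \<and>
       (\<forall>c. fs V (cst Y V c) = cst X (preim X f V) c) \<and>
       (\<forall>W\<in>opens_in Y V. \<forall>s\<in>carrier (sec Y V).
          fs W (res Y V W s) = res X (preim X f V) (preim X f W) (fs V s)))"

definition isomorphism ::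
  "('a, 'r) cspace \<Rightarrow> ('c, 's) cspace \<Rightarrow> ('a \<Rightarrow> 'c) \<Rightarrow> ('c set \<Rightarrow> 's \<Rightarrow> 'r) \<Rightarrow> bool" where
  "isomorphism X Y f fs \<longleftrightarrow> morphism X Y f fs \<and> homeomorphic_map (pts X) (pts Y) f \<and>
    (\<forall>V. openin (pts Y) V \<longrightarrow>
       bij_betw (fs V) (carrier (sec Y V)) (carrier (sec X (preim X f V))))"

definition closed_immersion ::
  "('a, 'r) cspace \<Rightarrow> ('c, 's) cspace \<Rightarrow> ('a \<Rightarrow> 'c) \<Rightarrow> ('c set \<Rightarrow> 's \<Rightarrow> 'r) \<Rightarrow> bool" where
  "closed_immersion X Y f fs \<longleftrightarrow> morphism X Y f fs \<and>
    embedding_map (pts X) (pts Y) f \<and> closedin (pts Y) (f ` points X) \<and>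
    (\<forall>V s q. openin (pts Y) V \<and> s \<in> carrier (sec X (preim X f V)) \<and> q \<in> V \<longrightarrow>
       (\<exists>W\<in>opens_in Y V. q \<in> W \<and>
          (\<exists>t\<in>carrier (sec Y W). fs W t = res X (preim X f V) (preim X f W) s)))"

definition ideal_sheaf ::
  "('a, 'r) cspace \<Rightarrow> ('c, 's) cspace \<Rightarrow> ('a \<Rightarrow> 'c) \<Rightarrow> ('c set \<Rightarrow> 's \<Rightarrow> 'r) \<Rightarrow> 'c set \<Rightarrow> 's set" where
  "ideal_sheaf X Y f fs V = {s \<in> carrier (sec Y V). fs V s = \<zero>\<^bsub>sec X (preim X f V)\<^esub>}"

section \<open>Schemes over the complex numbers\<close>

definition frac :: "'r ring \<Rightarrow> 'r set \<Rightarrow> 'r \<Rightarrow> 'r \<Rightarrow> ('r \<times> 'r) set" where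
  "frac R S a s = {(b, t). b \<in> carrier R \<and> t \<in> S \<and>
     (\<exists>u\<in>S. u \<otimes>\<^bsub>R\<^esub> (t \<otimes>\<^bsub>R\<^esub> a) = u \<otimes>\<^bsub>R\<^esub> (s \<otimes>\<^bsub>R\<^esub> b))}"

definition localization :: "'r ring \<Rightarrow> 'r set \<Rightarrow> ('r \<times> 'r) set ring" where
  "localization R S =
    \<lparr>carrier = {frac R S a s | a s. a \<in> carrier R \<and> s \<in> S},
     mult = (\<lambda>A B. \<Union>(a, s)\<in>A. \<Union>(b, t)\<in>B. frac R S (a \<otimes>\<^bsub>R\<^esub> b) (s \<otimes>\<^bsub>R\<^esub> t)),
     one = frac R S \<one>\<^bsub>R\<^esub> \<one>\<^bsub>R\<^esub>,
     ring.zero = frac R S \<zero>\<^bsub>R\<^esub> \<one>\<^bsub>R\<^esub>,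
     ring.add = (\<lambda>A B. \<Union>(a, s)\<in>A. \<Union>(b, t)\<in>B.
        frac R S (t \<otimes>\<^bsub>R\<^esub> a \<oplus>\<^bsub>R\<^esub> s \<otimes>\<^bsub>R\<^esub> b) (s \<otimes>\<^bsub>R\<^esub> t))\<rparr>"

text \<open>The common part of the constructions of Spec and Proj: a set \<open>P\<close> of prime ideals, with basic
  open sets \<open>{p \<in> P. f \<notin> p}\<close> for \<open>f \<in> F\<close>, and as sections those functions into the localizations at
  primes which are locally fractions \<open>a / s\<close> with \<open>(a, s)\<close> in a given relation \<open>Q\<close>.\<close>

definition prime_space ::
  "'r ring \<Rightarrow> (complex \<Rightarrow> 'r) \<Rightarrow> 'r set set \<Rightarrow> 'r set \<Rightarrow> ('r \<times> 'r) set \<Rightarrow>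
    ('r set, 'r set \<Rightarrow> ('r \<times> 'r) set) cspace" where
  "prime_space R k P F Q =
    (let T = topology_generated_by {{p \<in> P. f \<notin> p} | f. f \<in> F};
         L = (\<lambda>p. localization R (carrier R - p))
     in \<lparr>pts = T,
         sec = (\<lambda>U.
           \<lparr>carrier = {g \<in> (\<Pi>\<^sub>E p\<in>U. carrier (L p)). \<forall>p\<in>U. \<exists>V. openin T V \<and> p \<in> V \<and> V \<subseteq> U \<and>
               (\<exists>(a, s)\<in>Q. \<forall>q\<in>V. s \<notin> q \<and> g q = frac R (carrier R - q) a s)},
            mult = (\<lambda>g h. \<lambda>p\<in>U. g p \<otimes>\<^bsub>L p\<^esub> h p),
            one = (\<lambda>p\<in>U. \<one>\<^bsub>L p\<^esub>),
            ring.zero = (\<lambda>p\<in>U. \<zero>\<^bsub>L p\<^esub>),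
            ring.add = (\<lambda>g h. \<lambda>p\<in>U. g p \<oplus>\<^bsub>L p\<^esub> h p)\<rparr>),
         res = (\<lambda>U V g. restrict g V),
         cst = (\<lambda>U c. \<lambda>p\<in>U. frac R (carrier R - p) (k c) \<one>\<^bsub>R\<^esub>)\<rparr>)"

definition Spec ::
  "'r ring \<Rightarrow> (complex \<Rightarrow> 'r) \<Rightarrow> ('r set, 'r set \<Rightarrow> ('r \<times> 'r) set) cspace" where
  "Spec R k = prime_space R k {p. primeideal p R} (carrier R) (carrier R \<times> carrier R)"

text \<open>If \<open>U\<close> is isomorphic to the spectrum of some \<open>\<complex>\<close>-algebra, that algebra is isomorphic to the
  algebra of sections over \<open>U\<close>.\<close>

definition affine_open :: "('a, 'r) cspace \<Rightarrow> 'a set \<Rightarrow> bool" where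
  "affine_open X U \<longleftrightarrow> openin (pts X) U \<and>
    (\<exists>f fs. isomorphism (open_sub X U) (Spec (sec X U) (cst X U)) f fs)"

definition noetherian_space :: "('a, 'r) cspace \<Rightarrow> bool" where
  "noetherian_space X \<longleftrightarrow> (\<exists>\<U>. finite \<U> \<and> points X = \<Union>\<U> \<and>
     (\<forall>U\<in>\<U>. affine_open X U \<and> noetherian_ring (sec X U)))"

text \<open>The diagonal of \<open>X\<close> over \<open>\<complex>\<close> is a closed immersion, as expressed on the affine open subsets
  \<open>U \<times> V\<close> of \<open>X \<times> X\<close>, whose preimage is \<open>U \<inter> V\<close>: \<open>U \<inter> V\<close> is affine and
  \<open>\<O>(U) \<otimes> \<O>(V) \<rightarrow> \<O>(U \<inter> V)\<close> is surjective.\<close>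

definition separated_space :: "('a, 'r) cspace \<Rightarrow> bool" where
  "separated_space X \<longleftrightarrow> (\<forall>U V. affine_open X U \<and> affine_open X V \<longrightarrow>
     affine_open X (U \<inter> V) \<and>
     generate_ring (sec X (U \<inter> V))
       (res X U (U \<inter> V) ` carrier (sec X U) \<union> res X V (U \<inter> V) ` carrier (sec X V))
     = carrier (sec X (U \<inter> V)))"

definition cscheme :: "('a, 'r) cspace \<Rightarrow> bool" where
  "cscheme X \<longleftrightarrow> ringed_cspace X \<and> (\<forall>p\<in>points X. \<exists>U. affine_open X U \<and> p \<in> U) \<and>
     noetherian_space X \<and> separated_space X"

definition finite_type :: "('a, 'r) cspace \<Rightarrow> bool" where
  "finite_type X \<longleftrightarrow> (\<exists>\<U>. finite \<U> \<and> points X = \<Union>\<U> \<and>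
     (\<forall>U\<in>\<U>. affine_open X U \<and> (\<exists>S. finite S \<and> S \<subseteq> carrier (sec X U) \<and>
        generate_ring (sec X U) (range (cst X U) \<union> S) = carrier (sec X U))))"

definition integral_space :: "('a, 'r) cspace \<Rightarrow> bool" where
  "integral_space X \<longleftrightarrow> points X \<noteq> {} \<and>
     (\<forall>U. openin (pts X) U \<and> U \<noteq> {} \<longrightarrow> domain (sec X U))"

definition variety :: "('a, 'r) cspace \<Rightarrow> bool" where
  "variety X \<longleftrightarrow> cscheme X \<and> finite_type X \<and> integral_space X"

definition irreducible_closed :: "'a topology \<Rightarrow> 'a set \<Rightarrow> bool" where
  "irreducible_closed T Z \<longleftrightarrow> closedin T Z \<and> Z \<noteq> {} \<and>
     (\<forall>A B. closedin T A \<and> closedin T B \<and> Z \<subseteq> A \<union> B \<longrightarrow> Z \<subseteq> A \<or> Z \<subseteq> B)"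

definition space_dim :: "'a topology \<Rightarrow> enat" where
  "space_dim T = Sup {enat n | n. \<exists>Z. (\<forall>i\<le>n. irreducible_closed T (Z i)) \<and>
     (\<forall>i<n. Z i \<subset> Z (Suc i))}"

definition krull_dim :: "'r ring \<Rightarrow> enat" where
  "krull_dim R = Sup {enat n | n. \<exists>P. (\<forall>i\<le>n. primeideal (P i) R) \<and> (\<forall>i<n. P i \<subset> P (Suc i))}"

definition regular_local :: "'r ring \<Rightarrow> bool" where
  "regular_local R \<longleftrightarrow> cring R \<and> noetherian_ring R \<and> (\<exists>!m. maximalideal m R) \<and>
     (\<exists>S. finite S \<and> S \<subseteq> carrier R \<and> maximalideal (Idl\<^bsub>R\<^esub> S) R \<and> enat (card S) = krull_dim R)"

definition regular_sequence :: "'r ring \<Rightarrow> 'r list \<Rightarrow> bool" where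
  "regular_sequence R xs \<longleftrightarrow> (\<forall>i<length xs. \<forall>a\<in>carrier R.
     xs ! i \<otimes>\<^bsub>R\<^esub> a \<in> Idl\<^bsub>R\<^esub> (set (take i xs)) \<longrightarrow> a \<in> Idl\<^bsub>R\<^esub> (set (take i xs)))"

definition cohen_macaulay_local :: "'r ring \<Rightarrow> bool" where
  "cohen_macaulay_local R \<longleftrightarrow> cring R \<and> noetherian_ring R \<and> (\<exists>!m. maximalideal m R) \<and>
     (\<exists>xs m. maximalideal m R \<and> set xs \<subseteq> m \<and> regular_sequence R xs \<and>
        enat (length xs) = krull_dim R)"

text \<open>Over the field \<open>\<complex>\<close>, smooth means that the local rings are regular.\<close>

definition smooth_variety :: "('a, 'r) cspace \<Rightarrow> bool" where
  "smooth_variety X \<longleftrightarrow> variety X \<and> (\<forall>p\<in>points X. regular_local (local_ring X p))"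

definition cohen_macaulay :: "('a, 'r) cspace \<Rightarrow> bool" where
  "cohen_macaulay X \<longleftrightarrow> (\<forall>p\<in>points X. cohen_macaulay_local (local_ring X p))"

type_synonym cpoly = "(nat \<Rightarrow>\<^sub>0 nat) \<Rightarrow>\<^sub>0 complex"

definition poly_ring :: "nat \<Rightarrow> cpoly ring" where
  "poly_ring n = type_ring {f. \<forall>m\<in>Poly_Mapping.keys f. Poly_Mapping.keys m \<subseteq> {..n}}"

definition homogeneous :: "nat \<Rightarrow> cpoly \<Rightarrow> bool" where
  "homogeneous d f \<longleftrightarrow>
     (\<forall>m\<in>Poly_Mapping.keys f. (\<Sum>i\<in>Poly_Mapping.keys m. Poly_Mapping.lookup m i) = d)"

text \<open>\<open>projective_space n\<close> is Proj of the polynomial ring \<open>S = \<complex>[x\<^sub>0, \<dots>, x\<^sub>n]\<close>. As \<open>S\<close> is a domain, the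
  homogeneous localization of \<open>S\<close> at \<open>p\<close> is a subring of the full localization at \<open>p\<close>; its elements are
  singled out by requiring sections to be locally fractions of two forms of the same degree.\<close>

definition projective_space :: "nat \<Rightarrow> (cpoly set, cpoly set \<Rightarrow> (cpoly \<times> cpoly) set) cspace" where
  "projective_space n = prime_space (poly_ring n) (Poly_Mapping.single 0)
     {p. primeideal p (poly_ring n) \<and>
         p = Idl\<^bsub>poly_ring n\<^esub> {f \<in> p. \<exists>d. homogeneous d f} \<and>
         \<not> {f \<in> carrier (poly_ring n). \<exists>d>0. homogeneous d f} \<subseteq> p}
     {f \<in> carrier (poly_ring n). \<exists>d. homogeneous d f}
     {(a, s). a \<in> carrier (poly_ring n) \<and> s \<in> carrier (poly_ring n) \<and>
        (\<exists>d. homogeneous d a \<and> homogeneous d s)}"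

definition projective :: "('a, 'r) cspace \<Rightarrow> bool" where
  "projective X \<longleftrightarrow> (\<exists>n f fs. closed_immersion X (projective_space n) f fs)"

section \<open>Sheaves of modules\<close>

text \<open>The fields \<open>mult\<close> and \<open>one\<close>, which module records inherit from ring records, play no role and
  are left undefined throughout.\<close>

record ('a, 'r, 'm) omod =
  msec :: "'a set \<Rightarrow> ('r, 'm) module"
  mres :: "'a set \<Rightarrow> 'a set \<Rightarrow> 'm \<Rightarrow> 'm"

text \<open>The sheaf whose sections over \<open>U\<close> are the families of maps \<open>S V \<rightarrow> \<O>(V)\<close>, for \<open>V \<subseteq> U\<close> open, which
  are compatible with restrictions and satisfy \<open>P V\<close>. It specializes to the tangent sheaf (derivations
  of \<open>\<O>\<close> over \<open>\<complex>\<close>) and to the dual of an ideal sheaf.\<close>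

definition map_sheaf ::
  "('a, 'r) cspace \<Rightarrow> ('a set \<Rightarrow> 'r set) \<Rightarrow> ('a set \<Rightarrow> ('r \<Rightarrow> 'r) \<Rightarrow> bool) \<Rightarrow>
    ('a, 'r, 'a set \<Rightarrow> 'r \<Rightarrow> 'r) omod" where
  "map_sheaf X S P =
    \<lparr>msec = (\<lambda>U.
      \<lparr>carrier = {D \<in> (\<Pi>\<^sub>E V\<in>opens_in X U. S V \<rightarrow>\<^sub>E carrier (sec X V)).
          \<forall>V\<in>opens_in X U. P V (D V) \<and>
            (\<forall>W\<in>opens_in X V. \<forall>s\<in>S V. D W (res X V W s) = res X V W (D V s))},
       mult = undefined, one = undefined,
       ring.zero = (\<lambda>V\<in>opens_in X U. \<lambda>s\<in>S V. \<zero>\<^bsub>sec X V\<^esub>),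
       ring.add = (\<lambda>D E. \<lambda>V\<in>opens_in X U. \<lambda>s\<in>S V. D V s \<oplus>\<^bsub>sec X V\<^esub> E V s),
       smult = (\<lambda>r D. \<lambda>V\<in>opens_in X U. \<lambda>s\<in>S V. res X U V r \<otimes>\<^bsub>sec X V\<^esub> D V s)\<rparr>),
     mres = (\<lambda>U V D. restrict D (opens_in X V))\<rparr>"

definition tangent_sheaf :: "('a, 'r) cspace \<Rightarrow> ('a, 'r, 'a set \<Rightarrow> 'r \<Rightarrow> 'r) omod" where
  "tangent_sheaf X = map_sheaf X (\<lambda>V. carrier (sec X V))
    (\<lambda>V D. (\<forall>a\<in>carrier (sec X V). \<forall>b\<in>carrier (sec X V).
        D (a \<oplus>\<^bsub>sec X V\<^esub> b) = D a \<oplus>\<^bsub>sec X V\<^esub> D b \<and>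
        D (a \<otimes>\<^bsub>sec X V\<^esub> b) = a \<otimes>\<^bsub>sec X V\<^esub> D b \<oplus>\<^bsub>sec X V\<^esub> b \<otimes>\<^bsub>sec X V\<^esub> D a) \<and>
      (\<forall>c. D (cst X V c) = \<zero>\<^bsub>sec X V\<^esub>))"

definition ideal_module :: "('a, 'r) cspace \<Rightarrow> ('a set \<Rightarrow> 'r set) \<Rightarrow> ('a, 'r, 'r) omod" where
  "ideal_module X J =
    \<lparr>msec = (\<lambda>U. \<lparr>carrier = J U, mult = undefined, one = undefined, ring.zero = ring.zero (sec X U),
       ring.add = ring.add (sec X U), smult = mult (sec X U)\<rparr>),
     mres = res X\<rparr>"

text \<open>The dual of the ideal sheaf \<open>J\<close>, i.e. \<open>\<O>(H)\<close> when \<open>J\<close> is the ideal sheaf of \<open>H\<close>; its canonical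
  section is the inclusion of \<open>J\<close> into \<open>\<O>\<close>.\<close>

definition dual_ideal :: "('a, 'r) cspace \<Rightarrow> ('a set \<Rightarrow> 'r set) \<Rightarrow> ('a, 'r, 'a set \<Rightarrow> 'r \<Rightarrow> 'r) omod" where
  "dual_ideal X J = map_sheaf X J
    (\<lambda>V h. \<forall>s\<in>J V. (\<forall>t\<in>J V. h (s \<oplus>\<^bsub>sec X V\<^esub> t) = h s \<oplus>\<^bsub>sec X V\<^esub> h t) \<and>
      (\<forall>r\<in>carrier (sec X V). h (r \<otimes>\<^bsub>sec X V\<^esub> s) = r \<otimes>\<^bsub>sec X V\<^esub> h s))"

definition canonical_section :: "('a, 'r) cspace \<Rightarrow> ('a set \<Rightarrow> 'r set) \<Rightarrow> 'a set \<Rightarrow> 'a set \<Rightarrow> 'r \<Rightarrow> 'r" where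
  "canonical_section X J U = (\<lambda>V\<in>opens_in X U. \<lambda>s\<in>J V. s)"

definition trivialization ::
  "('a, 'r) cspace \<Rightarrow> ('a, 'r, 'm) omod \<Rightarrow> 'a set \<Rightarrow> ('a set \<Rightarrow> 'm \<Rightarrow> 'r) \<Rightarrow> bool" where
  "trivialization X M U a \<longleftrightarrow> (\<forall>V\<in>opens_in X U.
     bij_betw (a V) (carrier (msec M V)) (carrier (sec X V)) \<and>
     (\<forall>m\<in>carrier (msec M V).
        (\<forall>n\<in>carrier (msec M V). a V (m \<oplus>\<^bsub>msec M V\<^esub> n) = a V m \<oplus>\<^bsub>sec X V\<^esub> a V n) \<and>
        (\<forall>r\<in>carrier (sec X V). a V (r \<odot>\<^bsub>msec M V\<^esub> m) = r \<otimes>\<^bsub>sec X V\<^esub> a V m) \<and>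
        (\<forall>W\<in>opens_in X V. a W (mres M V W m) = res X V W (a V m))))"

text \<open>For a trivialization \<open>a\<close>, the section \<open>a\<inverse>(1)\<close> over \<open>V\<close>.\<close>

definition triv_frame ::
  "('a, 'r) cspace \<Rightarrow> ('a, 'r, 'm) omod \<Rightarrow> ('a set \<Rightarrow> 'm \<Rightarrow> 'r) \<Rightarrow> 'a set \<Rightarrow> 'm" where
  "triv_frame X M a V = inv_into (carrier (msec M V)) (a V) \<one>\<^bsub>sec X V\<^esub>"

subsection \<open>Tensor products\<close>

definition tensor_rel ::
  "'r ring \<Rightarrow> ('r, 'm) module \<Rightarrow> ('r, 'n) module \<Rightarrow> ('m \<times> 'n \<Rightarrow>\<^sub>0 int) set" where
  "tensor_rel R M N = generate (free_Abelian_group (carrier M \<times> carrier N))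
    ({frag_of (m \<oplus>\<^bsub>M\<^esub> m', n) - frag_of (m, n) - frag_of (m', n) | m m' n.
        m \<in> carrier M \<and> m' \<in> carrier M \<and> n \<in> carrier N} \<union>
     {frag_of (m, n \<oplus>\<^bsub>N\<^esub> n') - frag_of (m, n) - frag_of (m, n') | m n n'.
        m \<in> carrier M \<and> n \<in> carrier N \<and> n' \<in> carrier N} \<union>
     {frag_of (r \<odot>\<^bsub>M\<^esub> m, n) - frag_of (m, r \<odot>\<^bsub>N\<^esub> n) | r m n.
        r \<in> carrier R \<and> m \<in> carrier M \<and> n \<in> carrier N})"

definition tensor_class ::
  "'r ring \<Rightarrow> ('r, 'm) module \<Rightarrow> ('r, 'n) module \<Rightarrow> ('m \<times> 'n \<Rightarrow>\<^sub>0 int) \<Rightarrow> ('m \<times> 'n \<Rightarrow>\<^sub>0 int) set" where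
  "tensor_class R M N c = tensor_rel R M N #>\<^bsub>free_Abelian_group (carrier M \<times> carrier N)\<^esub> c"

text \<open>The map into \<open>M \<otimes> N\<close> which sends each \<open>m \<otimes> n\<close> to \<open>f m \<otimes> g n\<close>.\<close>

definition tensor_map ::
  "'r ring \<Rightarrow> ('r, 'm) module \<Rightarrow> ('r, 'n) module \<Rightarrow> ('k \<Rightarrow> 'm) \<Rightarrow> ('l \<Rightarrow> 'n) \<Rightarrow>
    ('k \<times> 'l \<Rightarrow>\<^sub>0 int) set \<Rightarrow> ('m \<times> 'n \<Rightarrow>\<^sub>0 int) set" where
  "tensor_map R M N f g K =
    (\<Union>c\<in>K. tensor_class R M N (frag_extend (\<lambda>(m, n). frag_of (f m, g n)) c))"

definition tensor_module ::
  "'r ring \<Rightarrow> ('r, 'm) module \<Rightarrow> ('r, 'n) module \<Rightarrow> ('r, ('m \<times> 'n \<Rightarrow>\<^sub>0 int) set) module" where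
  "tensor_module R M N =
    \<lparr>carrier = tensor_class R M N ` carrier (free_Abelian_group (carrier M \<times> carrier N)),
     mult = undefined, one = undefined,
     ring.zero = tensor_class R M N 0,
     ring.add = (\<lambda>K L. \<Union>c\<in>K. \<Union>d\<in>L. tensor_class R M N (c + d)),
     smult = (\<lambda>r. tensor_map R M N (\<lambda>m. r \<odot>\<^bsub>M\<^esub> m) (\<lambda>n. n))\<rparr>"

definition tensor_presheaf ::
  "('a, 'r) cspace \<Rightarrow> ('a, 'r, 'm) omod \<Rightarrow> ('a, 'r, 'n) omod \<Rightarrow>
    ('a, 'r, ('m \<times> 'n \<Rightarrow>\<^sub>0 int) set) omod" where
  "tensor_presheaf X M N =
    \<lparr>msec = (\<lambda>U. tensor_module (sec X U) (msec M U) (msec N U)),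
     mres = (\<lambda>U V. tensor_map (sec X V) (msec M V) (msec N V) (mres M U V) (mres N U V))\<rparr>"

definition mgerm ::
  "('a, 'r) cspace \<Rightarrow> ('a, 'r, 'm) omod \<Rightarrow> 'a \<Rightarrow> 'a set \<Rightarrow> 'm \<Rightarrow> ('a set \<times> 'm) set" where
  "mgerm X M = germ (pts X) (\<lambda>U. carrier (msec M U)) (mres M)"

definition sheafify ::
  "('a, 'r) cspace \<Rightarrow> ('a, 'r, 'm) omod \<Rightarrow> ('a, 'r, 'a \<Rightarrow> ('a set \<times> 'm) set) omod" where
  "sheafify X M =
    \<lparr>msec = (\<lambda>U.
      \<lparr>carrier = {s. s \<in> extensional U \<and> (\<forall>p\<in>U. \<exists>V\<in>opens_in X U. p \<in> V \<and>
          (\<exists>t\<in>carrier (msec M V). \<forall>q\<in>V. s q = mgerm X M q V t))},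
       mult = undefined, one = undefined,
       ring.zero = (\<lambda>p\<in>U. mgerm X M p U \<zero>\<^bsub>msec M U\<^esub>),
       ring.add = (\<lambda>s s'. \<lambda>p\<in>U. \<Union>(V, t)\<in>s p. \<Union>(W, t')\<in>s' p.
          mgerm X M p (V \<inter> W) (mres M V (V \<inter> W) t \<oplus>\<^bsub>msec M (V \<inter> W)\<^esub> mres M W (V \<inter> W) t')),
       smult = (\<lambda>r s. \<lambda>p\<in>U. \<Union>(V, t)\<in>s p.
          mgerm X M p (U \<inter> V) (res X U (U \<inter> V) r \<odot>\<^bsub>msec M (U \<inter> V)\<^esub> mres M V (U \<inter> V) t))\<rparr>),
     mres = (\<lambda>U V s. restrict s V)\<rparr>"

definition tensor_sheaf ::
  "('a, 'r) cspace \<Rightarrow> ('a, 'r, 'm) omod \<Rightarrow> ('a, 'r, 'n) omod \<Rightarrow>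
    ('a, 'r, 'a \<Rightarrow> ('a set \<times> ('m \<times> 'n \<Rightarrow>\<^sub>0 int) set) set) omod" where
  "tensor_sheaf X M N = sheafify X (tensor_presheaf X M N)"

text \<open>The section \<open>m \<otimes> n\<close> over \<open>U\<close>.\<close>

definition tensor_section ::
  "('a, 'r) cspace \<Rightarrow> ('a, 'r, 'm) omod \<Rightarrow> ('a, 'r, 'n) omod \<Rightarrow> 'a set \<Rightarrow> 'm \<Rightarrow> 'n \<Rightarrow>
    'a \<Rightarrow> ('a set \<times> ('m \<times> 'n \<Rightarrow>\<^sub>0 int) set) set" where
  "tensor_section X M N U m n = (\<lambda>p\<in>U. mgerm X (tensor_presheaf X M N) p U
     (tensor_class (sec X U) (msec M U) (msec N U) (frag_of (m, n))))"

text \<open>The morphism into \<open>M \<otimes> N\<close> induced by morphisms \<open>f\<close>, \<open>g\<close> into \<open>M\<close> and \<open>N\<close>.\<close>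

definition tensor_morphism ::
  "('a, 'r) cspace \<Rightarrow> ('a, 'r, 'm) omod \<Rightarrow> ('a, 'r, 'n) omod \<Rightarrow>
    ('a set \<Rightarrow> 'k \<Rightarrow> 'm) \<Rightarrow> ('a set \<Rightarrow> 'l \<Rightarrow> 'n) \<Rightarrow> 'a set \<Rightarrow>
    ('a \<Rightarrow> ('a set \<times> ('k \<times> 'l \<Rightarrow>\<^sub>0 int) set) set) \<Rightarrow>
    ('a \<Rightarrow> ('a set \<times> ('m \<times> 'n \<Rightarrow>\<^sub>0 int) set) set)" where
  "tensor_morphism X M N f g U s = (\<lambda>p\<in>U. \<Union>(V, K)\<in>s p.
     mgerm X (tensor_presheaf X M N) p V
       (tensor_map (sec X V) (msec M V) (msec N V) (f V) (g V) K))"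

subsection \<open>First cohomology\<close>

text \<open>\<open>H\<^sup>1\<close> is the Cech cohomology, i.e. the colimit over all open covers (which is sheaf cohomology
  in degree one). Covers indexed by the points of \<open>X\<close> are cofinal, so a cohomology class is realized
  as the set of all cocycles on such covers that become cohomologous on a common refinement; a cocycle
  on a cover with an arbitrary index set determines such a class.\<close>

definition open_cover :: "('a, 'r) cspace \<Rightarrow> 'i set \<Rightarrow> ('i \<Rightarrow> 'a set) \<Rightarrow> bool" where
  "open_cover X I U \<longleftrightarrow> (\<forall>i\<in>I. openin (pts X) (U i)) \<and> (\<Union>i\<in>I. U i) = points X"

definition cech_cocycle ::
  "('a, 'r) cspace \<Rightarrow> ('a, 'r, 'm) omod \<Rightarrow> 'i set \<Rightarrow> ('i \<Rightarrow> 'a set) \<Rightarrow> ('i \<Rightarrow> 'i \<Rightarrow> 'm) \<Rightarrow> bool" where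
  "cech_cocycle X M I U c \<longleftrightarrow> open_cover X I U \<and>
    (\<forall>i\<in>I. \<forall>j\<in>I. c i j \<in> carrier (msec M (U i \<inter> U j))) \<and>
    (\<forall>i\<in>I. \<forall>j\<in>I. \<forall>k\<in>I. let W = U i \<inter> U j \<inter> U k in
       mres M (U i \<inter> U j) W (c i j) \<oplus>\<^bsub>msec M W\<^esub> mres M (U j \<inter> U k) W (c j k)
       = mres M (U i \<inter> U k) W (c i k))"

definition cech_cohomologous ::
  "('a, 'r) cspace \<Rightarrow> ('a, 'r, 'm) omod \<Rightarrow>
    'i set \<Rightarrow> ('i \<Rightarrow> 'a set) \<Rightarrow> ('i \<Rightarrow> 'i \<Rightarrow> 'm) \<Rightarrow>
    'j set \<Rightarrow> ('j \<Rightarrow> 'a set) \<Rightarrow> ('j \<Rightarrow> 'j \<Rightarrow> 'm) \<Rightarrow> bool" where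
  "cech_cohomologous X M I U c J V d \<longleftrightarrow>
    cech_cocycle X M I U c \<and> cech_cocycle X M J V d \<and>
    (\<exists>W s t b.
      (\<forall>p\<in>points X. openin (pts X) (W p) \<and> p \<in> W p \<and> s p \<in> I \<and> W p \<subseteq> U (s p) \<and>
         t p \<in> J \<and> W p \<subseteq> V (t p) \<and> b p \<in> carrier (msec M (W p))) \<and>
      (\<forall>p\<in>points X. \<forall>q\<in>points X. let P = W p \<inter> W q in
         mres M (U (s p) \<inter> U (s q)) P (c (s p) (s q)) \<oplus>\<^bsub>msec M P\<^esub> mres M (W q) P (b q)
         = mres M (V (t p) \<inter> V (t q)) P (d (t p) (t q)) \<oplus>\<^bsub>msec M P\<^esub> mres M (W p) P (b p)))"

type_synonym ('a, 'm) cech_class = "(('a \<Rightarrow> 'a set) \<times> ('a \<Rightarrow> 'a \<Rightarrow> 'm)) set"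

definition cech_class ::
  "('a, 'r) cspace \<Rightarrow> ('a, 'r, 'm) omod \<Rightarrow> 'i set \<Rightarrow> ('i \<Rightarrow> 'a set) \<Rightarrow> ('i \<Rightarrow> 'i \<Rightarrow> 'm) \<Rightarrow>
    ('a, 'm) cech_class" where
  "cech_class X M I U c = {(V, d). cech_cohomologous X M I U c (points X) V d}"

definition H1 :: "('a, 'r) cspace \<Rightarrow> ('a, 'r, 'm) omod \<Rightarrow> ('a, 'm) cech_class set" where
  "H1 X M = {cech_class X M (points X) V d | V d. cech_cocycle X M (points X) V d}"

text \<open>The map from \<open>H1\<close> to \<open>H1 X N\<close> induced by a sheaf morphism \<open>f\<close> into \<open>N\<close>.\<close>

definition H1_map ::
  "('a, 'r) cspace \<Rightarrow> ('a, 'r, 'n) omod \<Rightarrow> ('a set \<Rightarrow> 'm \<Rightarrow> 'n) \<Rightarrow>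
    ('a, 'm) cech_class \<Rightarrow> ('a, 'n) cech_class" where
  "H1_map X N f A =
    (\<Union>(V, d)\<in>A. cech_class X N (points X) V (\<lambda>p q. f (V p \<inter> V q) (d p q)))"

section \<open>Primitive double schemes\<close>

text \<open>\<open>primitive_double_scheme X XX \<rho>\<close>: \<open>XX\<close> is a primitive double scheme with reduced scheme \<open>X\<close>. The
  two schemes have the same underlying space, and \<open>\<rho>\<close> is the surjection of structure sheaves defining
  the inclusion of \<open>X\<close> in \<open>XX\<close>. Connectedness of \<open>X\<close> is part of \<open>variety\<close>. A variety over \<open>\<complex>\<close> has
  at most continuum many points, and its rings of sections have at most the cardinality of the
  continuum; hence letting \<open>M\<close> range over the varieties whose points and sections are represented by
  complex numbers covers all varieties up to isomorphism.\<close>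

definition primitive_double_scheme ::
  "('a, 'r) cspace \<Rightarrow> ('a, 's) cspace \<Rightarrow> ('a set \<Rightarrow> 's \<Rightarrow> 'r) \<Rightarrow> bool" where
  "primitive_double_scheme X XX \<rho> \<longleftrightarrow>
    cscheme XX \<and> cohen_macaulay XX \<and> smooth_variety X \<and>
    pts XX = pts X \<and> closed_immersion X XX (\<lambda>p. p) \<rho> \<and>
    (\<forall>p. closedin (pts X) {p} \<longrightarrow> (\<exists>U. openin (pts X) U \<and> p \<in> U \<and>
       (\<exists>(M :: (complex, complex) cspace) f fs.
          smooth_variety M \<and> space_dim (pts M) = space_dim (pts X) + 1 \<and>
          closed_immersion (open_sub XX U) M f fs))) \<and>
    (\<exists>U. openin (pts X) U \<and> ideal_sheaf X XX (\<lambda>p. p) \<rho> U \<noteq> {\<zero>\<^bsub>sec XX U\<^esub>}) \<and>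
    (\<forall>U. openin (pts X) U \<longrightarrow>
       (\<forall>a\<in>ideal_sheaf X XX (\<lambda>p. p) \<rho> U. \<forall>b\<in>ideal_sheaf X XX (\<lambda>p. p) \<rho> U.
          a \<otimes>\<^bsub>sec XX U\<^esub> b = \<zero>\<^bsub>sec XX U\<^esub>))"

text \<open>The ideal sheaf of \<open>X\<close> in \<open>XX\<close> as a sheaf of modules over \<open>X\<close>: \<open>r m\<close> is the section which is
  locally the product of \<open>m\<close> with any lift of \<open>r\<close> to \<open>XX\<close>.\<close>

definition associated_line_bundle ::
  "('a, 'r) cspace \<Rightarrow> ('a, 's) cspace \<Rightarrow> ('a set \<Rightarrow> 's \<Rightarrow> 'r) \<Rightarrow> ('a, 'r, 's) omod" where
  "associated_line_bundle X XX \<rho> =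
    \<lparr>msec = (\<lambda>U.
      \<lparr>carrier = ideal_sheaf X XX (\<lambda>p. p) \<rho> U, mult = undefined, one = undefined,
       ring.zero = ring.zero (sec XX U), ring.add = ring.add (sec XX U),
       smult = (\<lambda>r m. THE n. n \<in> ideal_sheaf X XX (\<lambda>p. p) \<rho> U \<and>
          (\<forall>V\<in>opens_in X U. \<forall>b\<in>carrier (sec XX V). \<rho> V b = res X U V r \<longrightarrow>
             res XX U V n = b \<otimes>\<^bsub>sec XX V\<^esub> res XX U V m))\<rparr>),
     mres = res XX\<rparr>"

definition hypersurface ::
  "('a, 'r) cspace \<Rightarrow> ('h, 'k) cspace \<Rightarrow> ('h \<Rightarrow> 'a) \<Rightarrow> ('a set \<Rightarrow> 'r \<Rightarrow> 'k) \<Rightarrow> bool" where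
  "hypersurface X H h hs \<longleftrightarrow> cscheme H \<and> closed_immersion H X h hs \<and>
    (\<forall>p\<in>points X. \<exists>U a. openin (pts X) U \<and> p \<in> U \<and>
       trivialization X (ideal_module X (ideal_sheaf H X h hs)) U a)"

definition generates_ideal ::
  "('a, 'r) cspace \<Rightarrow> ('a set \<Rightarrow> 'r set) \<Rightarrow> 'a set \<Rightarrow> 'r \<Rightarrow> bool" where
  "generates_ideal X J U x \<longleftrightarrow> x \<in> carrier (sec X U) \<and>
    (\<forall>V\<in>opens_in X U. J V = PIdl\<^bsub>sec X V\<^esub> (res X U V x))"

text \<open>The ring \<open>R[t]/(t\<^sup>2)\<close>; the pair \<open>(u, v)\<close> stands for \<open>u + v t\<close>.\<close>

definition dual_numbers :: "'r ring \<Rightarrow> ('r \<times> 'r) ring" where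
  "dual_numbers R =
    \<lparr>carrier = carrier R \<times> carrier R,
     mult = (\<lambda>(a, b) (c, d). (a \<otimes>\<^bsub>R\<^esub> c, a \<otimes>\<^bsub>R\<^esub> d \<oplus>\<^bsub>R\<^esub> b \<otimes>\<^bsub>R\<^esub> c)),
     one = (\<one>\<^bsub>R\<^esub>, \<zero>\<^bsub>R\<^esub>), ring.zero = (\<zero>\<^bsub>R\<^esub>, \<zero>\<^bsub>R\<^esub>),
     ring.add = (\<lambda>(a, b) (c, d). (a \<oplus>\<^bsub>R\<^esub> c, b \<oplus>\<^bsub>R\<^esub> d))\<rparr>"

definition times_Z2 :: "('a, 'r) cspace \<Rightarrow> ('a, 'r \<times> 'r) cspace" where
  "times_Z2 X = \<lparr>pts = pts X, sec = (\<lambda>U. dual_numbers (sec X U)),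
     res = (\<lambda>U V. map_prod (res X U V) (res X U V)), cst = (\<lambda>U c. (cst X U c, \<zero>\<^bsub>sec X U\<^esub>))\<rparr>"

text \<open>\<open>d\<close> is the comorphism of an isomorphism of the open subscheme of \<open>XX\<close> on \<open>U\<close> with \<open>U \<times> Z\<^sub>2\<close> which
  induces the identity on \<open>U\<close>.\<close>

definition split_chart ::
  "('a, 'r) cspace \<Rightarrow> ('a, 's) cspace \<Rightarrow> ('a set \<Rightarrow> 's \<Rightarrow> 'r) \<Rightarrow> 'a set \<Rightarrow>
    ('a set \<Rightarrow> 'r \<times> 'r \<Rightarrow> 's) \<Rightarrow> bool" where
  "split_chart X XX \<rho> U d \<longleftrightarrow>
    isomorphism (open_sub XX U) (times_Z2 (open_sub X U)) (\<lambda>p. p) d \<and>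
    (\<forall>V\<in>opens_in X U. \<forall>u\<in>carrier (sec X V). \<forall>v\<in>carrier (sec X V). \<rho> V (d V (u, v)) = u)"

definition transition ::
  "('a, 'r) cspace \<Rightarrow> ('i \<Rightarrow> 'a set \<Rightarrow> 'r \<times> 'r \<Rightarrow> 's) \<Rightarrow> 'i \<Rightarrow> 'i \<Rightarrow> 'a set \<Rightarrow> 'r \<times> 'r \<Rightarrow> 'r \<times> 'r" where
  "transition X \<delta> i j V w =
    inv_into (carrier (dual_numbers (sec X V))) (\<delta> i V) (\<delta> j V w)"

text \<open>With \<open>\<delta>\<^sub>i\<^sub>j\<close> the transition automorphism, \<open>\<delta>\<^sub>i\<^sub>j(u) = u + D\<^sub>i\<^sub>j(u) t\<close> and \<open>\<delta>\<^sub>i\<^sub>j(t) = \<alpha>\<^sub>i\<^sub>j t\<close>; \<open>D\<^sub>i\<^sub>j\<close> is given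
  on all open subsets of \<open>U\<^sub>i \<inter> U\<^sub>j\<close>, as a section of the tangent sheaf over \<open>U\<^sub>i \<inter> U\<^sub>j\<close>.\<close>

definition transition_der ::
  "('a, 'r) cspace \<Rightarrow> ('i \<Rightarrow> 'a set) \<Rightarrow> ('i \<Rightarrow> 'a set \<Rightarrow> 'r \<times> 'r \<Rightarrow> 's) \<Rightarrow> 'i \<Rightarrow> 'i \<Rightarrow> 'a set \<Rightarrow> 'r \<Rightarrow> 'r" where
  "transition_der X U \<delta> i j = (\<lambda>V\<in>opens_in X (U i \<inter> U j). \<lambda>u\<in>carrier (sec X V).
     snd (transition X \<delta> i j V (u, \<zero>\<^bsub>sec X V\<^esub>)))"

definition transition_unit ::
  "('a, 'r) cspace \<Rightarrow> ('i \<Rightarrow> 'a set) \<Rightarrow> ('i \<Rightarrow> 'a set \<Rightarrow> 'r \<times> 'r \<Rightarrow> 's) \<Rightarrow> 'i \<Rightarrow> 'i \<Rightarrow> 'r" where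
  "transition_unit X U \<delta> i j = (let V = U i \<inter> U j in
     snd (transition X \<delta> i j V (\<zero>\<^bsub>sec X V\<^esub>, \<one>\<^bsub>sec X V\<^esub>)))"

text \<open>The endomorphism \<open>u + v t \<mapsto> u + x v t\<close>.\<close>

definition chi :: "'r ring \<Rightarrow> 'r \<Rightarrow> 'r \<times> 'r \<Rightarrow> 'r \<times> 'r" where
  "chi R x = (\<lambda>(u, v). (u, x \<otimes>\<^bsub>R\<^esub> v))"

text \<open>\<open>B\<close>, with charts \<open>\<epsilon>\<^sub>i\<close>, is the blowing-up of \<open>XX\<close> along the hypersurface with local equations \<open>x\<^sub>i\<close>:
  the double scheme obtained by gluing the \<open>U\<^sub>i \<times> Z\<^sub>2\<close> along the automorphisms \<open>\<gamma>\<^sub>i\<^sub>j\<close> (the transitions of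
  the charts \<open>\<epsilon>\<^sub>i\<close>) such that \<open>\<gamma>\<^sub>i\<^sub>j \<circ> \<chi>\<^sub>x\<^sub>j = \<chi>\<^sub>x\<^sub>i \<circ> \<delta>\<^sub>i\<^sub>j\<close>.\<close>

definition blowing_up ::
  "('a, 'r) cspace \<Rightarrow> 'i set \<Rightarrow> ('i \<Rightarrow> 'a set) \<Rightarrow> ('i \<Rightarrow> 'r) \<Rightarrow>
    ('i \<Rightarrow> 'a set \<Rightarrow> 'r \<times> 'r \<Rightarrow> 's) \<Rightarrow>
    ('a, 'b) cspace \<Rightarrow> ('a set \<Rightarrow> 'b \<Rightarrow> 'r) \<Rightarrow> ('i \<Rightarrow> 'a set \<Rightarrow> 'r \<times> 'r \<Rightarrow> 'b) \<Rightarrow> bool" where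
  "blowing_up X I U x \<delta> B \<rho>B \<epsilon> \<longleftrightarrow>
    primitive_double_scheme X B \<rho>B \<and> (\<forall>i\<in>I. split_chart X B \<rho>B (U i) (\<epsilon> i)) \<and>
    (\<forall>i\<in>I. \<forall>j\<in>I. \<forall>V\<in>opens_in X (U i \<inter> U j). \<forall>w\<in>carrier (dual_numbers (sec X V)).
       transition X \<epsilon> i j V (chi (sec X V) (res X (U j) V (x j)) w)
       = chi (sec X V) (res X (U i) V (x i)) (transition X \<delta> i j V w))"

text \<open>The class in \<open>H\<^sup>1(X, T \<otimes> M)\<close> of the cocycle \<open>D\<^sub>i\<^sub>j \<otimes> \<beta>\<^sub>i\<inverse>(1)\<close>, for trivializations \<open>\<beta>\<^sub>i\<close> of \<open>M\<close>.\<close>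

definition represented_class ::
  "('a, 'r) cspace \<Rightarrow> ('a, 'r, 'm) omod \<Rightarrow> 'i set \<Rightarrow> ('i \<Rightarrow> 'a set) \<Rightarrow>
    ('i \<Rightarrow> 'a set \<Rightarrow> 'm \<Rightarrow> 'r) \<Rightarrow> ('i \<Rightarrow> 'i \<Rightarrow> 'a set \<Rightarrow> 'r \<Rightarrow> 'r) \<Rightarrow>
    ('a, 'a \<Rightarrow> ('a set \<times> (('a set \<Rightarrow> 'r \<Rightarrow> 'r) \<times> 'm \<Rightarrow>\<^sub>0 int) set) set) cech_class" where
  "represented_class X M I U \<beta> D =
    cech_class X (tensor_sheaf X (tangent_sheaf X) M) I U
      (\<lambda>i j. tensor_section X (tangent_sheaf X) M (U i \<inter> U j) (D i j)
               (triv_frame X M (\<beta> i) (U i \<inter> U j)))"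

text \<open>For a line bundle \<open>L\<close> and an ideal sheaf \<open>J\<close> with dual \<open>\<O>(H)\<close>, the morphism
  \<open>T \<otimes> L \<rightarrow> T \<otimes> (L \<otimes> \<O>(H))\<close> which tensors with the canonical section of \<open>\<O>(H)\<close>.\<close>

definition twist_morphism ::
  "('a, 'r) cspace \<Rightarrow> ('a, 'r, 'm) omod \<Rightarrow> ('a set \<Rightarrow> 'r set) \<Rightarrow> 'a set \<Rightarrow>
    ('a \<Rightarrow> ('a set \<times> (('a set \<Rightarrow> 'r \<Rightarrow> 'r) \<times> 'm \<Rightarrow>\<^sub>0 int) set) set) \<Rightarrow>
    ('a \<Rightarrow> ('a set \<times> (('a set \<Rightarrow> 'r \<Rightarrow> 'r) \<times>
      ('a \<Rightarrow> ('a set \<times> ('m \<times> ('a set \<Rightarrow> 'r \<Rightarrow> 'r) \<Rightarrow>\<^sub>0 int) set) set) \<Rightarrow>\<^sub>0 int) set) set)" where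
  "twist_morphism X L J =
    tensor_morphism X (tangent_sheaf X) (tensor_sheaf X L (dual_ideal X J))
      (\<lambda>V D. D) (\<lambda>V l. tensor_section X L (dual_ideal X J) V l (canonical_section X J V))"

end

theory Submission
  imports Defs
begin

text \<open>
Over an open subset of \<open>U\<^sub>i \<inter> U\<^sub>j\<close> the transition automorphism of the double scheme is
\<open>u + v t \<mapsto> u + (D\<^sub>i\<^sub>j(u) + \<alpha>\<^sub>i\<^sub>j v) t\<close>. Evaluating the relation \<open>\<gamma>\<^sub>i\<^sub>j \<circ> \<chi>\<^sub>x\<^sub>j = \<chi>\<^sub>x\<^sub>i \<circ> \<delta>\<^sub>i\<^sub>j\<close> which defines the
blowing-up at functions \<open>u\<close> without \<open>t\<close>, where \<open>\<chi>\<close> is the identity, gives \<open>E\<^sub>i\<^sub>j = x\<^sub>i D\<^sub>i\<^sub>j\<close>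
(\<open>transition_der_blowing_up\<close>).

On the other side, let \<open>f\<^sub>i = \<alpha>\<^sub>i\<inverse>(1)\<close> and \<open>g\<^sub>i = \<beta>\<^sub>i\<inverse>(1)\<close> be the frames of \<open>L\<close> and of \<open>L \<otimes> \<O>(H)\<close>. The canonical section
of \<open>\<O>(H)\<close> is the inclusion of the ideal of \<open>H\<close> into \<open>\<O>\<close>; its value at the local equation \<open>x\<^sub>i\<close> is \<open>x\<^sub>i\<close>. Hence
\<open>f\<^sub>i \<otimes> 1 = x\<^sub>i g\<^sub>i\<close>, and the morphism that induces \<open>\<phi>\<^sub>H\<close> sends the cochain of the double scheme to
\<open>D\<^sub>i\<^sub>j \<otimes> (f\<^sub>i \<otimes> 1) = D\<^sub>i\<^sub>j \<otimes> x\<^sub>i g\<^sub>i = x\<^sub>i D\<^sub>i\<^sub>j \<otimes> g\<^sub>i = E\<^sub>i\<^sub>j \<otimes> g\<^sub>i\<close>, which is the cochain of the blowing-up. So the two classes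
correspond already at the level of cochains on the given cover, without passing to a refinement or adding a coboundary. That
\<open>D\<^sub>i\<^sub>j \<otimes> f\<^sub>i\<close> is a cocycle is the composition law of the transitions, \<open>D\<^sub>i\<^sub>k = D\<^sub>i\<^sub>j + \<alpha>\<^sub>i\<^sub>j D\<^sub>j\<^sub>k\<close>, together with
\<open>f\<^sub>j = \<alpha>\<^sub>i\<^sub>j f\<^sub>i\<close> (\<open>cech_cocycle_transition_der\<close>); that \<open>E\<^sub>i\<^sub>j \<otimes> g\<^sub>i\<close> is one follows because morphisms preserve cocycles.

What gives this computation its meaning is that all objects in it are sheaves of modules and all maps are
morphisms. Tensors are classes of formal sums, sections of a tensor sheaf are families of germs, cohomology
classes are sets of cocycles, and their operations are unions over all representatives; the work lies in showing
that a single representative suffices. This is done once for arbitrary modules (\<open>module_tensor\<close>), presheaves of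
modules (\<open>module_presheaf_sheafify\<close>, \<open>presheaf_morphism_tensor_sheaf\<close>) and Cech classes (\<open>cech_class_in_H1\<close>,
\<open>H1_map_cech_class\<close>), and then applied to the tangent sheaf, to \<open>\<O>(H)\<close>, and to \<open>L\<close>. For the last one, the product of a
function on \<open>X\<close> with a section of the ideal of \<open>X\<close> has to be glued from the products with local lifts of the
function (\<open>scalar_product_exists\<close>).
\<close>

section \<open>Tensor products of modules\<close>

text \<open>The operations on tensors, germs and cohomology classes are unions over all representatives. Once the
  value is known not to depend on the representative, such a union collapses to the value at any one.\<close>

lemma UN_eq_representative:
  assumes "a \<in> A" "\<And>x. x \<in> A \<Longrightarrow> F x = F a"
  shows "(\<Union>x\<in>A. F x) = F a"
  using assms by blast

text \<open>For the restriction maps of a presheaf of modules, \<open>\<phi>\<close> is the restriction of functions; for morphisms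
  over one open set it is the identity.\<close>

definition semilinear ::
  "('r \<Rightarrow> 'q) \<Rightarrow> 'r ring \<Rightarrow> ('r, 'm) module \<Rightarrow> ('q, 'n) module \<Rightarrow> ('m \<Rightarrow> 'n) \<Rightarrow> bool" where
  "semilinear \<phi> R M N f \<longleftrightarrow> (\<forall>m\<in>carrier M. f m \<in> carrier N \<and>
     (\<forall>m'\<in>carrier M. f (m \<oplus>\<^bsub>M\<^esub> m') = f m \<oplus>\<^bsub>N\<^esub> f m') \<and>
     (\<forall>r\<in>carrier R. f (r \<odot>\<^bsub>M\<^esub> m) = \<phi> r \<odot>\<^bsub>N\<^esub> f m))"

lemma semilinearI:
  assumes "\<And>m. m \<in> carrier M \<Longrightarrow> f m \<in> carrier N"
    and "\<And>m m'. \<lbrakk>m \<in> carrier M; m' \<in> carrier M\<rbrakk> \<Longrightarrow> f (m \<oplus>\<^bsub>M\<^esub> m') = f m \<oplus>\<^bsub>N\<^esub> f m'"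
    and "\<And>r m. \<lbrakk>r \<in> carrier R; m \<in> carrier M\<rbrakk> \<Longrightarrow> f (r \<odot>\<^bsub>M\<^esub> m) = \<phi> r \<odot>\<^bsub>N\<^esub> f m"
  shows "semilinear \<phi> R M N f"
  using assms by (auto simp: semilinear_def)

lemma semilinearD:
  assumes "semilinear \<phi> R M N f"
  shows "m \<in> carrier M \<Longrightarrow> f m \<in> carrier N"
    and "\<lbrakk>m \<in> carrier M; m' \<in> carrier M\<rbrakk> \<Longrightarrow> f (m \<oplus>\<^bsub>M\<^esub> m') = f m \<oplus>\<^bsub>N\<^esub> f m'"
    and "\<lbrakk>r \<in> carrier R; m \<in> carrier M\<rbrakk> \<Longrightarrow> f (r \<odot>\<^bsub>M\<^esub> m) = \<phi> r \<odot>\<^bsub>N\<^esub> f m"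
  using assms by (auto simp: semilinear_def)

text \<open>The homomorphism of free abelian groups from which \<open>tensor_map\<close> arises by passing to classes.\<close>

definition tensor_lift ::
  "('k \<Rightarrow> 'm) \<Rightarrow> ('l \<Rightarrow> 'n) \<Rightarrow> ('k \<times> 'l \<Rightarrow>\<^sub>0 int) \<Rightarrow> ('m \<times> 'n \<Rightarrow>\<^sub>0 int)" where
  "tensor_lift f g = frag_extend (\<lambda>(m, n). frag_of (f m, g n))"

lemma tensor_lift_simps [simp]:
  "tensor_lift f g 0 = 0"
  "tensor_lift f g (frag_of (m, n)) = frag_of (f m, g n)"
  "tensor_lift f g (c + d) = tensor_lift f g c + tensor_lift f g d"
  "tensor_lift f g (c - d) = tensor_lift f g c - tensor_lift f g d"
  "tensor_lift f g (- c) = - tensor_lift f g c"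
  by (simp_all add: tensor_lift_def frag_extend_add frag_extend_diff frag_extend_minus)

lemma tensor_lift_comp: "tensor_lift f' g' (tensor_lift f g c) = tensor_lift (f' \<circ> f) (g' \<circ> g) c"
  by (rule frag_induction[of c UNIV]) auto

lemma tensor_lift_cong:
  assumes "Poly_Mapping.keys c \<subseteq> A \<times> B" "\<And>m. m \<in> A \<Longrightarrow> f m = f' m" "\<And>n. n \<in> B \<Longrightarrow> g n = g' n"
  shows "tensor_lift f g c = tensor_lift f' g' c"
  unfolding tensor_lift_def using assms by (intro frag_extend_eq) auto

lemma tensor_lift_id:
  assumes "Poly_Mapping.keys c \<subseteq> A \<times> B" "\<And>m. m \<in> A \<Longrightarrow> f m = m" "\<And>n. n \<in> B \<Longrightarrow> g n = n"
  shows "tensor_lift f g c = c"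
proof -
  have "tensor_lift f g c = tensor_lift id id c"
    by (rule tensor_lift_cong[OF assms(1)]) (auto simp: assms)
  also have "\<dots> = c" by (rule frag_induction[of c UNIV]) auto
  finally show ?thesis .
qed

lemma keys_tensor_lift:
  assumes "Poly_Mapping.keys c \<subseteq> A \<times> B" "\<And>m. m \<in> A \<Longrightarrow> f m \<in> A'" "\<And>n. n \<in> B \<Longrightarrow> g n \<in> B'"
  shows "Poly_Mapping.keys (tensor_lift f g c) \<subseteq> A' \<times> B'"
proof -
  have "Poly_Mapping.keys (tensor_lift f g c)
      \<subseteq> (\<Union>x\<in>Poly_Mapping.keys c. Poly_Mapping.keys (case x of (m, n) \<Rightarrow> frag_of (f m, g n)))"
    unfolding tensor_lift_def by (rule keys_frag_extend)
  also have "\<dots> \<subseteq> A' \<times> B'" using assms by auto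
  finally show ?thesis .
qed

locale module_pair = M: module R M + N: module R N
  for R :: "'r ring" and M :: "('r, 'm) module" and N :: "('r, 'n) module"
begin

abbreviation "formal_sums \<equiv> {c :: 'm \<times> 'n \<Rightarrow>\<^sub>0 int. Poly_Mapping.keys c \<subseteq> carrier M \<times> carrier N}"

lemma formal_sums_closed:
  "c \<in> formal_sums \<Longrightarrow> d \<in> formal_sums \<Longrightarrow> c + d \<in> formal_sums"
  "c \<in> formal_sums \<Longrightarrow> d \<in> formal_sums \<Longrightarrow> c - d \<in> formal_sums"
  using keys_add[of c d] keys_diff[of c d] by blast+

text \<open>The subgroup generated in a free abelian group lies in that group only if its generators do, and for
  the tensor relations this is the closure of the two modules under their operations.\<close>

lemma tensor_rel_subgroup:
  "subgroup (tensor_rel R M N) (free_Abelian_group (carrier M \<times> carrier N))"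
  unfolding tensor_rel_def
proof (rule group.generate_is_subgroup[OF group_free_Abelian_group], rule subsetI)
  fix c
  assume "c \<in> {frag_of (m \<oplus>\<^bsub>M\<^esub> m', n) - frag_of (m, n) - frag_of (m', n) | m m' n.
        m \<in> carrier M \<and> m' \<in> carrier M \<and> n \<in> carrier N} \<union>
     {frag_of (m, n \<oplus>\<^bsub>N\<^esub> n') - frag_of (m, n) - frag_of (m, n') | m n n'.
        m \<in> carrier M \<and> n \<in> carrier N \<and> n' \<in> carrier N} \<union>
     {frag_of (r \<odot>\<^bsub>M\<^esub> m, n) - frag_of (m, r \<odot>\<^bsub>N\<^esub> n) | r m n.
        r \<in> carrier R \<and> m \<in> carrier M \<and> n \<in> carrier N}"
  then have "c \<in> formal_sums"
    by (elim UnE CollectE exE conjE; hypsubst; intro formal_sums_closed) auto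
  then show "c \<in> carrier (free_Abelian_group (carrier M \<times> carrier N))" by simp
qed

lemma tensor_rel_closed:
  shows rel_zero: "0 \<in> tensor_rel R M N"
    and rel_add: "\<lbrakk>c \<in> tensor_rel R M N; d \<in> tensor_rel R M N\<rbrakk> \<Longrightarrow> c + d \<in> tensor_rel R M N"
    and rel_minus: "c \<in> tensor_rel R M N \<Longrightarrow> - c \<in> tensor_rel R M N"
    and rel_formal: "c \<in> tensor_rel R M N \<Longrightarrow> c \<in> formal_sums"
proof -
  let ?F = "free_Abelian_group (carrier M \<times> carrier N)"
  note S = tensor_rel_subgroup
  show "0 \<in> tensor_rel R M N" using subgroup.one_closed[OF S] by simp
  show "\<lbrakk>c \<in> tensor_rel R M N; d \<in> tensor_rel R M N\<rbrakk> \<Longrightarrow> c + d \<in> tensor_rel R M N"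
    using subgroup.m_closed[OF S] by simp
  show f: "c \<in> formal_sums" if "c \<in> tensor_rel R M N" for c
    using subgroup.mem_carrier[OF S that] by simp
  show "- c \<in> tensor_rel R M N" if "c \<in> tensor_rel R M N"
    using subgroup.m_inv_closed[OF S that] f[OF that] by simp
qed

lemma rel_diff: "\<lbrakk>c \<in> tensor_rel R M N; d \<in> tensor_rel R M N\<rbrakk> \<Longrightarrow> c - d \<in> tensor_rel R M N"
  using rel_add[of c "- d"] rel_minus[of d] by simp

lemma rel_generators:
  "\<lbrakk>m \<in> carrier M; m' \<in> carrier M; n \<in> carrier N\<rbrakk> \<Longrightarrow>
    frag_of (m \<oplus>\<^bsub>M\<^esub> m', n) - frag_of (m, n) - frag_of (m', n) \<in> tensor_rel R M N"
  "\<lbrakk>m \<in> carrier M; n \<in> carrier N; n' \<in> carrier N\<rbrakk> \<Longrightarrow>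
    frag_of (m, n \<oplus>\<^bsub>N\<^esub> n') - frag_of (m, n) - frag_of (m, n') \<in> tensor_rel R M N"
  "\<lbrakk>r \<in> carrier R; m \<in> carrier M; n \<in> carrier N\<rbrakk> \<Longrightarrow>
    frag_of (r \<odot>\<^bsub>M\<^esub> m, n) - frag_of (m, r \<odot>\<^bsub>N\<^esub> n) \<in> tensor_rel R M N"
  unfolding tensor_rel_def by (rule generate.incl; blast)+

lemma mem_tensor_class: "d \<in> tensor_class R M N c \<longleftrightarrow> d - c \<in> tensor_rel R M N"
  by (auto simp: tensor_class_def r_coset_def) (metis diff_add_cancel)

lemma tensor_class_self: "c \<in> tensor_class R M N c"
  by (simp add: mem_tensor_class rel_zero)

lemma tensor_class_eq_iff: "tensor_class R M N c = tensor_class R M N d \<longleftrightarrow> c - d \<in> tensor_rel R M N"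
proof
  assume "tensor_class R M N c = tensor_class R M N d"
  then show "c - d \<in> tensor_rel R M N"
    using tensor_class_self[of c] mem_tensor_class by blast
next
  assume cd: "c - d \<in> tensor_rel R M N"
  have "e - c \<in> tensor_rel R M N \<longleftrightarrow> e - d \<in> tensor_rel R M N" for e
    using rel_add[OF _ cd, of "e - c"] rel_diff[OF _ cd, of "e - d"] by auto
  then show "tensor_class R M N c = tensor_class R M N d"
    by (auto simp: mem_tensor_class)
qed

lemma tensor_class_carrier:
  "K \<in> carrier (tensor_module R M N) \<longleftrightarrow> (\<exists>c\<in>formal_sums. K = tensor_class R M N c)"
  by (simp add: tensor_module_def image_iff Bex_def)

lemma tensor_pure_carrier:
  "m \<in> carrier M \<Longrightarrow> n \<in> carrier N \<Longrightarrow>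
    tensor_class R M N (frag_of (m, n)) \<in> carrier (tensor_module R M N)"
  by (auto simp: tensor_class_carrier intro!: exI[of _ "frag_of (m, n)"])

lemma tensor_add:
  "tensor_class R M N c \<oplus>\<^bsub>tensor_module R M N\<^esub> tensor_class R M N d = tensor_class R M N (c + d)"
proof -
  have E: "tensor_class R M N (c' + d') = tensor_class R M N (c + d)"
    if "c' \<in> tensor_class R M N c" "d' \<in> tensor_class R M N d" for c' d'
    using that rel_add[of "c' - c" "d' - d"]
    by (simp add: mem_tensor_class tensor_class_eq_iff algebra_simps)
  have "(\<Union>d'\<in>tensor_class R M N d. tensor_class R M N (c' + d')) = tensor_class R M N (c + d)"
    if "c' \<in> tensor_class R M N c" for c'
    using E[OF that] tensor_class_self[of d] by blast
  then have "(\<Union>c'\<in>tensor_class R M N c. \<Union>d'\<in>tensor_class R M N d. tensor_class R M N (c' + d'))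
      = tensor_class R M N (c + d)"
    using tensor_class_self[of c] by blast
  then show ?thesis by (simp add: tensor_module_def)
qed

lemma tensor_pure:
  "\<lbrakk>m \<in> carrier M; m' \<in> carrier M; n \<in> carrier N\<rbrakk> \<Longrightarrow>
    tensor_class R M N (frag_of (m \<oplus>\<^bsub>M\<^esub> m', n)) =
    tensor_class R M N (frag_of (m, n)) \<oplus>\<^bsub>tensor_module R M N\<^esub> tensor_class R M N (frag_of (m', n))"
  "\<lbrakk>r \<in> carrier R; m \<in> carrier M; n \<in> carrier N\<rbrakk> \<Longrightarrow>
    tensor_class R M N (frag_of (r \<odot>\<^bsub>M\<^esub> m, n)) = tensor_class R M N (frag_of (m, r \<odot>\<^bsub>N\<^esub> n))"
  using rel_generators(1)[of m m' n] rel_generators(3)[of r m n]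
  by (simp_all add: tensor_add tensor_class_eq_iff algebra_simps)

text \<open>Identities between tensors are reduced in this way to pure tensors, from which all formal sums arise by subtraction.\<close>

lemma formal_sum_rel_induct:
  assumes "c \<in> formal_sums"
    and "P 0 = (0 :: 'm \<times> 'n \<Rightarrow>\<^sub>0 int)" "\<And>a b. P (a - b) = P a - P b"
    and "\<And>m n. \<lbrakk>m \<in> carrier M; n \<in> carrier N\<rbrakk> \<Longrightarrow> P (frag_of (m, n)) \<in> tensor_rel R M N"
  shows "P c \<in> tensor_rel R M N"
  using assms(1)[simplified]
  by (rule frag_induction) (use assms in \<open>auto simp: rel_zero rel_diff\<close>)

end

text \<open>Each of the three kinds of relations is sent to a relation of the same kind, with the scalar moved
  along \<open>\<phi>\<close>.\<close>

lemma tensor_lift_rel: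
  assumes "module_pair R M N" "module_pair R' M' N'" "\<phi> \<in> carrier R \<rightarrow> carrier R'"
    and f: "semilinear \<phi> R M M' f" and g: "semilinear \<phi> R N N' g"
    and c: "c \<in> tensor_rel R M N"
  shows "tensor_lift f g c \<in> tensor_rel R' M' N'"
proof -
  interpret A: module_pair R M N by fact
  interpret B: module_pair R' M' N' by fact
  note [simp] = semilinearD[OF f] semilinearD[OF g]
  have \<phi>: "\<And>r. r \<in> carrier R \<Longrightarrow> \<phi> r \<in> carrier R'" using assms by auto
  let ?H = "{frag_of (m \<oplus>\<^bsub>M\<^esub> m', n) - frag_of (m, n) - frag_of (m', n) | m m' n.
        m \<in> carrier M \<and> m' \<in> carrier M \<and> n \<in> carrier N} \<union>
     {frag_of (m, n \<oplus>\<^bsub>N\<^esub> n') - frag_of (m, n) - frag_of (m, n') | m n n'.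
        m \<in> carrier M \<and> n \<in> carrier N \<and> n' \<in> carrier N} \<union>
     {frag_of (r \<odot>\<^bsub>M\<^esub> m, n) - frag_of (m, r \<odot>\<^bsub>N\<^esub> n) | r m n.
        r \<in> carrier R \<and> m \<in> carrier M \<and> n \<in> carrier N}"
  have gen: "tensor_lift f g h \<in> tensor_rel R' M' N'" if "h \<in> ?H" for h
    using that
    by (elim UnE CollectE exE conjE; hypsubst)
      (simp_all add: B.rel_generators \<phi>)
  have H: "?H \<subseteq> tensor_rel R M N"
    unfolding tensor_rel_def by (blast intro: generate.incl)
  from c show ?thesis
    unfolding tensor_rel_def[of R M N]
  proof (induction rule: generate.induct)
    case (inv h)
    then have "h \<in> A.formal_sums" using H A.rel_formal by blast
    then show ?case using gen[OF inv] by (simp add: B.rel_minus)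
  qed (use gen in \<open>auto simp: B.rel_zero B.rel_add\<close>)
qed

lemma tensor_map_class:
  assumes "module_pair R M N" "module_pair R' M' N'" "\<phi> \<in> carrier R \<rightarrow> carrier R'"
    and "semilinear \<phi> R M M' f" "semilinear \<phi> R N N' g"
  shows "tensor_map R' M' N' f g (tensor_class R M N c) = tensor_class R' M' N' (tensor_lift f g c)"
proof -
  interpret A: module_pair R M N by fact
  interpret B: module_pair R' M' N' by fact
  have "(\<Union>d\<in>tensor_class R M N c. tensor_class R' M' N' (tensor_lift f g d))
      = tensor_class R' M' N' (tensor_lift f g c)"
  proof (rule UN_eq_representative[OF A.tensor_class_self])
    fix d
    assume "d \<in> tensor_class R M N c"
    then show "tensor_class R' M' N' (tensor_lift f g d) = tensor_class R' M' N' (tensor_lift f g c)"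
      using tensor_lift_rel[OF assms, of "d - c"]
      by (simp add: A.mem_tensor_class B.tensor_class_eq_iff)
  qed
  then show ?thesis by (simp add: tensor_map_def tensor_lift_def)
qed

context module_pair begin

text \<open>The scalars act on tensors through the first factor; as the ring is commutative, this action is linear and
  so descends to classes.\<close>

lemma scalar_semilinear:
  assumes "r \<in> carrier R"
  shows "semilinear (\<lambda>s. s) R M M (\<lambda>m. r \<odot>\<^bsub>M\<^esub> m)"
  by (rule semilinearI) (simp_all add: assms M.smult_r_distr M.R.m_comm flip: M.smult_assoc1)

lemma tensor_smult:
  assumes "r \<in> carrier R"
  shows "r \<odot>\<^bsub>tensor_module R M N\<^esub> tensor_class R M N c
    = tensor_class R M N (tensor_lift (\<lambda>m. r \<odot>\<^bsub>M\<^esub> m) (\<lambda>n. n) c)"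
proof -
  have "module_pair R M N" by unfold_locales
  then show ?thesis
    using tensor_map_class[of R M N R M N "\<lambda>s. s" "\<lambda>m. r \<odot>\<^bsub>M\<^esub> m" "\<lambda>n. n" c]
      scalar_semilinear[OF assms]
    by (simp add: tensor_module_def semilinear_def)
qed

lemma tensor_lift_scalar:
  assumes "c \<in> formal_sums" "r \<in> carrier R"
  shows "tensor_lift (\<lambda>m. r \<odot>\<^bsub>M\<^esub> m) (\<lambda>n. n) c \<in> formal_sums"
  using assms keys_tensor_lift[of c "carrier M" "carrier N" "\<lambda>m. r \<odot>\<^bsub>M\<^esub> m" "carrier M" "\<lambda>n. n"] by simp

text \<open>Associativity and the unit law of the action hold already for formal sums; only \<open>(r + s) x = r x + s x\<close> uses the
  relations.\<close>

lemma module_tensor: "module R (tensor_module R M N)"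
proof (rule moduleI)
  let ?T = "tensor_module R M N" and ?c = "tensor_class R M N"
  let ?l = "\<lambda>r. tensor_lift (\<lambda>m. r \<odot>\<^bsub>M\<^esub> m) (\<lambda>n :: 'n. n)"
  note car = tensor_class_carrier
  have I: "c \<in> formal_sums \<Longrightarrow> ?c c \<in> carrier ?T" for c by (auto simp: car)
  show "cring R" ..
  have z: "\<zero>\<^bsub>?T\<^esub> = ?c 0" by (simp add: tensor_module_def)
  show "abelian_group ?T"
  proof (rule abelian_groupI)
    show "\<zero>\<^bsub>?T\<^esub> \<in> carrier ?T" by (simp add: z I)
    show "\<exists>y\<in>carrier ?T. y \<oplus>\<^bsub>?T\<^esub> x = \<zero>\<^bsub>?T\<^esub>" if x: "x \<in> carrier ?T" for x
    proof -
      obtain c where c: "c \<in> formal_sums" "x = ?c c" using x unfolding car by blast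
      then have "?c (- c) \<in> carrier ?T" by (intro I) simp
      moreover have "?c (- c) \<oplus>\<^bsub>?T\<^esub> x = \<zero>\<^bsub>?T\<^esub>" by (simp add: c z tensor_add)
      ultimately show ?thesis by blast
    qed
    show "x \<oplus>\<^bsub>?T\<^esub> y \<in> carrier ?T" if "x \<in> carrier ?T" "y \<in> carrier ?T" for x y
    proof -
      obtain c d where c: "c \<in> formal_sums" "d \<in> formal_sums" "x = ?c c" "y = ?c d"
        using \<open>x \<in> carrier ?T\<close> \<open>y \<in> carrier ?T\<close> unfolding car by blast
      then show ?thesis using I[OF formal_sums_closed(1)[OF c(1,2)]] by (simp add: tensor_add)
    qed
    show "x \<oplus>\<^bsub>?T\<^esub> y \<oplus>\<^bsub>?T\<^esub> w = x \<oplus>\<^bsub>?T\<^esub> (y \<oplus>\<^bsub>?T\<^esub> w)"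
      if "x \<in> carrier ?T" "y \<in> carrier ?T" "w \<in> carrier ?T" for x y w
      using that unfolding car by (elim bexE) (simp add: tensor_add add.assoc)
    show "x \<oplus>\<^bsub>?T\<^esub> y = y \<oplus>\<^bsub>?T\<^esub> x" if "x \<in> carrier ?T" "y \<in> carrier ?T" for x y
      using that unfolding car by (elim bexE) (simp add: tensor_add add.commute)
    show "\<zero>\<^bsub>?T\<^esub> \<oplus>\<^bsub>?T\<^esub> x = x" if "x \<in> carrier ?T" for x
      using that unfolding car by (elim bexE) (simp add: tensor_add z)
  qed
  show "r \<odot>\<^bsub>?T\<^esub> x \<in> carrier ?T" if "r \<in> carrier R" and x: "x \<in> carrier ?T" for r x
  proof -
    obtain c where c: "c \<in> formal_sums" "x = ?c c" using x unfolding car by blast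
    show ?thesis
      unfolding c(2) tensor_smult[OF \<open>r \<in> carrier R\<close>]
      by (rule I[OF tensor_lift_scalar[OF c(1) \<open>r \<in> carrier R\<close>]])
  qed
  show "(r \<oplus>\<^bsub>R\<^esub> s) \<odot>\<^bsub>?T\<^esub> x = r \<odot>\<^bsub>?T\<^esub> x \<oplus>\<^bsub>?T\<^esub> s \<odot>\<^bsub>?T\<^esub> x"
    if r: "r \<in> carrier R" "s \<in> carrier R" and x: "x \<in> carrier ?T" for r s x
  proof -
    obtain c where c: "c \<in> formal_sums" "x = ?c c" using x unfolding car by blast
    have "?l (r \<oplus>\<^bsub>R\<^esub> s) c - ?l r c - ?l s c \<in> tensor_rel R M N"
      by (rule formal_sum_rel_induct[OF c(1), of "\<lambda>c. ?l (r \<oplus>\<^bsub>R\<^esub> s) c - ?l r c - ?l s c"])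
        (simp_all add: M.smult_l_distr rel_generators(1) r)
    then have "?c (?l (r \<oplus>\<^bsub>R\<^esub> s) c) = ?c (?l r c + ?l s c)"
      by (simp add: tensor_class_eq_iff diff_diff_eq)
    then show ?thesis using r c by (simp add: tensor_smult tensor_add)
  qed
  show "r \<odot>\<^bsub>?T\<^esub> (x \<oplus>\<^bsub>?T\<^esub> y) = r \<odot>\<^bsub>?T\<^esub> x \<oplus>\<^bsub>?T\<^esub> r \<odot>\<^bsub>?T\<^esub> y"
    if "r \<in> carrier R" "x \<in> carrier ?T" "y \<in> carrier ?T" for r x y
    using that unfolding car by (elim bexE) (simp add: tensor_add tensor_smult)
  show "(r \<otimes>\<^bsub>R\<^esub> s) \<odot>\<^bsub>?T\<^esub> x = r \<odot>\<^bsub>?T\<^esub> (s \<odot>\<^bsub>?T\<^esub> x)"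
    if r: "r \<in> carrier R" "s \<in> carrier R" and x: "x \<in> carrier ?T" for r s x
  proof -
    obtain c where c: "c \<in> formal_sums" "x = ?c c" using x unfolding car by blast
    have "?l (r \<otimes>\<^bsub>R\<^esub> s) c = ?l r (?l s c)"
      unfolding tensor_lift_comp using c(1)
      by (intro tensor_lift_cong[of _ "carrier M" "carrier N"]) (auto simp: M.smult_assoc1 r)
    then show ?thesis using r c by (simp add: tensor_smult)
  qed
  show "\<one>\<^bsub>R\<^esub> \<odot>\<^bsub>?T\<^esub> x = x" if x: "x \<in> carrier ?T" for x
  proof -
    obtain c where c: "c \<in> formal_sums" "x = ?c c" using x unfolding car by blast
    have "?l \<one>\<^bsub>R\<^esub> c = c"
      using c(1) by (intro tensor_lift_id[of _ "carrier M" "carrier N"]) auto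
    then show ?thesis using c by (simp add: tensor_smult)
  qed
qed

end

lemma tensor_map_semilinear:
  assumes "module_pair R M N" "module_pair R' M' N'" "\<phi> \<in> carrier R \<rightarrow> carrier R'"
    and f: "semilinear \<phi> R M M' f" and g: "semilinear \<phi> R N N' g"
  shows "semilinear \<phi> R (tensor_module R M N) (tensor_module R' M' N') (tensor_map R' M' N' f g)"
proof (rule semilinearI)
  interpret A: module_pair R M N by fact
  interpret B: module_pair R' M' N' by fact
  note T = tensor_map_class[OF assms]
  have \<phi>: "\<And>r. r \<in> carrier R \<Longrightarrow> \<phi> r \<in> carrier R'" using assms by auto
  show "tensor_map R' M' N' f g x \<in> carrier (tensor_module R' M' N')"
    if x: "x \<in> carrier (tensor_module R M N)" for x
  proof -
    obtain c where c: "c \<in> A.formal_sums" "x = tensor_class R M N c"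
      using x unfolding A.tensor_class_carrier by blast
    have "tensor_lift f g c \<in> B.formal_sums"
      using keys_tensor_lift[of c "carrier M" "carrier N" f "carrier M'" g "carrier N'"] c
        semilinearD(1)[OF f] semilinearD(1)[OF g] by simp
    then show ?thesis unfolding B.tensor_class_carrier c T by blast
  qed
  show "tensor_map R' M' N' f g (x \<oplus>\<^bsub>tensor_module R M N\<^esub> y)
      = tensor_map R' M' N' f g x \<oplus>\<^bsub>tensor_module R' M' N'\<^esub> tensor_map R' M' N' f g y"
    if "x \<in> carrier (tensor_module R M N)" "y \<in> carrier (tensor_module R M N)" for x y
    using that unfolding A.tensor_class_carrier by (elim bexE) (simp add: A.tensor_add B.tensor_add T)
  show "tensor_map R' M' N' f g (r \<odot>\<^bsub>tensor_module R M N\<^esub> x)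
      = \<phi> r \<odot>\<^bsub>tensor_module R' M' N'\<^esub> tensor_map R' M' N' f g x"
    if r: "r \<in> carrier R" and x: "x \<in> carrier (tensor_module R M N)" for r x
  proof -
    obtain c where c: "c \<in> A.formal_sums" "x = tensor_class R M N c"
      using x unfolding A.tensor_class_carrier by blast
    have "tensor_lift f g (tensor_lift (\<lambda>m. r \<odot>\<^bsub>M\<^esub> m) (\<lambda>n. n) c)
        = tensor_lift (\<lambda>m. \<phi> r \<odot>\<^bsub>M'\<^esub> m) (\<lambda>n. n) (tensor_lift f g c)"
      unfolding tensor_lift_comp using c(1)
      by (intro tensor_lift_cong[of _ "carrier M" "carrier N"]) (auto simp: semilinearD[OF f] r)
    then show ?thesis unfolding c A.tensor_smult[OF r] T B.tensor_smult[OF \<phi>[OF r]] by simp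
  qed
qed

section \<open>Module axioms verified on local models\<close>

definition self_module :: "'s ring \<Rightarrow> ('s, 's) module" where
  "self_module S = \<lparr>carrier = carrier S, mult = undefined, one = undefined, ring.zero = ring.zero S,
     ring.add = ring.add S, smult = mult S\<rparr>"

lemma module_self_module:
  assumes "cring S"
  shows "module S (self_module S)"
proof -
  interpret cring S by fact
  have "\<exists>y\<in>carrier S. y \<oplus>\<^bsub>S\<^esub> x = \<zero>\<^bsub>S\<^esub>" if "x \<in> carrier S" for x
    using that l_neg[OF that] by blast
  then show ?thesis
    by (intro moduleI abelian_groupI assms) (simp_all add: self_module_def l_distr r_distr m_assoc a_ac)
qed

text \<open>Module axioms are often true because they hold locally, in modules that one knows already: sections of a
  sheafification are locally sections of the presheaf, and the ideal of \<open>X\<close> in a double scheme is locally acted on by lifts of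
  functions. Here \<open>N\<close> is the structure in question, \<open>K p\<close> indexes its models near the point \<open>p\<close>, and \<open>scal\<close> and \<open>rep\<close> relate
  scalars and elements to their counterparts in a model. They are relations because a function on \<open>X\<close> has many lifts;
  \<open>scal_unique\<close> says that all of these act in the same way.\<close>

locale locally_modelled =
  fixes R :: "'r ring" and N :: "('r, 'n) module"
    and P :: "'p set" and K :: "'p \<Rightarrow> 'k set"
    and S :: "'k \<Rightarrow> 's ring" and A :: "'k \<Rightarrow> ('s, 'm) module"
    and scal :: "'k \<Rightarrow> 'r \<Rightarrow> 's \<Rightarrow> bool" and rep :: "'k \<Rightarrow> 'n \<Rightarrow> 'm \<Rightarrow> bool"
  assumes R: "cring R"
    and add_closed: "\<lbrakk>x \<in> carrier N; y \<in> carrier N\<rbrakk> \<Longrightarrow> x \<oplus>\<^bsub>N\<^esub> y \<in> carrier N"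
    and smult_closed: "\<lbrakk>r \<in> carrier R; x \<in> carrier N\<rbrakk> \<Longrightarrow> r \<odot>\<^bsub>N\<^esub> x \<in> carrier N"
    and zero_closed: "\<zero>\<^bsub>N\<^esub> \<in> carrier N"
    and model: "\<lbrakk>p \<in> P; k \<in> K p\<rbrakk> \<Longrightarrow> module (S k) (A k)"
    and carriers: "scal k r s \<Longrightarrow> s \<in> carrier (S k)" "rep k x a \<Longrightarrow> a \<in> carrier (A k)"
    and scal_ops: "\<lbrakk>p \<in> P; k \<in> K p; scal k r s; scal k r' s'\<rbrakk> \<Longrightarrow> scal k (r \<oplus>\<^bsub>R\<^esub> r') (s \<oplus>\<^bsub>S k\<^esub> s')"
      "\<lbrakk>p \<in> P; k \<in> K p; scal k r s; scal k r' s'\<rbrakk> \<Longrightarrow> scal k (r \<otimes>\<^bsub>R\<^esub> r') (s \<otimes>\<^bsub>S k\<^esub> s')"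
      "\<lbrakk>p \<in> P; k \<in> K p\<rbrakk> \<Longrightarrow> scal k \<zero>\<^bsub>R\<^esub> \<zero>\<^bsub>S k\<^esub>"
      "\<lbrakk>p \<in> P; k \<in> K p\<rbrakk> \<Longrightarrow> scal k \<one>\<^bsub>R\<^esub> \<one>\<^bsub>S k\<^esub>"
    and scal_unique: "\<lbrakk>p \<in> P; k \<in> K p; scal k r s; scal k r s'; rep k x a\<rbrakk> \<Longrightarrow> s \<odot>\<^bsub>A k\<^esub> a = s' \<odot>\<^bsub>A k\<^esub> a"
    and rep_ops: "\<lbrakk>p \<in> P; k \<in> K p; rep k x a; rep k y b\<rbrakk> \<Longrightarrow> rep k (x \<oplus>\<^bsub>N\<^esub> y) (a \<oplus>\<^bsub>A k\<^esub> b)"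
      "\<lbrakk>p \<in> P; k \<in> K p; scal k r s; rep k x a\<rbrakk> \<Longrightarrow> rep k (r \<odot>\<^bsub>N\<^esub> x) (s \<odot>\<^bsub>A k\<^esub> a)"
      "\<lbrakk>p \<in> P; k \<in> K p\<rbrakk> \<Longrightarrow> rep k \<zero>\<^bsub>N\<^esub> \<zero>\<^bsub>A k\<^esub>"
    and eqI: "\<lbrakk>x \<in> carrier N; y \<in> carrier N; \<And>p. p \<in> P \<Longrightarrow> \<exists>k\<in>K p. \<exists>a. rep k x a \<and> rep k y a\<rbrakk> \<Longrightarrow> x = y"
    and common: "\<lbrakk>p \<in> P; r \<in> carrier R; r' \<in> carrier R; x \<in> carrier N; y \<in> carrier N; z \<in> carrier N\<rbrakk> \<Longrightarrow>
      \<exists>k\<in>K p. \<exists>s s' a b c. scal k r s \<and> scal k r' s' \<and> rep k x a \<and> rep k y b \<and> rep k z c"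
begin

lemma eq_if_models_eq:
  assumes c: "v \<in> carrier N" "w \<in> carrier N" "r \<in> carrier R" "r' \<in> carrier R" "x \<in> carrier N" "y \<in> carrier N" "z \<in> carrier N"
    and step: "\<And>p k s s' a b c. \<lbrakk>p \<in> P; k \<in> K p; module (S k) (A k); scal k r s; scal k r' s'; rep k x a; rep k y b; rep k z c;
      s \<in> carrier (S k); s' \<in> carrier (S k); a \<in> carrier (A k); b \<in> carrier (A k); c \<in> carrier (A k)\<rbrakk>
      \<Longrightarrow> \<exists>d e. rep k v d \<and> rep k w e \<and> d = e"
  shows "v = w"
proof (rule eqI[OF c(1,2)])
  fix p assume p: "p \<in> P"
  obtain k s s' a b c where "k \<in> K p" "scal k r s" "scal k r' s'" "rep k x a" "rep k y b" "rep k z c"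
    using common[OF p c(3-7)] by blast
  from this carriers(1)[OF this(2)] carriers(1)[OF this(3)] carriers(2)[OF this(4)] carriers(2)[OF this(5)]
    carriers(2)[OF this(6)]
  have "\<exists>d e. rep k v d \<and> rep k w e \<and> d = e" by (intro step[OF p _ model[OF p]])
  with \<open>k \<in> K p\<close> show "\<exists>k\<in>K p. \<exists>a. rep k v a \<and> rep k w a" by blast
qed

lemma module: "module R N"
proof (rule moduleI)
  interpret R: cring R by (rule R)
  note closed = add_closed smult_closed zero_closed
  show "abelian_group N"
  proof (rule abelian_groupI)
    fix x y z assume xyz: "x \<in> carrier N" "y \<in> carrier N" "z \<in> carrier N"
    show "x \<oplus>\<^bsub>N\<^esub> y \<oplus>\<^bsub>N\<^esub> z = x \<oplus>\<^bsub>N\<^esub> (y \<oplus>\<^bsub>N\<^esub> z)"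
    proof (rule eq_if_models_eq[of _ _ "\<zero>\<^bsub>R\<^esub>" "\<zero>\<^bsub>R\<^esub>" x y z])
      fix p k s s' a b c
      assume k: "p \<in> P" "k \<in> K p" "module (S k) (A k)" "rep k x a" "rep k y b" "rep k z c"
        and cl: "a \<in> carrier (A k)" "b \<in> carrier (A k)" "c \<in> carrier (A k)"
      interpret M: module "S k" "A k" by fact
      show "\<exists>d e. rep k (x \<oplus>\<^bsub>N\<^esub> y \<oplus>\<^bsub>N\<^esub> z) d \<and> rep k (x \<oplus>\<^bsub>N\<^esub> (y \<oplus>\<^bsub>N\<^esub> z)) e \<and> d = e"
        by (rule exI conjI rep_ops[OF k(1,2)] scal_ops[OF k(1,2)] k(4-) | simp add: M.M.a_assoc cl)+
    qed (simp_all add: closed xyz)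
  next
    fix x y assume xy: "x \<in> carrier N" "y \<in> carrier N"
    show "x \<oplus>\<^bsub>N\<^esub> y = y \<oplus>\<^bsub>N\<^esub> x"
    proof (rule eq_if_models_eq[of _ _ "\<zero>\<^bsub>R\<^esub>" "\<zero>\<^bsub>R\<^esub>" x y y])
      fix p k s s' a b c
      assume k: "p \<in> P" "k \<in> K p" "module (S k) (A k)" "rep k x a" "rep k y b"
        and cl: "a \<in> carrier (A k)" "b \<in> carrier (A k)"
      interpret M: module "S k" "A k" by fact
      show "\<exists>d e. rep k (x \<oplus>\<^bsub>N\<^esub> y) d \<and> rep k (y \<oplus>\<^bsub>N\<^esub> x) e \<and> d = e"
        by (rule exI conjI rep_ops[OF k(1,2)] scal_ops[OF k(1,2)] k(4-) | simp add: M.M.a_comm cl)+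
    qed (simp_all add: closed xy)
  next
    fix x assume x: "x \<in> carrier N"
    show "\<zero>\<^bsub>N\<^esub> \<oplus>\<^bsub>N\<^esub> x = x"
    proof (rule eq_if_models_eq[of _ _ "\<zero>\<^bsub>R\<^esub>" "\<zero>\<^bsub>R\<^esub>" x x x])
      fix p k s s' a b c
      assume k: "p \<in> P" "k \<in> K p" "module (S k) (A k)" "rep k x a"
        and cl: "a \<in> carrier (A k)"
      interpret M: module "S k" "A k" by fact
      show "\<exists>d e. rep k (\<zero>\<^bsub>N\<^esub> \<oplus>\<^bsub>N\<^esub> x) d \<and> rep k x e \<and> d = e"
        by (rule exI conjI rep_ops[OF k(1,2)] scal_ops[OF k(1,2)] k(4-) | simp add: M.M.l_zero cl)+
    qed (simp_all add: closed x)
    have "(\<ominus>\<^bsub>R\<^esub> \<one>\<^bsub>R\<^esub>) \<odot>\<^bsub>N\<^esub> x \<oplus>\<^bsub>N\<^esub> x = \<zero>\<^bsub>N\<^esub>"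
    proof (rule eq_if_models_eq[of _ _ "\<ominus>\<^bsub>R\<^esub> \<one>\<^bsub>R\<^esub>" "\<zero>\<^bsub>R\<^esub>" x x x])
      fix p k s s' a b c
      assume k: "p \<in> P" "k \<in> K p" "module (S k) (A k)" "rep k x a" and s: "scal k (\<ominus>\<^bsub>R\<^esub> \<one>\<^bsub>R\<^esub>) s"
        and cl: "a \<in> carrier (A k)"
      interpret M: module "S k" "A k" by fact
      \<comment> \<open>The scalar \<open>s\<close> need not be \<open>-1\<close>, but \<open>s + 1\<close> and \<open>0\<close> both model \<open>0\<close> and so act in the same way.\<close>
      have "scal k \<zero>\<^bsub>R\<^esub> (s \<oplus>\<^bsub>S k\<^esub> \<one>\<^bsub>S k\<^esub>)"
        using scal_ops(1)[OF k(1,2) s scal_ops(4)[OF k(1,2)]] by (simp add: R.l_neg)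
      then have "(s \<oplus>\<^bsub>S k\<^esub> \<one>\<^bsub>S k\<^esub>) \<odot>\<^bsub>A k\<^esub> a = \<zero>\<^bsub>S k\<^esub> \<odot>\<^bsub>A k\<^esub> a"
        by (rule scal_unique[OF k(1,2) _ scal_ops(3)[OF k(1,2)] k(4)])
      then have "s \<odot>\<^bsub>A k\<^esub> a \<oplus>\<^bsub>A k\<^esub> a = \<zero>\<^bsub>A k\<^esub>"
        using carriers(1)[OF s] cl by (simp add: M.smult_l_distr)
      with rep_ops(1)[OF k(1,2) rep_ops(2)[OF k(1,2) s k(4)] k(4)] rep_ops(3)[OF k(1,2)] show "\<exists>d e. rep k ((\<ominus>\<^bsub>R\<^esub> \<one>\<^bsub>R\<^esub>) \<odot>\<^bsub>N\<^esub> x \<oplus>\<^bsub>N\<^esub> x) d \<and> rep k \<zero>\<^bsub>N\<^esub> e \<and> d = e"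
        by auto
    qed (simp_all add: closed x)
    then show "\<exists>y\<in>carrier N. y \<oplus>\<^bsub>N\<^esub> x = \<zero>\<^bsub>N\<^esub>" by (rule bexI) (simp add: closed x)
  qed (simp_all add: closed)
  fix r x assume r: "r \<in> carrier R" and x: "x \<in> carrier N"
  show "r \<odot>\<^bsub>N\<^esub> x \<in> carrier N" using r x by (rule smult_closed)
  show "r \<odot>\<^bsub>N\<^esub> (x \<oplus>\<^bsub>N\<^esub> y) = r \<odot>\<^bsub>N\<^esub> x \<oplus>\<^bsub>N\<^esub> r \<odot>\<^bsub>N\<^esub> y" if y: "y \<in> carrier N" for y
  proof (rule eq_if_models_eq[of _ _ r r x y y])
    fix p k s s' a b c
    assume k: "p \<in> P" "k \<in> K p" "module (S k) (A k)" "scal k r s" "rep k x a" "rep k y b"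
      and cl: "s \<in> carrier (S k)" "a \<in> carrier (A k)" "b \<in> carrier (A k)"
    interpret M: module "S k" "A k" by fact
    show "\<exists>d e. rep k (r \<odot>\<^bsub>N\<^esub> (x \<oplus>\<^bsub>N\<^esub> y)) d \<and> rep k (r \<odot>\<^bsub>N\<^esub> x \<oplus>\<^bsub>N\<^esub> r \<odot>\<^bsub>N\<^esub> y) e \<and> d = e"
      by (rule exI conjI rep_ops[OF k(1,2)] scal_ops[OF k(1,2)] k(4-) | simp add: M.smult_r_distr cl)+
  qed (simp_all add: closed r x y)
  fix r' assume r': "r' \<in> carrier R"
  show "(r \<oplus>\<^bsub>R\<^esub> r') \<odot>\<^bsub>N\<^esub> x = r \<odot>\<^bsub>N\<^esub> x \<oplus>\<^bsub>N\<^esub> r' \<odot>\<^bsub>N\<^esub> x"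
  proof (rule eq_if_models_eq[of _ _ r r' x x x])
    fix p k s s' a b c
    assume k: "p \<in> P" "k \<in> K p" "module (S k) (A k)" "scal k r s" "scal k r' s'" "rep k x a"
      and cl: "s \<in> carrier (S k)" "s' \<in> carrier (S k)" "a \<in> carrier (A k)"
    interpret M: module "S k" "A k" by fact
    show "\<exists>d e. rep k ((r \<oplus>\<^bsub>R\<^esub> r') \<odot>\<^bsub>N\<^esub> x) d \<and> rep k (r \<odot>\<^bsub>N\<^esub> x \<oplus>\<^bsub>N\<^esub> r' \<odot>\<^bsub>N\<^esub> x) e \<and> d = e"
      by (rule exI conjI rep_ops[OF k(1,2)] scal_ops[OF k(1,2)] k(4-) | simp add: M.smult_l_distr cl)+
  qed (simp_all add: closed r r' x)
  show "(r \<otimes>\<^bsub>R\<^esub> r') \<odot>\<^bsub>N\<^esub> x = r \<odot>\<^bsub>N\<^esub> (r' \<odot>\<^bsub>N\<^esub> x)"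
  proof (rule eq_if_models_eq[of _ _ r r' x x x])
    fix p k s s' a b c
    assume k: "p \<in> P" "k \<in> K p" "module (S k) (A k)" "scal k r s" "scal k r' s'" "rep k x a"
      and cl: "s \<in> carrier (S k)" "s' \<in> carrier (S k)" "a \<in> carrier (A k)"
    interpret M: module "S k" "A k" by fact
    show "\<exists>d e. rep k ((r \<otimes>\<^bsub>R\<^esub> r') \<odot>\<^bsub>N\<^esub> x) d \<and> rep k (r \<odot>\<^bsub>N\<^esub> (r' \<odot>\<^bsub>N\<^esub> x)) e \<and> d = e"
      by (rule exI conjI rep_ops[OF k(1,2)] scal_ops[OF k(1,2)] k(4-) | simp add: M.smult_assoc1 cl)+
  qed (simp_all add: closed r r' x)
next
  fix x assume x: "x \<in> carrier N"
  interpret R: cring R by (rule R)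
  show "\<one>\<^bsub>R\<^esub> \<odot>\<^bsub>N\<^esub> x = x"
  proof (rule eq_if_models_eq[of _ _ "\<one>\<^bsub>R\<^esub>" "\<one>\<^bsub>R\<^esub>" x x x])
    fix p k s s' a b c
    assume k: "p \<in> P" "k \<in> K p" "module (S k) (A k)" "rep k x a"
      and cl: "a \<in> carrier (A k)"
    interpret M: module "S k" "A k" by fact
    show "\<exists>d e. rep k (\<one>\<^bsub>R\<^esub> \<odot>\<^bsub>N\<^esub> x) d \<and> rep k x e \<and> d = e"
      by (rule exI conjI rep_ops[OF k(1,2)] scal_ops[OF k(1,2)] k(4-) | simp add: M.smult_one cl)+
  qed (simp_all add: smult_closed x)
qed (rule R)

end

section \<open>Presheaves of modules and sheafification\<close>

lemma ringed_cspace_sections: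
  assumes "ringed_cspace X" "openin (pts X) U"
  shows "cring (sec X U)"
    and "cst X U \<in> ring_hom (type_ring UNIV) (sec X U)"
    and "s \<in> carrier (sec X U) \<Longrightarrow> res X U U s = s"
  using assms by (auto simp: ringed_cspace_def)

lemma ringed_cspace_res:
  assumes "ringed_cspace X" "openin (pts X) U" "openin (pts X) V" "V \<subseteq> U"
  shows "res X U V \<in> ring_hom (sec X U) (sec X V)"
    and "res X U V (cst X U c) = cst X V c"
    and "\<lbrakk>openin (pts X) W; W \<subseteq> V; s \<in> carrier (sec X U)\<rbrakk> \<Longrightarrow> res X V W (res X U V s) = res X U W s"
  using assms by (auto simp: ringed_cspace_def opens_in_def)

lemma ringed_cspace_res_closed:
  assumes "ringed_cspace X" "openin (pts X) U" "openin (pts X) V" "V \<subseteq> U" "s \<in> carrier (sec X U)"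
  shows "res X U V s \<in> carrier (sec X V)"
  using ring_hom_closed[OF ringed_cspace_res(1)[OF assms(1-4)] assms(5)] .

text \<open>The common frame for the sheaves of the theorem and for the presheaf tensor product, from which the tensor
  sheaf arises by sheafification.\<close>

locale module_presheaf =
  fixes X :: "('a, 'r) cspace" and M :: "('a, 'r, 'm) omod"
  assumes ringed: "ringed_cspace X"
    and module_sections: "openin (pts X) U \<Longrightarrow> module (sec X U) (msec M U)"
    and res_semilinear: "\<lbrakk>openin (pts X) U; openin (pts X) V; V \<subseteq> U\<rbrakk> \<Longrightarrow>
      semilinear (res X U V) (sec X U) (msec M U) (msec M V) (mres M U V)"
    and res_id: "\<lbrakk>openin (pts X) U; m \<in> carrier (msec M U)\<rbrakk> \<Longrightarrow> mres M U U m = m"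
    and res_trans: "\<lbrakk>openin (pts X) U; openin (pts X) V; openin (pts X) W; V \<subseteq> U; W \<subseteq> V;
      m \<in> carrier (msec M U)\<rbrakk> \<Longrightarrow> mres M V W (mres M U V m) = mres M U W m"
begin

lemmas res_closed = semilinearD(1)[OF res_semilinear]
  and res_add = semilinearD(2)[OF res_semilinear]
  and res_smult = semilinearD(3)[OF res_semilinear]

lemma section_group: "openin (pts X) U \<Longrightarrow> abelian_group (msec M U)"
  using module_sections[of U] by (simp add: module_def)

lemmas add_closed = abelian_monoid.a_closed[OF abelian_group.axioms(1)[OF section_group]]
  and zero_closed = abelian_monoid.zero_closed[OF abelian_group.axioms(1)[OF section_group]]
  and smult_closed = module.smult_closed[OF module_sections]

lemma res_zero:
  assumes "openin (pts X) U" "openin (pts X) V" "V \<subseteq> U"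
  shows "mres M U V \<zero>\<^bsub>msec M U\<^esub> = \<zero>\<^bsub>msec M V\<^esub>"
proof -
  interpret A: abelian_group "msec M U" by (rule section_group[OF assms(1)])
  interpret B: abelian_group "msec M V" by (rule section_group[OF assms(2)])
  let ?z = "mres M U V \<zero>\<^bsub>msec M U\<^esub>"
  have "?z \<oplus>\<^bsub>msec M V\<^esub> ?z = ?z"
    using res_add[OF assms A.zero_closed A.zero_closed] by simp
  then show ?thesis using res_closed[OF assms A.zero_closed] B.add.r_cancel_one' by metis
qed

lemma mem_mgerm:
  "(V, t) \<in> mgerm X M p U s \<longleftrightarrow> openin (pts X) V \<and> p \<in> V \<and> t \<in> carrier (msec M V) \<and>
     (\<exists>W. openin (pts X) W \<and> p \<in> W \<and> W \<subseteq> U \<and> W \<subseteq> V \<and> mres M U W s = mres M V W t)"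
  by (auto simp: mgerm_def germ_def)

lemma mgerm_self:
  assumes "openin (pts X) U" "p \<in> U" "s \<in> carrier (msec M U)"
  shows "(U, s) \<in> mgerm X M p U s"
  using assms by (auto simp: mem_mgerm)

text \<open>Agreement on a neighbourhood makes the germs equal: a further representative agrees with one of the two sections on some
  neighbourhood, and all three agree on the intersection.\<close>

lemma mgerm_subset:
  assumes "openin (pts X) U" "s \<in> carrier (msec M U)" "openin (pts X) V" "t \<in> carrier (msec M V)"
    and "openin (pts X) W" "p \<in> W" "W \<subseteq> U" "W \<subseteq> V" "mres M U W s = mres M V W t"
  shows "mgerm X M p U s \<subseteq> mgerm X M p V t"
proof safe
  fix V' t'
  assume "(V', t') \<in> mgerm X M p U s"
  then obtain W' where W': "openin (pts X) V'" "p \<in> V'" "t' \<in> carrier (msec M V')"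
      "openin (pts X) W'" "p \<in> W'" "W' \<subseteq> U" "W' \<subseteq> V'" "mres M U W' s = mres M V' W' t'"
    by (auto simp: mem_mgerm)
  have o: "openin (pts X) (W \<inter> W')" using assms W' by blast
  have "mres M V (W \<inter> W') t = mres M W (W \<inter> W') (mres M V W t)"
    using assms o by (intro res_trans[symmetric]) auto
  also have "\<dots> = mres M U (W \<inter> W') s"
    unfolding assms(9)[symmetric] using assms o by (intro res_trans) auto
  also have "\<dots> = mres M W' (W \<inter> W') (mres M U W' s)"
    using assms W' o by (intro res_trans[symmetric]) auto
  also have "\<dots> = mres M V' (W \<inter> W') t'"
    unfolding W'(8) using W' o by (intro res_trans) auto
  finally show "(V', t') \<in> mgerm X M p V t"
    using W' assms o by (auto simp: mem_mgerm intro!: exI[of _ "W \<inter> W'"])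
qed

lemma mgerm_eqI:
  assumes "openin (pts X) U" "s \<in> carrier (msec M U)" "openin (pts X) V" "t \<in> carrier (msec M V)"
    and "openin (pts X) W" "p \<in> W" "W \<subseteq> U" "W \<subseteq> V" "mres M U W s = mres M V W t"
  shows "mgerm X M p U s = mgerm X M p V t"
  using mgerm_subset[OF assms] mgerm_subset[OF assms(3,4,1,2,5,6,8,7) assms(9)[symmetric]] by blast

lemma mgerm_res:
  assumes "openin (pts X) U" "s \<in> carrier (msec M U)" "openin (pts X) V" "V \<subseteq> U" "p \<in> V"
  shows "mgerm X M p V (mres M U V s) = mgerm X M p U s"
  using assms by (intro mgerm_eqI[of _ _ _ _ V]) (auto intro: res_closed res_id)

text \<open>Two representatives of a germ agree on some neighbourhood, and the operations commute with restriction to it. So the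
  unions over all representatives that define the operations on germs reduce to a single one.\<close>

lemma germ_add:
  assumes "openin (pts X) U" "p \<in> U" "s \<in> carrier (msec M U)" "t \<in> carrier (msec M U)"
  shows "(\<Union>(V, s')\<in>mgerm X M p U s. \<Union>(W, t')\<in>mgerm X M p U t.
      mgerm X M p (V \<inter> W) (mres M V (V \<inter> W) s' \<oplus>\<^bsub>msec M (V \<inter> W)\<^esub> mres M W (V \<inter> W) t'))
    = mgerm X M p U (s \<oplus>\<^bsub>msec M U\<^esub> t)" (is "?L = ?R")
proof -
  have E: "mgerm X M p (V \<inter> W) (mres M V (V \<inter> W) s' \<oplus>\<^bsub>msec M (V \<inter> W)\<^esub> mres M W (V \<inter> W) t') = ?R"
    if a: "(V, s') \<in> mgerm X M p U s" and b: "(W, t') \<in> mgerm X M p U t" for V s' W t'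
  proof -
    from a obtain A where A: "openin (pts X) V" "p \<in> V" "s' \<in> carrier (msec M V)"
        "openin (pts X) A" "p \<in> A" "A \<subseteq> U" "A \<subseteq> V" "mres M U A s = mres M V A s'"
      by (auto simp: mem_mgerm)
    from b obtain B where B: "openin (pts X) W" "p \<in> W" "t' \<in> carrier (msec M W)"
        "openin (pts X) B" "p \<in> B" "B \<subseteq> U" "B \<subseteq> W" "mres M U B t = mres M W B t'"
      by (auto simp: mem_mgerm)
    let ?C = "A \<inter> B" and ?P = "V \<inter> W"
    have o: "openin (pts X) ?C" "openin (pts X) ?P" and sub: "?C \<subseteq> ?P" "?C \<subseteq> U" using A B by auto
    have s: "mres M V ?C s' = mres M U ?C s"
      using res_trans[of V A ?C s'] res_trans[of U A ?C s] A o assms by simp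
    have t: "mres M W ?C t' = mres M U ?C t"
      using res_trans[of W B ?C t'] res_trans[of U B ?C t] B o assms by simp
    have cl: "mres M V ?P s' \<in> carrier (msec M ?P)" "mres M W ?P t' \<in> carrier (msec M ?P)"
      using A B o by (auto intro!: res_closed)
    have "mres M ?P ?C (mres M V ?P s' \<oplus>\<^bsub>msec M ?P\<^esub> mres M W ?P t')
        = mres M V ?C s' \<oplus>\<^bsub>msec M ?C\<^esub> mres M W ?C t'"
      using res_add[OF o(2,1) sub(1) cl] res_trans[of V ?P ?C s'] res_trans[of W ?P ?C t'] A B o sub by simp
    also have "\<dots> = mres M U ?C (s \<oplus>\<^bsub>msec M U\<^esub> t)"
      using res_add[of U ?C s t] assms o sub by (simp add: s t)
    finally show ?thesis
      using assms A B o sub cl by (intro mgerm_eqI[of _ _ _ _ ?C]) (auto intro: add_closed)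
  qed
  show ?thesis
  proof (intro equalityI subsetI)
    fix z assume "z \<in> ?L"
    then show "z \<in> ?R" using E by blast
  next
    fix z assume z: "z \<in> ?R"
    have "z \<in> mgerm X M p (U \<inter> U) (mres M U (U \<inter> U) s \<oplus>\<^bsub>msec M (U \<inter> U)\<^esub> mres M U (U \<inter> U) t)"
      using E[OF mgerm_self mgerm_self] z assms by simp
    then show "z \<in> ?L" using mgerm_self[OF assms(1,2,3)] mgerm_self[OF assms(1,2,4)] by blast
  qed
qed

lemma germ_smult:
  assumes U: "openin (pts X) U" and r: "r \<in> carrier (sec X U)"
    and V: "openin (pts X) V" "V \<subseteq> U" "p \<in> V" "t \<in> carrier (msec M V)"
  shows "(\<Union>(W, s)\<in>mgerm X M p V t.
      mgerm X M p (U \<inter> W) (res X U (U \<inter> W) r \<odot>\<^bsub>msec M (U \<inter> W)\<^esub> mres M W (U \<inter> W) s))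
    = mgerm X M p V (res X U V r \<odot>\<^bsub>msec M V\<^esub> t)" (is "?L = ?R")
proof -
  have E: "mgerm X M p (U \<inter> W) (res X U (U \<inter> W) r \<odot>\<^bsub>msec M (U \<inter> W)\<^esub> mres M W (U \<inter> W) s) = ?R"
    if "(W, s) \<in> mgerm X M p V t" for W s
  proof -
    from that obtain A where A: "openin (pts X) W" "p \<in> W" "s \<in> carrier (msec M W)"
        "openin (pts X) A" "p \<in> A" "A \<subseteq> V" "A \<subseteq> W" "mres M V A t = mres M W A s"
      by (auto simp: mem_mgerm)
    let ?P = "U \<inter> W"
    have o: "openin (pts X) ?P" and sub: "A \<subseteq> ?P" "A \<subseteq> U" using A U V by auto
    have cl: "res X U ?P r \<in> carrier (sec X ?P)" "mres M W ?P s \<in> carrier (msec M ?P)"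
        "res X U V r \<in> carrier (sec X V)"
      using A o U V r by (auto intro: res_closed ringed_cspace_res_closed[OF ringed])
    have "mres M ?P A (res X U ?P r \<odot>\<^bsub>msec M ?P\<^esub> mres M W ?P s) = res X U A r \<odot>\<^bsub>msec M A\<^esub> mres M W A s"
      using res_smult[OF o A(4) sub(1) cl(1,2)] res_trans[of W ?P A s]
        ringed_cspace_res(3)[OF ringed U o _ A(4) sub(1) r] A o sub by simp
    also have "\<dots> = mres M V A (res X U V r \<odot>\<^bsub>msec M V\<^esub> t)"
      using res_smult[OF V(1) A(4,6) cl(3) V(4)]
        ringed_cspace_res(3)[OF ringed U V(1,2) A(4,6) r] A(8) by simp
    finally show ?thesis
      using assms A o sub cl by (intro mgerm_eqI[of _ _ _ _ A]) (auto intro: smult_closed)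
  qed
  show ?thesis
  proof (intro equalityI subsetI)
    fix z assume "z \<in> ?L"
    then show "z \<in> ?R" using E by blast
  next
    fix z assume z: "z \<in> ?R"
    then have "z \<in> mgerm X M p (U \<inter> V) (res X U (U \<inter> V) r \<odot>\<^bsub>msec M (U \<inter> V)\<^esub> mres M V (U \<inter> V) t)"
      using E[OF mgerm_self[OF V(1,3,4)]] by simp
    then show "z \<in> ?L" using mgerm_self[OF V(1,3,4)] by blast
  qed
qed

text \<open>An identity between sections of the sheafification is proved near each point, by choosing sections of \<open>M\<close> which
  represent everything involved over a common neighbourhood and computing in \<open>M\<close>.\<close>

definition represents :: "('a \<Rightarrow> ('a set \<times> 'm) set) \<Rightarrow> 'a set \<Rightarrow> 'm \<Rightarrow> bool" where
  "represents s V t \<longleftrightarrow> openin (pts X) V \<and> t \<in> carrier (msec M V) \<and> (\<forall>q\<in>V. s q = mgerm X M q V t)"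

lemma represents_restrict:
  "\<lbrakk>represents s V t; openin (pts X) W; W \<subseteq> V\<rbrakk> \<Longrightarrow> represents s W (mres M V W t)"
  by (auto simp: represents_def mgerm_res res_closed)

lemma sheafify_carrier:
  "s \<in> carrier (msec (sheafify X M) U) \<longleftrightarrow>
    s \<in> extensional U \<and> (\<forall>p\<in>U. \<exists>V t. p \<in> V \<and> V \<subseteq> U \<and> represents s V t)"
  unfolding sheafify_def represents_def opens_in_def by simp blast

lemma sheafify_local:
  assumes "s \<in> carrier (msec (sheafify X M) U)" "p \<in> U"
  obtains V t where "p \<in> V" "V \<subseteq> U" "represents s V t"
  using assms unfolding sheafify_carrier by blast

lemma represents_open: "represents s V t \<Longrightarrow> openin (pts X) V"
  by (simp add: represents_def)

lemma sheafify_local2: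
  assumes "s \<in> carrier (msec (sheafify X M) U)" "s' \<in> carrier (msec (sheafify X M) U)" "p \<in> U"
  obtains V t t' where "p \<in> V" "V \<subseteq> U" "represents s V t" "represents s' V t'"
proof -
  obtain V t where V: "p \<in> V" "V \<subseteq> U" "represents s V t" using sheafify_local[OF assms(1,3)] .
  obtain W t' where W: "p \<in> W" "W \<subseteq> U" "represents s' W t'" using sheafify_local[OF assms(2,3)] .
  have o: "openin (pts X) (V \<inter> W)" using V W represents_open by blast
  show ?thesis
    using that[of "V \<inter> W"] V W represents_restrict[OF V(3) o] represents_restrict[OF W(3) o] by blast
qed

lemma sheafify_local3:
  assumes "s \<in> carrier (msec (sheafify X M) U)" "s' \<in> carrier (msec (sheafify X M) U)"
    "s'' \<in> carrier (msec (sheafify X M) U)" "p \<in> U"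
  obtains V t t' t'' where "p \<in> V" "V \<subseteq> U" "represents s V t" "represents s' V t'" "represents s'' V t''"
proof -
  obtain V t t' where V: "p \<in> V" "V \<subseteq> U" "represents s V t" "represents s' V t'"
    using sheafify_local2[OF assms(1,2,4)] .
  obtain W t'' where W: "p \<in> W" "W \<subseteq> U" "represents s'' W t''" using sheafify_local[OF assms(3,4)] .
  have o: "openin (pts X) (V \<inter> W)" using V W represents_open by blast
  show ?thesis
    using that[of "V \<inter> W"] V W represents_restrict[OF V(3) o] represents_restrict[OF V(4) o]
      represents_restrict[OF W(3) o] by blast
qed

lemma section_eqI:
  assumes "s \<in> extensional U" "s' \<in> extensional U"
    and "\<And>p. p \<in> U \<Longrightarrow> \<exists>V t. p \<in> V \<and> represents s V t \<and> represents s' V t"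
  shows "s = s'"
proof (rule extensionalityI[OF assms(1,2)])
  fix p assume "p \<in> U"
  then show "s p = s' p" using assms(3)[of p] by (auto simp: represents_def)
qed

lemma sheafify_extensional: "s \<in> carrier (msec (sheafify X M) U) \<Longrightarrow> s \<in> extensional U"
  by (simp add: sheafify_carrier)

lemma represents_add:
  assumes "represents s V t" "represents s' V t'" "V \<subseteq> U"
  shows "represents (s \<oplus>\<^bsub>msec (sheafify X M) U\<^esub> s') V (t \<oplus>\<^bsub>msec M V\<^esub> t')"
  using assms germ_add[of V _ t t'] unfolding represents_def
  by (auto simp: sheafify_def add_closed subset_iff)

lemma represents_smult:
  assumes "openin (pts X) U" "r \<in> carrier (sec X U)" "represents s V t" "V \<subseteq> U"
  shows "represents (r \<odot>\<^bsub>msec (sheafify X M) U\<^esub> s) V (res X U V r \<odot>\<^bsub>msec M V\<^esub> t)"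
  using assms germ_smult[of U r V _ t] ringed_cspace_res_closed[OF ringed, of U V r] unfolding represents_def
  by (auto simp: sheafify_def smult_closed subset_iff)

lemma represents_zero:
  assumes "openin (pts X) U" "openin (pts X) V" "V \<subseteq> U"
  shows "represents \<zero>\<^bsub>msec (sheafify X M) U\<^esub> V \<zero>\<^bsub>msec M V\<^esub>"
  using assms mgerm_res[of U "\<zero>\<^bsub>msec M U\<^esub>" V] unfolding represents_def
  by (auto simp: sheafify_def zero_closed res_zero subset_iff)

lemma sheafify_ops_extensional:
  "s \<oplus>\<^bsub>msec (sheafify X M) U\<^esub> s' \<in> extensional U"
  "r \<odot>\<^bsub>msec (sheafify X M) U\<^esub> s \<in> extensional U"
  "\<zero>\<^bsub>msec (sheafify X M) U\<^esub> \<in> extensional U"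
  by (auto simp: sheafify_def)

lemma sheafify_ops_closed:
  assumes U: "openin (pts X) U"
  shows sheafify_add_closed: "\<lbrakk>s \<in> carrier (msec (sheafify X M) U); s' \<in> carrier (msec (sheafify X M) U)\<rbrakk> \<Longrightarrow>
      s \<oplus>\<^bsub>msec (sheafify X M) U\<^esub> s' \<in> carrier (msec (sheafify X M) U)"
    and sheafify_smult_closed: "\<lbrakk>r \<in> carrier (sec X U); s \<in> carrier (msec (sheafify X M) U)\<rbrakk> \<Longrightarrow>
      r \<odot>\<^bsub>msec (sheafify X M) U\<^esub> s \<in> carrier (msec (sheafify X M) U)"
    and sheafify_zero_closed: "\<zero>\<^bsub>msec (sheafify X M) U\<^esub> \<in> carrier (msec (sheafify X M) U)"
proof -
  show "s \<oplus>\<^bsub>msec (sheafify X M) U\<^esub> s' \<in> carrier (msec (sheafify X M) U)"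
    if "s \<in> carrier (msec (sheafify X M) U)" "s' \<in> carrier (msec (sheafify X M) U)"
    using that represents_add[of s _ _ s' _ U]
    by (subst sheafify_carrier) (meson sheafify_local2 sheafify_ops_extensional)
  show "r \<odot>\<^bsub>msec (sheafify X M) U\<^esub> s \<in> carrier (msec (sheafify X M) U)"
    if "r \<in> carrier (sec X U)" "s \<in> carrier (msec (sheafify X M) U)"
    using that represents_smult[OF U that(1)]
    by (subst sheafify_carrier) (meson sheafify_local sheafify_ops_extensional)
  show "\<zero>\<^bsub>msec (sheafify X M) U\<^esub> \<in> carrier (msec (sheafify X M) U)"
    using represents_zero[OF U U] by (subst sheafify_carrier) (meson sheafify_ops_extensional subset_refl)
qed

lemma res_neg:
  assumes "openin (pts X) U" "openin (pts X) V" "V \<subseteq> U" "s \<in> carrier (msec M U)"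
  shows "mres M U V (\<ominus>\<^bsub>msec M U\<^esub> s) = \<ominus>\<^bsub>msec M V\<^esub> (mres M U V s)"
proof -
  interpret A: abelian_group "msec M U" by (rule section_group[OF assms(1)])
  interpret B: abelian_group "msec M V" by (rule section_group[OF assms(2)])
  have "mres M U V (\<ominus>\<^bsub>msec M U\<^esub> s) \<oplus>\<^bsub>msec M V\<^esub> mres M U V s = \<zero>\<^bsub>msec M V\<^esub>"
    using res_add[OF assms(1-3), of "\<ominus>\<^bsub>msec M U\<^esub> s" s] assms by (simp add: A.l_neg res_zero)
  then show ?thesis using assms by (intro B.minus_equality[symmetric]) (auto intro: res_closed)
qed

lemma represents_carrier: "represents s V t \<Longrightarrow> t \<in> carrier (msec M V)"
  by (simp add: represents_def)

text \<open>The models are the modules of sections of \<open>M\<close> over neighbourhoods on which all the sections involved are represented.\<close>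

lemma module_sheafify:
  assumes U: "openin (pts X) U"
  shows "module (sec X U) (msec (sheafify X M) U)"
proof (rule locally_modelled.module)
  let ?K = "\<lambda>p. {V. openin (pts X) V \<and> p \<in> V \<and> V \<subseteq> U}"
    and ?scal = "\<lambda>V r s. openin (pts X) V \<and> V \<subseteq> U \<and> r \<in> carrier (sec X U) \<and> s = res X U V r"
  interpret R: cring "sec X U" by (rule ringed_cspace_sections(1)[OF ringed U])
  have hom: "res X U V \<in> ring_hom (sec X U) (sec X V)" and ringV: "ring (sec X V)"
    if "openin (pts X) V" "V \<subseteq> U" for V
    using ringed_cspace_res(1)[OF ringed U that] ringed_cspace_sections(1)[OF ringed that(1)]
    by (simp_all add: cring.axioms(1))
  note res_ops = ring_hom_add[OF hom] ring_hom_mult[OF hom] ring_hom_one[OF hom]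
    ring_hom_zero[OF hom R.ring_axioms ringV]
  show "locally_modelled (sec X U) (msec (sheafify X M) U) U ?K (sec X) (msec M) ?scal (\<lambda>V s. represents s V)"
  proof (intro locally_modelled.intro, unfold mem_Collect_eq)
    fix x y assume xy: "x \<in> carrier (msec (sheafify X M) U)" "y \<in> carrier (msec (sheafify X M) U)"
      and "\<And>p. p \<in> U \<Longrightarrow> \<exists>V\<in>?K p. \<exists>a. represents x V a \<and> represents y V a"
    then show "x = y"
      by (intro section_eqI[OF sheafify_extensional sheafify_extensional]) blast+
  next
    fix p r r' x y z
    assume p: "p \<in> U" and r: "r \<in> carrier (sec X U)" "r' \<in> carrier (sec X U)"
      and xyz: "x \<in> carrier (msec (sheafify X M) U)" "y \<in> carrier (msec (sheafify X M) U)" "z \<in> carrier (msec (sheafify X M) U)"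
    obtain V a b c where "p \<in> V" "V \<subseteq> U" "represents x V a" "represents y V b" "represents z V c"
      by (rule sheafify_local3[OF xyz p])
    then show "\<exists>V\<in>?K p. \<exists>s s' a b c. ?scal V r s \<and> ?scal V r' s' \<and> represents x V a \<and> represents y V b \<and> represents z V c"
      using r represents_open by blast
  qed (use sheafify_ops_closed[OF U] represents_add represents_smult[OF U] represents_zero[OF U] represents_carrier
      module_sections res_ops ringed_cspace_res_closed[OF ringed U] R.cring_axioms in \<open>simp_all\<close>)
qed

lemma represents_eq_on:
  "\<lbrakk>represents s V t; \<And>q. q \<in> V \<Longrightarrow> s' q = s q\<rbrakk> \<Longrightarrow> represents s' V t"
  by (simp add: represents_def)

lemma mres_sheafify [simp]: "mres (sheafify X M) U V s = restrict s V"
  by (simp add: sheafify_def)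

lemma sheafify_res_closed:
  assumes s: "s \<in> carrier (msec (sheafify X M) U)" and V: "openin (pts X) V" "V \<subseteq> U"
  shows "restrict s V \<in> carrier (msec (sheafify X M) V)"
  unfolding sheafify_carrier
proof (intro conjI ballI)
  fix p assume p: "p \<in> V"
  then have "p \<in> U" using V by blast
  then obtain W t where W: "p \<in> W" "W \<subseteq> U" "represents s W t" by (rule sheafify_local[OF s])
  have "represents s (W \<inter> V) (mres M W (W \<inter> V) t)"
    using W V represents_open[OF W(3)] by (intro represents_restrict) auto
  then have "represents (restrict s V) (W \<inter> V) (mres M W (W \<inter> V) t)"
    by (rule represents_eq_on) simp
  then show "\<exists>W t. p \<in> W \<and> W \<subseteq> V \<and> represents (restrict s V) W t" using p W by blast
qed simp

lemma module_presheaf_sheafify: "module_presheaf X (sheafify X M)"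
proof (rule module_presheaf.intro)
  show "ringed_cspace X" by (rule ringed)
  show "module (sec X U) (msec (sheafify X M) U)" if "openin (pts X) U" for U
    by (rule module_sheafify[OF that])
  fix U V assume U: "openin (pts X) U" and V: "openin (pts X) V" and VU: "V \<subseteq> U"
  show "semilinear (res X U V) (sec X U) (msec (sheafify X M) U) (msec (sheafify X M) V) (mres (sheafify X M) U V)"
    unfolding mres_sheafify
  proof (rule semilinearI)
    show "restrict s V \<in> carrier (msec (sheafify X M) V)" if "s \<in> carrier (msec (sheafify X M) U)" for s
      by (rule sheafify_res_closed[OF that V VU])
    show "restrict (s \<oplus>\<^bsub>msec (sheafify X M) U\<^esub> s') V
        = restrict s V \<oplus>\<^bsub>msec (sheafify X M) V\<^esub> restrict s' V" for s s'
      using VU by (auto simp: sheafify_def restrict_def fun_eq_iff)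
    show "restrict (r \<odot>\<^bsub>msec (sheafify X M) U\<^esub> s) V
        = res X U V r \<odot>\<^bsub>msec (sheafify X M) V\<^esub> restrict s V"
      if r: "r \<in> carrier (sec X U)" and s: "s \<in> carrier (msec (sheafify X M) U)" for r s
    proof (rule section_eqI[of _ V])
      fix p assume p: "p \<in> V"
      obtain W t where W: "p \<in> W" "W \<subseteq> V" "represents (restrict s V) W t"
        using sheafify_local[OF sheafify_res_closed[OF s V VU] p] .
      have sW: "represents s W t"
        using W(2) by (intro represents_eq_on[OF W(3)]) auto
      have o: "openin (pts X) W" using W represents_open by blast
      have "represents (r \<odot>\<^bsub>msec (sheafify X M) U\<^esub> s) W (res X U W r \<odot>\<^bsub>msec M W\<^esub> t)"
        using W VU by (intro represents_smult[OF U r sW]) auto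
      then have 1: "represents (restrict (r \<odot>\<^bsub>msec (sheafify X M) U\<^esub> s) V) W (res X U W r \<odot>\<^bsub>msec M W\<^esub> t)"
        by (rule represents_eq_on) (use W in auto)
      have 2: "represents (res X U V r \<odot>\<^bsub>msec (sheafify X M) V\<^esub> restrict s V) W
          (res X V W (res X U V r) \<odot>\<^bsub>msec M W\<^esub> t)"
        using W r by (intro represents_smult[OF V]) (auto intro: ringed_cspace_res_closed[OF ringed U V VU])
      show "\<exists>W t. p \<in> W \<and> represents (restrict (r \<odot>\<^bsub>msec (sheafify X M) U\<^esub> s) V) W t \<and>
          represents (res X U V r \<odot>\<^bsub>msec (sheafify X M) V\<^esub> restrict s V) W t"
        using W(1) 1 2 ringed_cspace_res(3)[OF ringed U V VU o W(2) r] by auto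
    qed (auto intro: sheafify_ops_extensional)
  qed
next
  show "mres (sheafify X M) U U s = s" if "s \<in> carrier (msec (sheafify X M) U)" for U s
    using sheafify_extensional[OF that] by (simp add: extensional_restrict)
next
  show "mres (sheafify X M) V W (mres (sheafify X M) U V s) = mres (sheafify X M) U W s"
    if "W \<subseteq> V" for U V W s
    using that by (auto simp: restrict_def fun_eq_iff)
qed

end

section \<open>Tensor products of sheaves and their morphisms\<close>

locale presheaf_pair = M: module_presheaf X M + N: module_presheaf X N
  for X :: "('a, 'r) cspace" and M :: "('a, 'r, 'm) omod" and N :: "('a, 'r, 'n) omod"

locale presheaf_morphism = presheaf_pair X M N
  for X :: "('a, 'r) cspace" and M :: "('a, 'r, 'm) omod" and N :: "('a, 'r, 'n) omod" +
  fixes f :: "'a set \<Rightarrow> 'm \<Rightarrow> 'n"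
  assumes map_linear: "openin (pts X) U \<Longrightarrow> semilinear (\<lambda>r. r) (sec X U) (msec M U) (msec N U) (f U)"
    and map_res: "\<lbrakk>openin (pts X) U; openin (pts X) V; V \<subseteq> U; m \<in> carrier (msec M U)\<rbrakk> \<Longrightarrow>
      f V (mres M U V m) = mres N U V (f U m)"

text \<open>When \<open>f\<close> is a family of maps \<open>tensor_map\<close>, this is \<open>tensor_morphism\<close>.\<close>

definition sheafify_map ::
  "('a, 'r) cspace \<Rightarrow> ('a, 'r, 'n) omod \<Rightarrow> ('a set \<Rightarrow> 'm \<Rightarrow> 'n) \<Rightarrow> 'a set \<Rightarrow>
    ('a \<Rightarrow> ('a set \<times> 'm) set) \<Rightarrow> 'a \<Rightarrow> ('a set \<times> 'n) set" where
  "sheafify_map X N f U s = (\<lambda>p\<in>U. \<Union>(V, t)\<in>s p. mgerm X N p V (f V t))"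

context presheaf_morphism begin

lemmas map_closed = semilinearD(1)[OF map_linear]
  and map_add = semilinearD(2)[OF map_linear]
  and map_smult = semilinearD(3)[OF map_linear]

text \<open>As \<open>f\<close> commutes with restriction, equal germs have equal images.\<close>

lemma germ_map:
  assumes U: "openin (pts X) U" "p \<in> U" "s \<in> carrier (msec M U)"
  shows "(\<Union>(V, t)\<in>mgerm X M p U s. mgerm X N p V (f V t)) = mgerm X N p U (f U s)" (is "?L = ?R")
proof -
  have E: "mgerm X N p V (f V t) = ?R" if "(V, t) \<in> mgerm X M p U s" for V t
  proof -
    from that obtain A where A: "openin (pts X) V" "p \<in> V" "t \<in> carrier (msec M V)"
        "openin (pts X) A" "p \<in> A" "A \<subseteq> U" "A \<subseteq> V" "mres M U A s = mres M V A t"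
      by (auto simp: M.mem_mgerm)
    then have "mres N V A (f V t) = mres N U A (f U s)"
      using map_res[of V A t] map_res[of U A s] U by simp
    then show ?thesis
      using A U by (intro N.mgerm_eqI[of _ _ _ _ A]) (auto intro: map_closed)
  qed
  show ?thesis
  proof (intro equalityI subsetI)
    fix z assume "z \<in> ?L"
    then show "z \<in> ?R" using E by blast
  next
    fix z assume "z \<in> ?R"
    then show "z \<in> ?L" using M.mgerm_self[OF U] by blast
  qed
qed

lemma represents_map:
  assumes "M.represents s V t" "V \<subseteq> U"
  shows "N.represents (sheafify_map X N f U s) V (f V t)"
  using assms germ_map[of V _ t] map_closed
  unfolding M.represents_def N.represents_def sheafify_map_def by (auto simp: subset_iff)

lemma sheafify_map_closed:
  assumes "s \<in> carrier (msec (sheafify X M) U)"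
  shows "sheafify_map X N f U s \<in> carrier (msec (sheafify X N) U)"
  unfolding N.sheafify_carrier
proof (intro conjI ballI)
  fix p assume p: "p \<in> U"
  obtain V t where "p \<in> V" "V \<subseteq> U" "M.represents s V t" by (rule M.sheafify_local[OF assms p])
  then show "\<exists>V t. p \<in> V \<and> V \<subseteq> U \<and> N.represents (sheafify_map X N f U s) V t"
    using represents_map by blast
qed (simp add: sheafify_map_def)

lemma presheaf_morphism_sheafify:
  "presheaf_morphism X (sheafify X M) (sheafify X N) (sheafify_map X N f)"
proof (intro presheaf_morphism.intro presheaf_pair.intro presheaf_morphism_axioms.intro)
  show "module_presheaf X (sheafify X M)" by (rule M.module_presheaf_sheafify)
  show "module_presheaf X (sheafify X N)" by (rule N.module_presheaf_sheafify)
  fix U assume U: "openin (pts X) U"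
  have ext: "sheafify_map X N f U s \<in> extensional U" for s by (simp add: sheafify_map_def)
  show "semilinear (\<lambda>r. r) (sec X U) (msec (sheafify X M) U) (msec (sheafify X N) U) (sheafify_map X N f U)"
  proof (rule semilinearI)
    show "sheafify_map X N f U s \<in> carrier (msec (sheafify X N) U)"
      if "s \<in> carrier (msec (sheafify X M) U)" for s
      by (rule sheafify_map_closed[OF that])
    show "sheafify_map X N f U (s \<oplus>\<^bsub>msec (sheafify X M) U\<^esub> s')
        = sheafify_map X N f U s \<oplus>\<^bsub>msec (sheafify X N) U\<^esub> sheafify_map X N f U s'"
      if s: "s \<in> carrier (msec (sheafify X M) U)" "s' \<in> carrier (msec (sheafify X M) U)" for s s'
    proof (rule N.section_eqI[of _ U])
      fix p assume p: "p \<in> U"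
      obtain V t t' where V: "p \<in> V" "V \<subseteq> U" "M.represents s V t" "M.represents s' V t'"
        by (rule M.sheafify_local2[OF s p])
      have "N.represents (sheafify_map X N f U (s \<oplus>\<^bsub>msec (sheafify X M) U\<^esub> s')) V (f V (t \<oplus>\<^bsub>msec M V\<^esub> t'))"
        using V by (intro represents_map M.represents_add)
      moreover have "N.represents (sheafify_map X N f U s \<oplus>\<^bsub>msec (sheafify X N) U\<^esub> sheafify_map X N f U s') V
          (f V t \<oplus>\<^bsub>msec N V\<^esub> f V t')"
        using V by (intro represents_map N.represents_add)
      moreover have "f V (t \<oplus>\<^bsub>msec M V\<^esub> t') = f V t \<oplus>\<^bsub>msec N V\<^esub> f V t'"
        using V M.represents_open M.represents_carrier by (intro map_add) blast+
      ultimately show "\<exists>V t. p \<in> V \<and> N.represents (sheafify_map X N f U (s \<oplus>\<^bsub>msec (sheafify X M) U\<^esub> s')) V t \<and>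
          N.represents (sheafify_map X N f U s \<oplus>\<^bsub>msec (sheafify X N) U\<^esub> sheafify_map X N f U s') V t"
        using V by metis
    qed (rule ext N.sheafify_ops_extensional)+
    show "sheafify_map X N f U (r \<odot>\<^bsub>msec (sheafify X M) U\<^esub> s)
        = r \<odot>\<^bsub>msec (sheafify X N) U\<^esub> sheafify_map X N f U s"
      if r: "r \<in> carrier (sec X U)" and s: "s \<in> carrier (msec (sheafify X M) U)" for r s
    proof (rule N.section_eqI[of _ U])
      fix p assume p: "p \<in> U"
      obtain V t where V: "p \<in> V" "V \<subseteq> U" "M.represents s V t"
        by (rule M.sheafify_local[OF s p])
      have "N.represents (sheafify_map X N f U (r \<odot>\<^bsub>msec (sheafify X M) U\<^esub> s)) V (f V (res X U V r \<odot>\<^bsub>msec M V\<^esub> t))"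
        using V by (intro represents_map M.represents_smult[OF U r])
      moreover have "N.represents (r \<odot>\<^bsub>msec (sheafify X N) U\<^esub> sheafify_map X N f U s) V
          (res X U V r \<odot>\<^bsub>msec N V\<^esub> f V t)"
        using V by (intro represents_map N.represents_smult[OF U r])
      moreover have "f V (res X U V r \<odot>\<^bsub>msec M V\<^esub> t) = res X U V r \<odot>\<^bsub>msec N V\<^esub> f V t"
        using V M.represents_open[OF V(3)] M.represents_carrier[OF V(3)]
        by (intro map_smult ringed_cspace_res_closed[OF M.ringed U _ _ r])
      ultimately show "\<exists>V t. p \<in> V \<and> N.represents (sheafify_map X N f U (r \<odot>\<^bsub>msec (sheafify X M) U\<^esub> s)) V t \<and>
          N.represents (r \<odot>\<^bsub>msec (sheafify X N) U\<^esub> sheafify_map X N f U s) V t"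
        using V by metis
    qed (rule ext N.sheafify_ops_extensional)+
  qed
next
  show "sheafify_map X N f V (mres (sheafify X M) U V s) = mres (sheafify X N) U V (sheafify_map X N f U s)"
    if "V \<subseteq> U" for U V s
    using that by (auto simp: sheafify_map_def restrict_def fun_eq_iff)
qed

end

context presheaf_pair begin

lemma section_pair: "openin (pts X) U \<Longrightarrow> module_pair (sec X U) (msec M U) (msec N U)"
  by (intro module_pair.intro M.module_sections N.module_sections)

lemma res_funcset:
  "\<lbrakk>openin (pts X) U; openin (pts X) V; V \<subseteq> U\<rbrakk> \<Longrightarrow> res X U V \<in> carrier (sec X U) \<rightarrow> carrier (sec X V)"
  using ringed_cspace_res_closed[OF M.ringed] by blast

lemma msec_tensor_presheaf [simp]:
  "msec (tensor_presheaf X M N) U = tensor_module (sec X U) (msec M U) (msec N U)"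
  by (simp add: tensor_presheaf_def)

lemma mres_tensor_presheaf:
  assumes "openin (pts X) U" "openin (pts X) V" "V \<subseteq> U"
  shows "mres (tensor_presheaf X M N) U V (tensor_class (sec X U) (msec M U) (msec N U) c)
    = tensor_class (sec X V) (msec M V) (msec N V) (tensor_lift (mres M U V) (mres N U V) c)"
  using tensor_map_class[OF section_pair section_pair res_funcset M.res_semilinear N.res_semilinear] assms
  by (simp add: tensor_presheaf_def)

lemma module_presheaf_tensor_presheaf: "module_presheaf X (tensor_presheaf X M N)"
proof (rule module_presheaf.intro)
  show "ringed_cspace X" by (rule M.ringed)
  show "module (sec X U) (msec (tensor_presheaf X M N) U)" if "openin (pts X) U" for U
    using module_pair.module_tensor[OF section_pair[OF that]] by simp
  fix U V assume U: "openin (pts X) U" and V: "openin (pts X) V" and VU: "V \<subseteq> U"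
  show "semilinear (res X U V) (sec X U) (msec (tensor_presheaf X M N) U) (msec (tensor_presheaf X M N) V)
      (mres (tensor_presheaf X M N) U V)"
    using tensor_map_semilinear[OF section_pair section_pair res_funcset M.res_semilinear N.res_semilinear] U V VU
    by (simp add: tensor_presheaf_def)
next
  fix U x assume U: "openin (pts X) U" and "x \<in> carrier (msec (tensor_presheaf X M N) U)"
  then obtain c where c: "x = tensor_class (sec X U) (msec M U) (msec N U) c"
      "Poly_Mapping.keys c \<subseteq> carrier (msec M U) \<times> carrier (msec N U)"
    using module_pair.tensor_class_carrier[OF section_pair[OF U]] by auto
  have "tensor_lift (mres M U U) (mres N U U) c = c"
    using M.res_id[OF U] N.res_id[OF U] by (rule tensor_lift_id[OF c(2)])
  then show "mres (tensor_presheaf X M N) U U x = x"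
    using mres_tensor_presheaf[OF U U] c by simp
next
  fix U V W x
  assume o: "openin (pts X) U" "openin (pts X) V" "openin (pts X) W" and sub: "V \<subseteq> U" "W \<subseteq> V"
    and x: "x \<in> carrier (msec (tensor_presheaf X M N) U)"
  obtain c where c: "x = tensor_class (sec X U) (msec M U) (msec N U) c"
      "Poly_Mapping.keys c \<subseteq> carrier (msec M U) \<times> carrier (msec N U)"
    using x module_pair.tensor_class_carrier[OF section_pair[OF o(1)]] by auto
  have "tensor_lift (mres M V W) (mres N V W) (tensor_lift (mres M U V) (mres N U V) c)
      = tensor_lift (mres M U W) (mres N U W) c"
    unfolding tensor_lift_comp
    using M.res_trans[OF o sub] N.res_trans[OF o sub] by (intro tensor_lift_cong[OF c(2)]) auto
  then show "mres (tensor_presheaf X M N) V W (mres (tensor_presheaf X M N) U V x)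
      = mres (tensor_presheaf X M N) U W x"
    using mres_tensor_presheaf o sub c by simp
qed

sublocale T: module_presheaf X "tensor_presheaf X M N"
  by (rule module_presheaf_tensor_presheaf)

lemma module_presheaf_tensor_sheaf: "module_presheaf X (tensor_sheaf X M N)"
  unfolding tensor_sheaf_def by (rule T.module_presheaf_sheafify)

abbreviation pure :: "'a set \<Rightarrow> 'm \<Rightarrow> 'n \<Rightarrow> ('m \<times> 'n \<Rightarrow>\<^sub>0 int) set" where
  "pure U m n \<equiv> tensor_class (sec X U) (msec M U) (msec N U) (frag_of (m, n))"

lemma represents_tensor_section:
  assumes "openin (pts X) U" "m \<in> carrier (msec M U)" "n \<in> carrier (msec N U)"
  shows "T.represents (tensor_section X M N U m n) U (pure U m n)"
  using assms module_pair.tensor_pure_carrier[OF section_pair]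
  by (simp add: T.represents_def tensor_section_def)

lemma tensor_section_extensional: "tensor_section X M N U m n \<in> extensional U"
  by (simp add: tensor_section_def)

lemma tensor_section_closed:
  assumes "openin (pts X) U" "m \<in> carrier (msec M U)" "n \<in> carrier (msec N U)"
  shows "tensor_section X M N U m n \<in> carrier (msec (tensor_sheaf X M N) U)"
  using represents_tensor_section[OF assms]
  by (auto simp: tensor_sheaf_def T.sheafify_carrier tensor_section_extensional)

text \<open>For identities between sections \<open>m \<otimes> n\<close>, where both sides are represented by tensors over the whole of \<open>U\<close>.\<close>

lemma section_eq_represents:
  assumes "s \<in> extensional U" "s' \<in> extensional U" "T.represents s U t" "T.represents s' U t"
  shows "s = s'"
  using assms by (intro T.section_eqI) auto

lemma tensor_section_res:
  assumes U: "openin (pts X) U" and V: "openin (pts X) V" and VU: "V \<subseteq> U"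
    and mn: "m \<in> carrier (msec M U)" "n \<in> carrier (msec N U)"
  shows "mres (tensor_sheaf X M N) U V (tensor_section X M N U m n)
    = tensor_section X M N V (mres M U V m) (mres N U V n)"
proof (rule section_eq_represents[of _ V])
  have "T.represents (tensor_section X M N U m n) V (pure V (mres M U V m) (mres N U V n))"
    using T.represents_restrict[OF represents_tensor_section[OF U mn] V VU]
      mres_tensor_presheaf[OF U V VU, of "frag_of (m, n)"] by simp
  then show "T.represents (mres (tensor_sheaf X M N) U V (tensor_section X M N U m n)) V
      (pure V (mres M U V m) (mres N U V n))"
    unfolding tensor_sheaf_def T.mres_sheafify by (rule T.represents_eq_on) simp
  show "T.represents (tensor_section X M N V (mres M U V m) (mres N U V n)) V
      (pure V (mres M U V m) (mres N U V n))"
    by (rule represents_tensor_section[OF V M.res_closed[OF U V VU mn(1)] N.res_closed[OF U V VU mn(2)]])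
qed (simp_all add: tensor_section_extensional tensor_sheaf_def)

lemma tensor_section_add_left:
  assumes U: "openin (pts X) U" and mn: "m \<in> carrier (msec M U)" "m' \<in> carrier (msec M U)" "n \<in> carrier (msec N U)"
  shows "tensor_section X M N U (m \<oplus>\<^bsub>msec M U\<^esub> m') n
    = tensor_section X M N U m n \<oplus>\<^bsub>msec (tensor_sheaf X M N) U\<^esub> tensor_section X M N U m' n"
  unfolding tensor_sheaf_def
  using T.represents_add[OF represents_tensor_section[OF U mn(1,3)] represents_tensor_section[OF U mn(2,3)], of U]
    represents_tensor_section[OF U M.add_closed[OF U mn(1,2)] mn(3)]
    module_pair.tensor_pure(1)[OF section_pair[OF U] mn]
  by (intro section_eq_represents[OF tensor_section_extensional T.sheafify_ops_extensional(1)]) auto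

lemma tensor_section_balanced:
  assumes U: "openin (pts X) U" and "r \<in> carrier (sec X U)" "m \<in> carrier (msec M U)" "n \<in> carrier (msec N U)"
  shows "tensor_section X M N U (r \<odot>\<^bsub>msec M U\<^esub> m) n = tensor_section X M N U m (r \<odot>\<^bsub>msec N U\<^esub> n)"
  using module_pair.tensor_pure(2)[OF section_pair[OF U] assms(2-4)] by (simp add: tensor_section_def)

lemma tensor_section_smult:
  assumes U: "openin (pts X) U" and r: "r \<in> carrier (sec X U)"
    and mn: "m \<in> carrier (msec M U)" "n \<in> carrier (msec N U)"
  shows "r \<odot>\<^bsub>msec (tensor_sheaf X M N) U\<^esub> tensor_section X M N U m n
    = tensor_section X M N U (r \<odot>\<^bsub>msec M U\<^esub> m) n"
proof -
  have "T.represents (r \<odot>\<^bsub>msec (tensor_sheaf X M N) U\<^esub> tensor_section X M N U m n) U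
      (pure U (r \<odot>\<^bsub>msec M U\<^esub> m) n)"
    using T.represents_smult[OF U r represents_tensor_section[OF U mn] order_refl]
      ringed_cspace_sections(3)[OF M.ringed U r] module_pair.tensor_smult[OF section_pair[OF U] r]
    by (simp add: tensor_sheaf_def)
  then show ?thesis
    using represents_tensor_section[OF U M.smult_closed[OF U r mn(1)] mn(2)]
    by (intro section_eq_represents[OF _ tensor_section_extensional])
      (auto simp: tensor_sheaf_def T.sheafify_ops_extensional)
qed

text \<open>For the canonical section of \<open>\<O>(H)\<close> this is the map \<open>L \<rightarrow> L \<otimes> \<O>(H)\<close> that enters the twist morphism.\<close>

lemma presheaf_morphism_tensor_section:
  assumes "\<And>U. openin (pts X) U \<Longrightarrow> \<sigma> U \<in> carrier (msec N U)"
    and "\<And>U V. \<lbrakk>openin (pts X) U; openin (pts X) V; V \<subseteq> U\<rbrakk> \<Longrightarrow> mres N U V (\<sigma> U) = \<sigma> V"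
  shows "presheaf_morphism X M (tensor_sheaf X M N) (\<lambda>U m. tensor_section X M N U m (\<sigma> U))"
  by (intro presheaf_morphism.intro presheaf_pair.intro presheaf_morphism_axioms.intro semilinearI)
    (simp_all add: M.module_presheaf_axioms module_presheaf_tensor_sheaf tensor_section_closed
      tensor_section_add_left tensor_section_smult tensor_section_res assms)

end

locale two_presheaf_morphisms = f: presheaf_morphism X M M' f + g: presheaf_morphism X N N' g
  for X :: "('a, 'r) cspace" and M :: "('a, 'r, 'm) omod" and M' :: "('a, 'r, 'k) omod" and f
    and N :: "('a, 'r, 'n) omod" and N' :: "('a, 'r, 'l) omod" and g
begin

sublocale source: presheaf_pair X M N ..
sublocale target: presheaf_pair X M' N' ..

lemma tensor_map_pure:
  assumes "openin (pts X) U"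
  shows "tensor_map (sec X U) (msec M' U) (msec N' U) (f U) (g U) (tensor_class (sec X U) (msec M U) (msec N U) c)
    = tensor_class (sec X U) (msec M' U) (msec N' U) (tensor_lift (f U) (g U) c)"
  by (rule tensor_map_class[where \<phi> = "\<lambda>r. r"])
    (auto intro: source.section_pair target.section_pair f.map_linear g.map_linear assms)

lemma presheaf_morphism_tensor_presheaf:
  "presheaf_morphism X (tensor_presheaf X M N) (tensor_presheaf X M' N')
    (\<lambda>U. tensor_map (sec X U) (msec M' U) (msec N' U) (f U) (g U))"
proof (intro presheaf_morphism.intro presheaf_pair.intro presheaf_morphism_axioms.intro)
  show "module_presheaf X (tensor_presheaf X M N)" by (rule source.module_presheaf_tensor_presheaf)
  show "module_presheaf X (tensor_presheaf X M' N')" by (rule target.module_presheaf_tensor_presheaf)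
  show "semilinear (\<lambda>r. r) (sec X U) (msec (tensor_presheaf X M N) U) (msec (tensor_presheaf X M' N') U)
      (tensor_map (sec X U) (msec M' U) (msec N' U) (f U) (g U))" if "openin (pts X) U" for U
    unfolding source.msec_tensor_presheaf target.msec_tensor_presheaf
    by (rule tensor_map_semilinear)
      (auto intro: source.section_pair target.section_pair f.map_linear g.map_linear that)
  fix U V x
  assume o: "openin (pts X) U" "openin (pts X) V" and sub: "V \<subseteq> U"
    and x: "x \<in> carrier (msec (tensor_presheaf X M N) U)"
  obtain c where c: "x = tensor_class (sec X U) (msec M U) (msec N U) c"
      "Poly_Mapping.keys c \<subseteq> carrier (msec M U) \<times> carrier (msec N U)"
    using x module_pair.tensor_class_carrier[OF source.section_pair[OF o(1)]] by auto
  have "tensor_lift (f V) (g V) (tensor_lift (mres M U V) (mres N U V) c)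
      = tensor_lift (mres M' U V) (mres N' U V) (tensor_lift (f U) (g U) c)"
    unfolding tensor_lift_comp
    using f.map_res[OF o sub] g.map_res[OF o sub] by (intro tensor_lift_cong[OF c(2)]) auto
  then show "tensor_map (sec X V) (msec M' V) (msec N' V) (f V) (g V) (mres (tensor_presheaf X M N) U V x)
      = mres (tensor_presheaf X M' N') U V (tensor_map (sec X U) (msec M' U) (msec N' U) (f U) (g U) x)"
    unfolding c source.mres_tensor_presheaf[OF o sub] tensor_map_pure[OF o(1)] tensor_map_pure[OF o(2)]
      target.mres_tensor_presheaf[OF o sub] by simp
qed

lemma tensor_morphism_sheafify_map:
  "tensor_morphism X M' N' f g = sheafify_map X (tensor_presheaf X M' N')
    (\<lambda>U. tensor_map (sec X U) (msec M' U) (msec N' U) (f U) (g U))"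
  by (simp add: fun_eq_iff tensor_morphism_def sheafify_map_def)

lemma presheaf_morphism_tensor_sheaf:
  "presheaf_morphism X (tensor_sheaf X M N) (tensor_sheaf X M' N') (tensor_morphism X M' N' f g)"
  unfolding tensor_morphism_sheafify_map tensor_sheaf_def
  by (rule presheaf_morphism.presheaf_morphism_sheafify[OF presheaf_morphism_tensor_presheaf])

lemma tensor_morphism_section:
  assumes U: "openin (pts X) U" and mn: "m \<in> carrier (msec M U)" "n \<in> carrier (msec N U)"
  shows "tensor_morphism X M' N' f g U (tensor_section X M N U m n) = tensor_section X M' N' U (f U m) (g U n)"
proof (rule target.section_eq_represents)
  show "target.T.represents (tensor_morphism X M' N' f g U (tensor_section X M N U m n)) U
      (target.pure U (f U m) (g U n))"
    using presheaf_morphism.represents_map[OF presheaf_morphism_tensor_presheaf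
        source.represents_tensor_section[OF U mn] order_refl] tensor_map_pure[OF U, of "frag_of (m, n)"]
    by (simp add: tensor_morphism_sheafify_map)
  show "target.T.represents (tensor_section X M' N' U (f U m) (g U n)) U (target.pure U (f U m) (g U n))"
    using target.represents_tensor_section[OF U f.map_closed[OF U mn(1)] g.map_closed[OF U mn(2)]] .
qed (simp_all add: tensor_morphism_def target.tensor_section_extensional)

end

section \<open>Cech cohomology in degree one\<close>

context module_presheaf begin

lemma sum_eq_on_smaller:
  assumes o: "openin (pts X) A" "openin (pts X) B" "openin (pts X) C" "openin (pts X) D"
    and m: "a \<in> carrier (msec M A)" "b \<in> carrier (msec M B)" "c \<in> carrier (msec M C)" "d \<in> carrier (msec M D)"
    and Q: "openin (pts X) Q" "Q \<subseteq> A" "Q \<subseteq> B" "Q \<subseteq> C" "Q \<subseteq> D" and P: "openin (pts X) P" "P \<subseteq> Q"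
    and eq: "mres M A Q a \<oplus>\<^bsub>msec M Q\<^esub> mres M B Q b = mres M C Q c \<oplus>\<^bsub>msec M Q\<^esub> mres M D Q d"
  shows "mres M A P a \<oplus>\<^bsub>msec M P\<^esub> mres M B P b = mres M C P c \<oplus>\<^bsub>msec M P\<^esub> mres M D P d"
proof -
  have "mres M U P u \<oplus>\<^bsub>msec M P\<^esub> mres M V P v = mres M Q P (mres M U Q u \<oplus>\<^bsub>msec M Q\<^esub> mres M V Q v)"
    if "openin (pts X) U" "u \<in> carrier (msec M U)" "Q \<subseteq> U" "openin (pts X) V" "v \<in> carrier (msec M V)" "Q \<subseteq> V"
    for U u V v
    using that by (simp add: res_add[OF Q(1) P] res_closed[OF _ Q(1)] res_trans[OF _ Q(1) P(1) _ P(2)])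
  then show ?thesis using o m Q eq by simp
qed

lemma cech_cocycleD:
  assumes "cech_cocycle X M I U c" "i \<in> I"
  shows "openin (pts X) (U i)"
    and "j \<in> I \<Longrightarrow> c i j \<in> carrier (msec M (U i \<inter> U j))"
    and "(\<Union>i\<in>I. U i) = points X"
  using assms by (auto simp: cech_cocycle_def open_cover_def)

lemma cech_cocycle_on:
  assumes c: "cech_cocycle X M I U c" and ijk: "i \<in> I" "j \<in> I" "k \<in> I"
    and P: "openin (pts X) P" "P \<subseteq> U i" "P \<subseteq> U j" "P \<subseteq> U k"
  shows "mres M (U i \<inter> U j) P (c i j) \<oplus>\<^bsub>msec M P\<^esub> mres M (U j \<inter> U k) P (c j k)
    = mres M (U i \<inter> U k) P (c i k)"
proof -
  let ?W = "U i \<inter> U j \<inter> U k"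
  have o: "openin (pts X) (U i)" "openin (pts X) (U j)" "openin (pts X) (U k)"
    using cech_cocycleD(1)[OF c] ijk by auto
  have oW: "openin (pts X) ?W" "P \<subseteq> ?W" using o P by auto
  have "mres M (U i \<inter> U j) ?W (c i j) \<oplus>\<^bsub>msec M ?W\<^esub> mres M (U j \<inter> U k) ?W (c j k)
      = mres M (U i \<inter> U k) ?W (c i k)"
    using c ijk by (simp add: cech_cocycle_def Let_def)
  from arg_cong[OF this, of "mres M ?W P"] show ?thesis
    using o oW P cech_cocycleD(2)[OF c] ijk
    by (simp add: res_add res_closed res_trans openin_Int le_infI1 le_infI2)
qed

text \<open>The witnesses for two cocycles to be cohomologous: a common refinement \<open>W\<close> of the covers, with index maps \<open>s\<close> and \<open>t\<close>,
  and a 0-cochain \<open>b\<close> on \<open>W\<close>.\<close>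

definition cech_comparison ::
  "'i set \<Rightarrow> ('i \<Rightarrow> 'a set) \<Rightarrow> ('i \<Rightarrow> 'i \<Rightarrow> 'm) \<Rightarrow> 'j set \<Rightarrow> ('j \<Rightarrow> 'a set) \<Rightarrow> ('j \<Rightarrow> 'j \<Rightarrow> 'm) \<Rightarrow>
    ('a \<Rightarrow> 'a set) \<Rightarrow> ('a \<Rightarrow> 'i) \<Rightarrow> ('a \<Rightarrow> 'j) \<Rightarrow> ('a \<Rightarrow> 'm) \<Rightarrow> bool" where
  "cech_comparison I U c J V d W s t b \<longleftrightarrow>
    (\<forall>p\<in>points X. openin (pts X) (W p) \<and> p \<in> W p \<and> s p \<in> I \<and> W p \<subseteq> U (s p) \<and>
       t p \<in> J \<and> W p \<subseteq> V (t p) \<and> b p \<in> carrier (msec M (W p))) \<and>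
    (\<forall>p\<in>points X. \<forall>q\<in>points X. let P = W p \<inter> W q in
       mres M (U (s p) \<inter> U (s q)) P (c (s p) (s q)) \<oplus>\<^bsub>msec M P\<^esub> mres M (W q) P (b q)
       = mres M (V (t p) \<inter> V (t q)) P (d (t p) (t q)) \<oplus>\<^bsub>msec M P\<^esub> mres M (W p) P (b p))"

lemma cech_cohomologous_iff:
  "cech_cohomologous X M I U c J V d \<longleftrightarrow> cech_cocycle X M I U c \<and> cech_cocycle X M J V d \<and>
    (\<exists>W s t b. cech_comparison I U c J V d W s t b)"
  unfolding cech_cohomologous_def cech_comparison_def ..

lemma cech_comparisonD:
  assumes "cech_comparison I U c J V d W s t b" "p \<in> points X"
  shows "openin (pts X) (W p) \<and> p \<in> W p \<and> s p \<in> I \<and> W p \<subseteq> U (s p) \<and>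
       t p \<in> J \<and> W p \<subseteq> V (t p) \<and> b p \<in> carrier (msec M (W p))"
    and "q \<in> points X \<Longrightarrow>
      mres M (U (s p) \<inter> U (s q)) (W p \<inter> W q) (c (s p) (s q)) \<oplus>\<^bsub>msec M (W p \<inter> W q)\<^esub> mres M (W q) (W p \<inter> W q) (b q)
      = mres M (V (t p) \<inter> V (t q)) (W p \<inter> W q) (d (t p) (t q)) \<oplus>\<^bsub>msec M (W p \<inter> W q)\<^esub> mres M (W p) (W p \<inter> W q) (b p)"
  using assms by (simp_all add: cech_comparison_def Let_def)

lemma cech_cohomologousI:
  assumes "cech_cocycle X M I U c" "cech_cocycle X M J V d"
    and "\<And>p. p \<in> points X \<Longrightarrow> openin (pts X) (W p) \<and> p \<in> W p \<and> s p \<in> I \<and> W p \<subseteq> U (s p) \<and>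
         t p \<in> J \<and> W p \<subseteq> V (t p) \<and> b p \<in> carrier (msec M (W p))"
    and "\<And>p q. p \<in> points X \<Longrightarrow> q \<in> points X \<Longrightarrow>
      mres M (U (s p) \<inter> U (s q)) (W p \<inter> W q) (c (s p) (s q)) \<oplus>\<^bsub>msec M (W p \<inter> W q)\<^esub> mres M (W q) (W p \<inter> W q) (b q)
      = mres M (V (t p) \<inter> V (t q)) (W p \<inter> W q) (d (t p) (t q)) \<oplus>\<^bsub>msec M (W p \<inter> W q)\<^esub> mres M (W p) (W p \<inter> W q) (b p)"
  shows "cech_cohomologous X M I U c J V d"
  unfolding cech_cohomologous_def Let_def
  by (intro conjI[OF assms(1)] conjI[OF assms(2)] exI[of _ W] exI[of _ s] exI[of _ t] exI[of _ b]
      conjI[OF ballI ballI[OF ballI]] assms(3,4))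

text \<open>On the refinement by the sets \<open>U (\<tau> j)\<close>, both cocycles can be read with the same indices, so the zero cochain compares
  them. The case \<open>\<tau> = id\<close> is reflexivity; the case of an index map on points leads to covers indexed by points.\<close>

lemma cech_cohomologous_reindex:
  assumes c: "cech_cocycle X M I U c" and \<tau>: "\<And>j. j \<in> J \<Longrightarrow> \<tau> j \<in> I" and cov: "(\<Union>j\<in>J. U (\<tau> j)) = points X"
  shows "cech_cohomologous X M I U c J (\<lambda>j. U (\<tau> j)) (\<lambda>j k. c (\<tau> j) (\<tau> k))"
proof -
  have "\<forall>p\<in>points X. \<exists>j. j \<in> J \<and> p \<in> U (\<tau> j)" using cov by blast
  then obtain t where t: "\<And>p. p \<in> points X \<Longrightarrow> t p \<in> J \<and> p \<in> U (\<tau> (t p))" by metis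
  let ?s = "\<lambda>p. \<tau> (t p)"
  have s: "?s p \<in> I" "openin (pts X) (U (?s p))" if "p \<in> points X" for p
    using t[OF that] \<tau> cech_cocycleD(1)[OF c] by auto
  have d: "cech_cocycle X M J (\<lambda>j. U (\<tau> j)) (\<lambda>j k. c (\<tau> j) (\<tau> k))"
    using c \<tau> cov by (auto simp: cech_cocycle_def open_cover_def)
  show ?thesis
  proof (rule cech_cohomologousI[OF c d, where W = "\<lambda>p. U (?s p)" and s = ?s and t = t
        and b = "\<lambda>p. \<zero>\<^bsub>msec M (U (?s p))\<^esub>"])
    fix p assume p: "p \<in> points X"
    then show "openin (pts X) (U (?s p)) \<and> p \<in> U (?s p) \<and> ?s p \<in> I \<and> U (?s p) \<subseteq> U (?s p) \<and>
        t p \<in> J \<and> U (?s p) \<subseteq> U (\<tau> (t p)) \<and> \<zero>\<^bsub>msec M (U (?s p))\<^esub> \<in> carrier (msec M (U (?s p)))"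
      using s t zero_closed by simp
  next
    fix p q assume p: "p \<in> points X" and q: "q \<in> points X"
    let ?P = "U (?s p) \<inter> U (?s q)"
    have "openin (pts X) ?P" using s p q by blast
    then show "mres M ?P ?P (c (?s p) (?s q)) \<oplus>\<^bsub>msec M ?P\<^esub> mres M (U (?s q)) ?P \<zero>\<^bsub>msec M (U (?s q))\<^esub>
        = mres M ?P ?P (c (?s p) (?s q)) \<oplus>\<^bsub>msec M ?P\<^esub> mres M (U (?s p)) ?P \<zero>\<^bsub>msec M (U (?s p))\<^esub>"
      using s p q by (simp add: res_zero)
  qed
qed

lemma cech_cohomologous_refl:
  "cech_cocycle X M I U c \<Longrightarrow> cech_cohomologous X M I U c I U c"
  using cech_cohomologous_reindex[of I U c I "\<lambda>i. i"] by (auto simp: cech_cocycle_def open_cover_def)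

lemma cech_cohomologous_sym:
  assumes "cech_cohomologous X M I U c J V d"
  shows "cech_cohomologous X M J V d I U c"
proof -
  obtain W s t b where c: "cech_cocycle X M I U c" and d: "cech_cocycle X M J V d"
      and comp: "cech_comparison I U c J V d W s t b"
    using assms unfolding cech_cohomologous_iff by blast
  note W = cech_comparisonD(1)[OF comp] and eq = cech_comparisonD(2)[OF comp]
  show ?thesis
  proof (rule cech_cohomologousI[OF d c, where W = W and s = t and t = s and b = "\<lambda>p. \<ominus>\<^bsub>msec M (W p)\<^esub> b p"])
    fix p assume p: "p \<in> points X"
    then interpret A: abelian_group "msec M (W p)" using W[OF p] by (intro section_group) blast
    show "openin (pts X) (W p) \<and> p \<in> W p \<and> t p \<in> J \<and> W p \<subseteq> V (t p) \<and>
         s p \<in> I \<and> W p \<subseteq> U (s p) \<and> \<ominus>\<^bsub>msec M (W p)\<^esub> b p \<in> carrier (msec M (W p))"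
      using W[OF p] by auto
  next
    fix p q assume p: "p \<in> points X" and q: "q \<in> points X"
    let ?P = "W p \<inter> W q"
    have o: "openin (pts X) ?P" using W[OF p] W[OF q] by blast
    interpret A: abelian_group "msec M ?P" by (rule section_group[OF o])
    have n: "mres M (W p) ?P (\<ominus>\<^bsub>msec M (W p)\<^esub> b p) = \<ominus>\<^bsub>msec M ?P\<^esub> (mres M (W p) ?P (b p))"
      "mres M (W q) ?P (\<ominus>\<^bsub>msec M (W q)\<^esub> b q) = \<ominus>\<^bsub>msec M ?P\<^esub> (mres M (W q) ?P (b q))"
      using W[OF p] W[OF q] o by (auto intro!: res_neg)
    have cl: "mres M (W p) ?P (b p) \<in> carrier (msec M ?P)" "mres M (W q) ?P (b q) \<in> carrier (msec M ?P)"
      using W[OF p] W[OF q] o by (auto intro!: res_closed)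
    have cl': "mres M (U (s p) \<inter> U (s q)) ?P (c (s p) (s q)) \<in> carrier (msec M ?P)"
        "mres M (V (t p) \<inter> V (t q)) ?P (d (t p) (t q)) \<in> carrier (msec M ?P)"
      using W[OF p] W[OF q] o cech_cocycleD(1,2)[OF c] cech_cocycleD(1,2)[OF d]
      by (auto intro!: res_closed)
    have key: "b2 \<oplus>\<^bsub>msec M ?P\<^esub> \<ominus>\<^bsub>msec M ?P\<^esub> y = b1 \<oplus>\<^bsub>msec M ?P\<^esub> \<ominus>\<^bsub>msec M ?P\<^esub> x"
      if "b1 \<in> carrier (msec M ?P)" "b2 \<in> carrier (msec M ?P)" "x \<in> carrier (msec M ?P)" "y \<in> carrier (msec M ?P)"
        "b1 \<oplus>\<^bsub>msec M ?P\<^esub> y = b2 \<oplus>\<^bsub>msec M ?P\<^esub> x" for b1 b2 x y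
    proof -
      have "b2 \<oplus>\<^bsub>msec M ?P\<^esub> \<ominus>\<^bsub>msec M ?P\<^esub> y = (b2 \<oplus>\<^bsub>msec M ?P\<^esub> x) \<oplus>\<^bsub>msec M ?P\<^esub> (\<ominus>\<^bsub>msec M ?P\<^esub> x \<oplus>\<^bsub>msec M ?P\<^esub> \<ominus>\<^bsub>msec M ?P\<^esub> y)"
        using that by (simp add: A.a_assoc A.r_neg1 A.r_neg2)
      also have "\<dots> = (b1 \<oplus>\<^bsub>msec M ?P\<^esub> y) \<oplus>\<^bsub>msec M ?P\<^esub> (\<ominus>\<^bsub>msec M ?P\<^esub> y \<oplus>\<^bsub>msec M ?P\<^esub> \<ominus>\<^bsub>msec M ?P\<^esub> x)"
        using that by (simp add: A.a_comm)
      also have "\<dots> = b1 \<oplus>\<^bsub>msec M ?P\<^esub> \<ominus>\<^bsub>msec M ?P\<^esub> x"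
        using that(1-4) by (simp add: A.a_assoc A.r_neg1 A.r_neg2)
      finally show ?thesis .
    qed
    show "mres M (V (t p) \<inter> V (t q)) ?P (d (t p) (t q)) \<oplus>\<^bsub>msec M ?P\<^esub> mres M (W q) ?P (\<ominus>\<^bsub>msec M (W q)\<^esub> b q)
      = mres M (U (s p) \<inter> U (s q)) ?P (c (s p) (s q)) \<oplus>\<^bsub>msec M ?P\<^esub> mres M (W p) ?P (\<ominus>\<^bsub>msec M (W p)\<^esub> b p)"
      unfolding n by (rule key[OF cl' cl eq[OF p q]])
  qed
qed

text \<open>The two given comparisons may choose different indices for the middle cocycle \<open>d\<close>; the values of \<open>d\<close> between these indices
  correct the sum of the two given cochains.\<close>

lemma cech_cohomologous_trans:
  assumes "cech_cohomologous X M I U c J V d" "cech_cohomologous X M J V d K Z e"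
  shows "cech_cohomologous X M I U c K Z e"
proof -
  obtain W s t b where c: "cech_cocycle X M I U c" and d: "cech_cocycle X M J V d"
      and comp: "cech_comparison I U c J V d W s t b"
    using assms(1) unfolding cech_cohomologous_iff by blast
  note W = cech_comparisonD(1)[OF comp] and eq = cech_comparisonD(2)[OF comp]
  obtain W' s' t' b' where e: "cech_cocycle X M K Z e" and comp': "cech_comparison J V d K Z e W' s' t' b'"
    using assms(2) unfolding cech_cohomologous_iff by blast
  note W' = cech_comparisonD(1)[OF comp'] and eq' = cech_comparisonD(2)[OF comp']
  let ?W = "\<lambda>p. W p \<inter> W' p"
  let ?b = "\<lambda>p. mres M (W p) (?W p) (b p) \<oplus>\<^bsub>msec M (?W p)\<^esub>
      (mres M (W' p) (?W p) (b' p) \<oplus>\<^bsub>msec M (?W p)\<^esub> mres M (V (t p) \<inter> V (s' p)) (?W p) (d (t p) (s' p)))"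
  note oU = cech_cocycleD(1)[OF c] and oV = cech_cocycleD(1)[OF d] and oZ = cech_cocycleD(1)[OF e]
  have oW: "openin (pts X) (?W p)" if "p \<in> points X" for p
    using W[OF that] W'[OF that] by (intro openin_Int) simp_all
  have d_step: "openin (pts X) (V (t p) \<inter> V (s' p))" "?W p \<subseteq> V (t p) \<inter> V (s' p)"
      "d (t p) (s' p) \<in> carrier (msec M (V (t p) \<inter> V (s' p)))" if "p \<in> points X" for p
    using W[OF that] W'[OF that] by (simp_all add: oV openin_Int cech_cocycleD(2)[OF d] le_infI1 le_infI2)
  have clb: "mres M (W p) P (b p) \<in> carrier (msec M P)" "mres M (W' p) P (b' p) \<in> carrier (msec M P)"
      "mres M (V (t p) \<inter> V (s' p)) P (d (t p) (s' p)) \<in> carrier (msec M P)"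
    if p: "p \<in> points X" and P: "openin (pts X) P" "P \<subseteq> ?W p" for p P
  proof -
    show "mres M (W p) P (b p) \<in> carrier (msec M P)" "mres M (W' p) P (b' p) \<in> carrier (msec M P)"
      using W[OF p] W'[OF p] P by (simp_all add: res_closed)
    show "mres M (V (t p) \<inter> V (s' p)) P (d (t p) (s' p)) \<in> carrier (msec M P)"
      by (rule res_closed[OF d_step(1)[OF p] P(1) order_trans[OF P(2) d_step(2)[OF p]] d_step(3)[OF p]])
  qed
  show ?thesis
  proof (rule cech_cohomologousI[OF c e, where W = ?W and s = s and t = t' and b = ?b])
    fix p assume p: "p \<in> points X"
    show "openin (pts X) (?W p) \<and> p \<in> ?W p \<and> s p \<in> I \<and> ?W p \<subseteq> U (s p) \<and>
         t' p \<in> K \<and> ?W p \<subseteq> Z (t' p) \<and> ?b p \<in> carrier (msec M (?W p))"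
      using W[OF p] W'[OF p] oW[OF p] clb[OF p oW[OF p] order_refl] by (simp add: add_closed le_infI1 le_infI2)
  next
    fix p q assume p: "p \<in> points X" and q: "q \<in> points X"
    let ?P = "?W p \<inter> ?W q"
    have o: "openin (pts X) ?P" by (rule openin_Int[OF oW[OF p] oW[OF q]])
    have sub: "?P \<subseteq> W p" "?P \<subseteq> W q" "?P \<subseteq> W' p" "?P \<subseteq> W' q" "?P \<subseteq> ?W p" "?P \<subseteq> ?W q" by auto
    have subV: "?P \<subseteq> U (s p)" "?P \<subseteq> U (s q)" "?P \<subseteq> V (t p)" "?P \<subseteq> V (t q)" "?P \<subseteq> V (s' p)" "?P \<subseteq> V (s' q)"
        "?P \<subseteq> Z (t' p)" "?P \<subseteq> Z (t' q)"
      using W[OF p] W[OF q] W'[OF p] W'[OF q] by auto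
    interpret A: abelian_group "msec M ?P" by (rule section_group[OF o])
    have resb: "mres M (?W r) ?P (?b r) = mres M (W r) ?P (b r) \<oplus>\<^bsub>msec M ?P\<^esub>
        (mres M (W' r) ?P (b' r) \<oplus>\<^bsub>msec M ?P\<^esub> mres M (V (t r) \<inter> V (s' r)) ?P (d (t r) (s' r)))"
      if r: "r \<in> points X" and P: "?P \<subseteq> ?W r" for r
    proof -
      note cl = clb[OF r oW[OF r] order_refl]
      have "mres M (?W r) ?P (mres M A (?W r) a) = mres M A ?P a"
        if "openin (pts X) A" "?W r \<subseteq> A" "a \<in> carrier (msec M A)" for A a
        using res_trans[OF that(1) oW[OF r] o that(2) P that(3)] .
      then show ?thesis
        using W[OF r] W'[OF r] d_step[OF r]
        by (simp add: res_add[OF oW[OF r] o P] add_closed[OF oW[OF r]] cl)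
    qed
    have oc: "openin (pts X) (U (s p) \<inter> U (s q))" "openin (pts X) (V (t p) \<inter> V (t q))"
        "openin (pts X) (V (s' p) \<inter> V (s' q))" "openin (pts X) (Z (t' p) \<inter> Z (t' q))"
        "openin (pts X) (W p \<inter> W q)" "openin (pts X) (W' p \<inter> W' q)"
      using W[OF p] W[OF q] W'[OF p] W'[OF q] by (simp_all add: oU oV oZ openin_Int)
    have cc: "c (s p) (s q) \<in> carrier (msec M (U (s p) \<inter> U (s q)))"
        "d (t p) (t q) \<in> carrier (msec M (V (t p) \<inter> V (t q)))"
        "d (s' p) (s' q) \<in> carrier (msec M (V (s' p) \<inter> V (s' q)))"
        "e (t' p) (t' q) \<in> carrier (msec M (Z (t' p) \<inter> Z (t' q)))"
      using W[OF p] W[OF q] W'[OF p] W'[OF q]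
      by (simp_all add: cech_cocycleD(2)[OF c] cech_cocycleD(2)[OF d] cech_cocycleD(2)[OF e])
    have si: "W p \<inter> W q \<subseteq> U (s p) \<inter> U (s q)" "W p \<inter> W q \<subseteq> V (t p) \<inter> V (t q)"
        "W' p \<inter> W' q \<subseteq> V (s' p) \<inter> V (s' q)" "W' p \<inter> W' q \<subseteq> Z (t' p) \<inter> Z (t' q)"
      using W[OF p] W[OF q] W'[OF p] W'[OF q] by auto
    define C where "C = mres M (U (s p) \<inter> U (s q)) ?P (c (s p) (s q))"
    define E where "E = mres M (Z (t' p) \<inter> Z (t' q)) ?P (e (t' p) (t' q))"
    define D1 where "D1 = mres M (V (t p) \<inter> V (t q)) ?P (d (t p) (t q))"
    define D2 where "D2 = mres M (V (s' p) \<inter> V (s' q)) ?P (d (s' p) (s' q))"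
    define dp where "dp = mres M (V (t p) \<inter> V (s' p)) ?P (d (t p) (s' p))"
    define dq where "dq = mres M (V (t q) \<inter> V (s' q)) ?P (d (t q) (s' q))"
    define bp where "bp = mres M (W p) ?P (b p)"
    define bq where "bq = mres M (W q) ?P (b q)"
    define bp' where "bp' = mres M (W' p) ?P (b' p)"
    define bq' where "bq' = mres M (W' q) ?P (b' q)"
    note defs = C_def E_def D1_def D2_def dp_def dq_def bp_def bq_def bp'_def bq'_def
    have cl: "C \<in> carrier (msec M ?P)" "E \<in> carrier (msec M ?P)" "D1 \<in> carrier (msec M ?P)"
        "D2 \<in> carrier (msec M ?P)" "dp \<in> carrier (msec M ?P)" "dq \<in> carrier (msec M ?P)"
        "bp \<in> carrier (msec M ?P)" "bq \<in> carrier (msec M ?P)" "bp' \<in> carrier (msec M ?P)" "bq' \<in> carrier (msec M ?P)"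
      unfolding defs
      using clb[OF p o sub(5)] clb[OF q o sub(6)] subV
      by (simp_all add: res_closed[OF oc(1) o _ cc(1)] res_closed[OF oc(2) o _ cc(2)]
        res_closed[OF oc(3) o _ cc(3)] res_closed[OF oc(4) o _ cc(4)])
    have 1: "C \<oplus>\<^bsub>msec M ?P\<^esub> bq = D1 \<oplus>\<^bsub>msec M ?P\<^esub> bp"
    proof -
      have P: "?P \<subseteq> W p \<inter> W q" by auto
      show ?thesis
        unfolding defs
        by (rule sum_eq_on_smaller[OF _ _ _ _ _ _ _ _ oc(5) _ _ _ _ o P eq[OF p q]])
          (use W[OF p] W[OF q] oc cc si in auto)
    qed
    have 2: "D2 \<oplus>\<^bsub>msec M ?P\<^esub> bq' = E \<oplus>\<^bsub>msec M ?P\<^esub> bp'"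
    proof -
      have P: "?P \<subseteq> W' p \<inter> W' q" by auto
      show ?thesis
        unfolding defs
        by (rule sum_eq_on_smaller[OF _ _ _ _ _ _ _ _ oc(6) _ _ _ _ o P eq'[OF p q]])
          (use W'[OF p] W'[OF q] oc cc si in auto)
    qed
    have 3: "D1 \<oplus>\<^bsub>msec M ?P\<^esub> dq = dp \<oplus>\<^bsub>msec M ?P\<^esub> D2"
      using cech_cocycle_on[OF d, of "t p" "t q" "s' q" ?P] cech_cocycle_on[OF d, of "t p" "s' p" "s' q" ?P]
        W[OF p] W[OF q] W'[OF p] W'[OF q] o subV
      unfolding defs by simp
    have "C \<oplus>\<^bsub>msec M ?P\<^esub> (bq \<oplus>\<^bsub>msec M ?P\<^esub> (bq' \<oplus>\<^bsub>msec M ?P\<^esub> dq))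
        = (C \<oplus>\<^bsub>msec M ?P\<^esub> bq) \<oplus>\<^bsub>msec M ?P\<^esub> (bq' \<oplus>\<^bsub>msec M ?P\<^esub> dq)"
      using cl by (simp add: A.a_assoc)
    also have "\<dots> = (D1 \<oplus>\<^bsub>msec M ?P\<^esub> dq) \<oplus>\<^bsub>msec M ?P\<^esub> (bp \<oplus>\<^bsub>msec M ?P\<^esub> bq')"
      unfolding 1 using cl by (simp add: A.a_ac)
    also have "\<dots> = (D2 \<oplus>\<^bsub>msec M ?P\<^esub> bq') \<oplus>\<^bsub>msec M ?P\<^esub> (bp \<oplus>\<^bsub>msec M ?P\<^esub> dp)"
      unfolding 3 using cl by (simp add: A.a_ac)
    also have "\<dots> = E \<oplus>\<^bsub>msec M ?P\<^esub> (bp \<oplus>\<^bsub>msec M ?P\<^esub> (bp' \<oplus>\<^bsub>msec M ?P\<^esub> dp))"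
      unfolding 2 using cl by (simp add: A.a_ac)
    finally show "mres M (U (s p) \<inter> U (s q)) ?P (c (s p) (s q)) \<oplus>\<^bsub>msec M ?P\<^esub> mres M (?W q) ?P (?b q)
        = mres M (Z (t' p) \<inter> Z (t' q)) ?P (e (t' p) (t' q)) \<oplus>\<^bsub>msec M ?P\<^esub> mres M (?W p) ?P (?b p)"
      unfolding resb[OF p sub(5)] resb[OF q sub(6)] defs .
  qed
qed

lemma cech_class_eq:
  assumes "cech_cohomologous X M I U c J V d"
  shows "cech_class X M I U c = cech_class X M J V d"
  using assms cech_cohomologous_trans[OF assms] cech_cohomologous_trans[OF cech_cohomologous_sym[OF assms]]
  by (auto simp: cech_class_def)

lemma cech_class_point_cover:
  assumes c: "cech_cocycle X M I U c"
  obtains V d where "cech_cohomologous X M I U c (points X) V d"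
proof -
  have "\<forall>p\<in>points X. \<exists>i. i \<in> I \<and> p \<in> U i" using c by (auto simp: cech_cocycle_def open_cover_def)
  then obtain \<tau> where \<tau>: "\<And>p. p \<in> points X \<Longrightarrow> \<tau> p \<in> I \<and> p \<in> U (\<tau> p)" by metis
  have "(\<Union>p\<in>points X. U (\<tau> p)) = points X"
    using \<tau> openin_subset[OF cech_cocycleD(1)[OF c]] by blast
  then show ?thesis
    using that[OF cech_cohomologous_reindex[OF c, of "points X" \<tau>]] \<tau> by blast
qed

lemma cech_class_in_H1:
  assumes c: "cech_cocycle X M I U c"
  shows "cech_class X M I U c \<in> H1 X M"
proof -
  obtain V d where V: "cech_cohomologous X M I U c (points X) V d" by (rule cech_class_point_cover[OF c])
  then have "cech_cocycle X M (points X) V d" by (simp add: cech_cohomologous_def)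
  then show ?thesis unfolding H1_def using cech_class_eq[OF V] by blast
qed

end

context presheaf_morphism begin

lemma cech_cocycle_map:
  assumes c: "cech_cocycle X M I U c"
  shows "cech_cocycle X N I U (\<lambda>i j. f (U i \<inter> U j) (c i j))"
  unfolding cech_cocycle_def Let_def
proof (intro conjI ballI)
  show "open_cover X I U" using c by (simp add: cech_cocycle_def)
  note D = M.cech_cocycleD[OF c]
  show "f (U i \<inter> U j) (c i j) \<in> carrier (msec N (U i \<inter> U j))" if "i \<in> I" "j \<in> I" for i j
    using that D(1,2) by (intro map_closed openin_Int) auto
  fix i j k assume ijk: "i \<in> I" "j \<in> I" "k \<in> I"
  let ?W = "U i \<inter> U j \<inter> U k"
  have o: "openin (pts X) (U i)" "openin (pts X) (U j)" "openin (pts X) (U k)" using ijk D(1) by auto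
  have oo: "openin (pts X) (U i \<inter> U j)" "openin (pts X) (U j \<inter> U k)" "openin (pts X) (U i \<inter> U k)" "openin (pts X) ?W"
    using o by auto
  have sub: "?W \<subseteq> U i \<inter> U j" "?W \<subseteq> U j \<inter> U k" "?W \<subseteq> U i \<inter> U k" by auto
  have cc: "c i j \<in> carrier (msec M (U i \<inter> U j))" "c j k \<in> carrier (msec M (U j \<inter> U k))"
      "c i k \<in> carrier (msec M (U i \<inter> U k))" using ijk D(2) by auto
  have "f ?W (mres M (U i \<inter> U j) ?W (c i j) \<oplus>\<^bsub>msec M ?W\<^esub> mres M (U j \<inter> U k) ?W (c j k))
      = f ?W (mres M (U i \<inter> U k) ?W (c i k))"
    using c ijk by (simp add: cech_cocycle_def Let_def)
  then show "mres N (U i \<inter> U j) ?W (f (U i \<inter> U j) (c i j)) \<oplus>\<^bsub>msec N ?W\<^esub> mres N (U j \<inter> U k) ?W (f (U j \<inter> U k) (c j k))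
      = mres N (U i \<inter> U k) ?W (f (U i \<inter> U k) (c i k))"
    using map_res[OF oo(1,4) sub(1) cc(1)] map_res[OF oo(2,4) sub(2) cc(2)] map_res[OF oo(3,4) sub(3) cc(3)]
      map_add[OF oo(4) M.res_closed[OF oo(1,4) sub(1) cc(1)] M.res_closed[OF oo(2,4) sub(2) cc(2)]]
    by simp
qed

lemma cech_cohomologous_map:
  assumes "cech_cohomologous X M I U c J V d"
  shows "cech_cohomologous X N I U (\<lambda>i j. f (U i \<inter> U j) (c i j)) J V (\<lambda>i j. f (V i \<inter> V j) (d i j))"
proof -
  obtain W s t b where c: "cech_cocycle X M I U c" and d: "cech_cocycle X M J V d"
      and comp: "M.cech_comparison I U c J V d W s t b"
    using assms unfolding M.cech_cohomologous_iff by blast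
  note W = M.cech_comparisonD(1)[OF comp] and eq = M.cech_comparisonD(2)[OF comp]
  show ?thesis
  proof (rule N.cech_cohomologousI[OF cech_cocycle_map[OF c] cech_cocycle_map[OF d],
        where W = W and s = s and t = t and b = "\<lambda>p. f (W p) (b p)"])
    fix p assume p: "p \<in> points X"
    show "openin (pts X) (W p) \<and> p \<in> W p \<and> s p \<in> I \<and> W p \<subseteq> U (s p) \<and>
         t p \<in> J \<and> W p \<subseteq> V (t p) \<and> f (W p) (b p) \<in> carrier (msec N (W p))"
      using W[OF p] by (auto intro: map_closed)
  next
    fix p q assume p: "p \<in> points X" and q: "q \<in> points X"
    let ?P = "W p \<inter> W q"
    have o: "openin (pts X) (W p)" "openin (pts X) (W q)" "openin (pts X) ?P"
        "openin (pts X) (U (s p) \<inter> U (s q))" "openin (pts X) (V (t p) \<inter> V (t q))"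
      using W[OF p] W[OF q] M.cech_cocycleD(1)[OF c] M.cech_cocycleD(1)[OF d] by (auto intro!: openin_Int)
    have sub: "?P \<subseteq> W p" "?P \<subseteq> W q" "?P \<subseteq> U (s p) \<inter> U (s q)" "?P \<subseteq> V (t p) \<inter> V (t q)"
      using W[OF p] W[OF q] by auto
    have cl: "b p \<in> carrier (msec M (W p))" "b q \<in> carrier (msec M (W q))"
        "c (s p) (s q) \<in> carrier (msec M (U (s p) \<inter> U (s q)))" "d (t p) (t q) \<in> carrier (msec M (V (t p) \<inter> V (t q)))"
      using W[OF p] W[OF q] M.cech_cocycleD(2)[OF c] M.cech_cocycleD(2)[OF d] by auto
    note R = M.res_closed[OF o(1,3) sub(1) cl(1)] M.res_closed[OF o(2,3) sub(2) cl(2)]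
      M.res_closed[OF o(4,3) sub(3) cl(3)] M.res_closed[OF o(5,3) sub(4) cl(4)]
    note S = map_res[OF o(1,3) sub(1) cl(1)] map_res[OF o(2,3) sub(2) cl(2)]
      map_res[OF o(4,3) sub(3) cl(3)] map_res[OF o(5,3) sub(4) cl(4)]
    show "mres N (U (s p) \<inter> U (s q)) ?P (f (U (s p) \<inter> U (s q)) (c (s p) (s q))) \<oplus>\<^bsub>msec N ?P\<^esub> mres N (W q) ?P (f (W q) (b q))
      = mres N (V (t p) \<inter> V (t q)) ?P (f (V (t p) \<inter> V (t q)) (d (t p) (t q))) \<oplus>\<^bsub>msec N ?P\<^esub> mres N (W p) ?P (f (W p) (b p))"
      using arg_cong[OF eq[OF p q], of "f ?P"] unfolding map_add[OF o(3) R(3,2)] map_add[OF o(3) R(4,1)] S .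
  qed
qed

text \<open>All members of the class of \<open>c\<close> are cohomologous to \<open>c\<close>, hence have images cohomologous to that of \<open>c\<close>, and there is at
  least one member.\<close>

lemma H1_map_cech_class:
  assumes c: "cech_cocycle X M I U c"
  shows "H1_map X N f (cech_class X M I U c) = cech_class X N I U (\<lambda>i j. f (U i \<inter> U j) (c i j))"
proof -
  have E: "cech_class X N (points X) V (\<lambda>p q. f (V p \<inter> V q) (d p q)) = cech_class X N I U (\<lambda>i j. f (U i \<inter> U j) (c i j))"
    if "(V, d) \<in> cech_class X M I U c" for V d
  proof -
    have "cech_cohomologous X M I U c (points X) V d" using that by (simp add: cech_class_def)
    then show ?thesis by (rule N.cech_class_eq[OF cech_cohomologous_map, symmetric])
  qed
  obtain V0 d0 where "cech_cohomologous X M I U c (points X) V0 d0" by (rule M.cech_class_point_cover[OF c])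
  then have "(V0, d0) \<in> cech_class X M I U c" by (simp add: cech_class_def)
  from UN_eq_representative[OF this,
      of "\<lambda>(V, d). cech_class X N (points X) V (\<lambda>p q. f (V p \<inter> V q) (d p q))"] E[OF this]
  show ?thesis using E unfolding H1_map_def by (simp add: split_beta)
qed

end

section \<open>Tangent sheaf and dual of an ideal sheaf\<close>

lemma map_sheaf_carrier:
  "D \<in> carrier (msec (map_sheaf X S P) U) \<longleftrightarrow> D \<in> extensional (opens_in X U) \<and>
    (\<forall>V\<in>opens_in X U. D V \<in> extensional (S V) \<and> (\<forall>s\<in>S V. D V s \<in> carrier (sec X V)) \<and> P V (D V) \<and>
      (\<forall>W\<in>opens_in X V. \<forall>s\<in>S V. D W (res X V W s) = res X V W (D V s)))"
  unfolding map_sheaf_def by (simp add: PiE_def Pi_def) blast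

lemma map_sheaf_eqI:
  assumes "D \<in> carrier (msec (map_sheaf X S P) U)" "E \<in> carrier (msec (map_sheaf X S P) U)"
    and "\<And>V s. \<lbrakk>V \<in> opens_in X U; s \<in> S V\<rbrakk> \<Longrightarrow> D V s = E V s"
  shows "D = E"
proof (rule extensionalityI[of D "opens_in X U" E])
  show "D \<in> extensional (opens_in X U)" "E \<in> extensional (opens_in X U)"
    using assms(1,2) by (simp_all add: map_sheaf_carrier)
  fix V assume V: "V \<in> opens_in X U"
  show "D V = E V"
    using V assms by (intro extensionalityI[of _ "S V"]) (simp_all add: map_sheaf_carrier)
qed

lemma map_sheaf_ops:
  assumes "V \<in> opens_in X U" "s \<in> S V"
  shows "(D \<oplus>\<^bsub>msec (map_sheaf X S P) U\<^esub> E) V s = D V s \<oplus>\<^bsub>sec X V\<^esub> E V s"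
    and "(r \<odot>\<^bsub>msec (map_sheaf X S P) U\<^esub> D) V s = res X U V r \<otimes>\<^bsub>sec X V\<^esub> D V s"
    and "\<zero>\<^bsub>msec (map_sheaf X S P) U\<^esub> V s = \<zero>\<^bsub>sec X V\<^esub>"
  using assms by (simp_all add: map_sheaf_def)

lemma mres_map_sheaf: "mres (map_sheaf X S P) U V D = restrict D (opens_in X V)"
  by (simp add: map_sheaf_def)

lemma opens_in_iff: "V \<in> opens_in X U \<longleftrightarrow> openin (pts X) V \<and> V \<subseteq> U"
  by (simp add: opens_in_def)

text \<open>The operations are computed value by value in the rings \<open>\<O>(V)\<close>, so the axioms are ring identities; what depends on
  the sheaf is that \<open>P\<close> is stable under the operations.\<close>

lemma module_presheaf_map_sheaf:
  fixes X :: "('a, 'r) cspace" and S :: "'a set \<Rightarrow> 'r set" and P :: "'a set \<Rightarrow> ('r \<Rightarrow> 'r) \<Rightarrow> bool"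
  assumes X: "ringed_cspace X"
    and S_res: "\<And>V W s. \<lbrakk>openin (pts X) V; openin (pts X) W; W \<subseteq> V; s \<in> S V\<rbrakk> \<Longrightarrow> res X V W s \<in> S W"
    and P_zero: "\<And>V. openin (pts X) V \<Longrightarrow> P V (\<lambda>s\<in>S V. \<zero>\<^bsub>sec X V\<^esub>)"
    and P_add: "\<And>V D E. \<lbrakk>openin (pts X) V; P V D; P V E; \<And>s. s \<in> S V \<Longrightarrow> D s \<in> carrier (sec X V);
      \<And>s. s \<in> S V \<Longrightarrow> E s \<in> carrier (sec X V)\<rbrakk> \<Longrightarrow> P V (\<lambda>s\<in>S V. D s \<oplus>\<^bsub>sec X V\<^esub> E s)"
    and P_smult: "\<And>V D r. \<lbrakk>openin (pts X) V; P V D; r \<in> carrier (sec X V);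
      \<And>s. s \<in> S V \<Longrightarrow> D s \<in> carrier (sec X V)\<rbrakk> \<Longrightarrow> P V (\<lambda>s\<in>S V. r \<otimes>\<^bsub>sec X V\<^esub> D s)"
  shows "module_presheaf X (map_sheaf X S P)"
proof -
  let ?M = "map_sheaf X S P"
  have cr: "cring (sec X V)" if "V \<in> opens_in X U" for U V
    using that ringed_cspace_sections(1)[OF X] by (simp add: opens_in_iff)
  have res_cl: "res X U V r \<in> carrier (sec X V)"
    if "openin (pts X) U" "V \<in> opens_in X U" "r \<in> carrier (sec X U)" for U V r
    using that ringed_cspace_res_closed[OF X] by (simp add: opens_in_iff)
  have res_hom: "res X V W \<in> ring_hom (sec X V) (sec X W)"
    if "V \<in> opens_in X U" "W \<in> opens_in X V" for U V W
    using that ringed_cspace_res(1)[OF X] by (simp add: opens_in_iff)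
  have car: "D V s \<in> carrier (sec X V)" if "D \<in> carrier (msec ?M U)" "V \<in> opens_in X U" "s \<in> S V" for D U V s
    using that by (simp add: map_sheaf_carrier)
  have nat: "D W (res X V W s) = res X V W (D V s)"
    if "D \<in> carrier (msec ?M U)" "V \<in> opens_in X U" "W \<in> opens_in X V" "s \<in> S V" for D U V W s
    using that by (simp add: map_sheaf_carrier)
  have P: "P V (D V)" if "D \<in> carrier (msec ?M U)" "V \<in> opens_in X U" for D U V
    using that by (simp add: map_sheaf_carrier)
  have tr: "W \<in> opens_in X U" if "V \<in> opens_in X U" "W \<in> opens_in X V" for U V W
    using that by (auto simp: opens_in_iff)
  have Sr: "res X V W s \<in> S W" if "V \<in> opens_in X U" "W \<in> opens_in X V" "s \<in> S V" for U V W s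
    using that S_res by (simp add: opens_in_iff)
  have zero: "\<zero>\<^bsub>msec ?M U\<^esub> \<in> carrier (msec ?M U)" for U
    unfolding map_sheaf_carrier
  proof (intro conjI ballI)
    fix V W s assume V: "V \<in> opens_in X U" "W \<in> opens_in X V" "s \<in> S V"
    show "\<zero>\<^bsub>msec ?M U\<^esub> W (res X V W s) = res X V W (\<zero>\<^bsub>msec ?M U\<^esub> V s)"
      using V cr[OF V(1)] cr[OF V(2)] tr[OF V(1,2)] Sr[OF V] ring_hom_zero[OF res_hom[OF V(1,2)]]
      by (simp add: map_sheaf_ops cring.axioms(1))
  next
    fix V s assume V: "V \<in> opens_in X U" "s \<in> S V"
    interpret cring "sec X V" by (rule cr[OF V(1)])
    show "\<zero>\<^bsub>msec ?M U\<^esub> V s \<in> carrier (sec X V)" by (simp add: map_sheaf_ops V)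
  next
    fix V assume V: "V \<in> opens_in X U"
    then show "P V (\<zero>\<^bsub>msec ?M U\<^esub> V)" using P_zero by (simp add: map_sheaf_def opens_in_iff)
  qed (simp_all add: map_sheaf_def)
  have add: "D \<oplus>\<^bsub>msec ?M U\<^esub> E \<in> carrier (msec ?M U)"
    if D: "D \<in> carrier (msec ?M U)" and E: "E \<in> carrier (msec ?M U)" for D E U
    unfolding map_sheaf_carrier
  proof (intro conjI ballI)
    fix V W s assume V: "V \<in> opens_in X U" "W \<in> opens_in X V" "s \<in> S V"
    show "(D \<oplus>\<^bsub>msec ?M U\<^esub> E) W (res X V W s) = res X V W ((D \<oplus>\<^bsub>msec ?M U\<^esub> E) V s)"
      using V tr[OF V(1,2)] Sr[OF V] ring_hom_add[OF res_hom[OF V(1,2)] car[OF D V(1,3)] car[OF E V(1,3)]]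
        nat[OF D V] nat[OF E V]
      by (simp add: map_sheaf_ops)
  next
    fix V s assume V: "V \<in> opens_in X U" "s \<in> S V"
    interpret cring "sec X V" by (rule cr[OF V(1)])
    show "(D \<oplus>\<^bsub>msec ?M U\<^esub> E) V s \<in> carrier (sec X V)"
      using car[OF D V] car[OF E V] by (simp add: map_sheaf_ops V)
  next
    fix V assume V: "V \<in> opens_in X U"
    then show "P V ((D \<oplus>\<^bsub>msec ?M U\<^esub> E) V)"
      using P_add[of V "D V" "E V"] P[OF D V] P[OF E V] car[OF D V] car[OF E V]
      by (simp add: map_sheaf_def opens_in_iff)
  qed (simp_all add: map_sheaf_def)
  have smult: "r \<odot>\<^bsub>msec ?M U\<^esub> D \<in> carrier (msec ?M U)"
    if U: "openin (pts X) U" and r: "r \<in> carrier (sec X U)" and D: "D \<in> carrier (msec ?M U)" for r D U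
    unfolding map_sheaf_carrier
  proof (intro conjI ballI)
    fix V W s assume V: "V \<in> opens_in X U" "W \<in> opens_in X V" "s \<in> S V"
    have "res X V W (res X U V r) = res X U W r"
      using ringed_cspace_res(3)[OF X U _ _ _ _ r] V by (simp add: opens_in_iff)
    then show "(r \<odot>\<^bsub>msec ?M U\<^esub> D) W (res X V W s) = res X V W ((r \<odot>\<^bsub>msec ?M U\<^esub> D) V s)"
      using V tr[OF V(1,2)] Sr[OF V] ring_hom_mult[OF res_hom[OF V(1,2)] res_cl[OF U V(1) r] car[OF D V(1,3)]]
        nat[OF D V]
      by (simp add: map_sheaf_ops)
  next
    fix V s assume V: "V \<in> opens_in X U" "s \<in> S V"
    interpret cring "sec X V" by (rule cr[OF V(1)])
    show "(r \<odot>\<^bsub>msec ?M U\<^esub> D) V s \<in> carrier (sec X V)"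
      using car[OF D V] res_cl[OF U V(1) r] by (simp add: map_sheaf_ops V)
  next
    fix V assume V: "V \<in> opens_in X U"
    then show "P V ((r \<odot>\<^bsub>msec ?M U\<^esub> D) V)"
      using P_smult[of V "D V" "res X U V r"] P[OF D V] car[OF D V] res_cl[OF U V r]
      by (simp add: map_sheaf_def opens_in_iff)
  qed (simp_all add: map_sheaf_def)
  show ?thesis
  proof (rule module_presheaf.intro)
    show "ringed_cspace X" by (rule X)
    fix U assume U: "openin (pts X) U"
    interpret RU: cring "sec X U" by (rule ringed_cspace_sections(1)[OF X U])
    have hU: "res X U V \<in> ring_hom (sec X U) (sec X V)" and ringV: "ring (sec X V)" if "V \<in> opens_in X U" for V
      using ringed_cspace_res(1)[OF X U] cr[OF that] that by (simp_all add: opens_in_iff cring.axioms(1))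
    note res_ops = ring_hom_add[OF hU] ring_hom_mult[OF hU] ring_hom_one[OF hU] ring_hom_zero[OF hU RU.ring_axioms ringV]
    show "module (sec X U) (msec ?M U)"
    proof (rule locally_modelled.module)
      let ?scal = "\<lambda>(V, s) r a. V \<in> opens_in X U \<and> r \<in> carrier (sec X U) \<and> a = res X U V r"
        and ?rep = "\<lambda>(V, s) D a. D \<in> carrier (msec ?M U) \<and> V \<in> opens_in X U \<and> s \<in> S V \<and> a = D V s"
      show "locally_modelled (sec X U) (msec ?M U) (SIGMA V:opens_in X U. S V) (\<lambda>p. {p})
          (\<lambda>(V, s). sec X V) (\<lambda>(V, s). self_module (sec X V)) ?scal ?rep"
      proof (intro locally_modelled.intro)
        fix D E assume D: "D \<in> carrier (msec ?M U)" "E \<in> carrier (msec ?M U)"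
          and eq: "\<And>p. p \<in> (SIGMA V:opens_in X U. S V) \<Longrightarrow> \<exists>k\<in>{p}. \<exists>a. ?rep k D a \<and> ?rep k E a"
        show "D = E"
        proof (rule map_sheaf_eqI[OF D])
          fix V s assume "V \<in> opens_in X U" "s \<in> S V"
          then show "D V s = E V s" using eq[of "(V, s)"] by simp
        qed
      qed (use add smult[OF U] zero car res_ops res_cl[OF U] module_self_module[OF cr] RU.cring_axioms
          in \<open>auto simp: self_module_def map_sheaf_ops\<close>)
    qed
    have rc: "mres ?M U V D \<in> carrier (msec ?M V)"
      if V: "openin (pts X) V" "V \<subseteq> U" and D: "D \<in> carrier (msec ?M U)" for V D
    proof -
      have "V' \<in> opens_in X U" if "V' \<in> opens_in X V" for V' using that V by (auto simp: opens_in_iff)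
      then show ?thesis
        using D tr[of _ V] unfolding map_sheaf_carrier mres_map_sheaf by simp
    qed
    fix V assume V: "openin (pts X) V" and VU: "V \<subseteq> U"
    have sub: "W \<in> opens_in X U" if "W \<in> opens_in X V" for W using that VU by (auto simp: opens_in_iff)
    have VoU: "V \<in> opens_in X U" using V VU by (simp add: opens_in_iff)
    show "semilinear (res X U V) (sec X U) (msec ?M U) (msec ?M V) (mres ?M U V)"
    proof (rule semilinearI)
      fix D assume D: "D \<in> carrier (msec ?M U)"
      show "mres ?M U V D \<in> carrier (msec ?M V)" by (rule rc[OF V VU D])
    next
      fix D E assume D: "D \<in> carrier (msec ?M U)" and E: "E \<in> carrier (msec ?M U)"
      show "mres ?M U V (D \<oplus>\<^bsub>msec ?M U\<^esub> E) = mres ?M U V D \<oplus>\<^bsub>msec ?M V\<^esub> mres ?M U V E"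
        by (rule map_sheaf_eqI[OF rc[OF V VU add[OF D E]] add[OF rc[OF V VU D] rc[OF V VU E]]])
          (simp add: mres_map_sheaf map_sheaf_ops sub)
    next
      fix r D assume r: "r \<in> carrier (sec X U)" and D: "D \<in> carrier (msec ?M U)"
      have "res X V W (res X U V r) = res X U W r" if "W \<in> opens_in X V" for W
        using ringed_cspace_res(3)[OF X U V VU _ _ r] that by (simp add: opens_in_iff)
      then show "mres ?M U V (r \<odot>\<^bsub>msec ?M U\<^esub> D) = res X U V r \<odot>\<^bsub>msec ?M V\<^esub> mres ?M U V D"
        by (intro map_sheaf_eqI[OF rc[OF V VU smult[OF U r D]] smult[OF V res_cl[OF U VoU r] rc[OF V VU D]]])
          (simp add: mres_map_sheaf map_sheaf_ops sub)
    qed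
  next
    fix U D assume "D \<in> carrier (msec ?M U)"
    then show "mres ?M U U D = D"
      by (simp add: mres_map_sheaf map_sheaf_carrier extensional_restrict)
  next
    fix U V W D assume "openin (pts X) W" "W \<subseteq> V" "openin (pts X) V"
    then have "opens_in X V \<inter> opens_in X W = opens_in X W" by (auto simp: opens_in_iff subset_iff)
    then show "mres ?M V W (mres ?M U V D) = mres ?M U W D"
      by (simp add: mres_map_sheaf restrict_restrict)
  qed
qed

lemma module_presheaf_tangent_sheaf:
  assumes X: "ringed_cspace X"
  shows "module_presheaf X (tangent_sheaf X)"
  unfolding tangent_sheaf_def
proof (rule module_presheaf_map_sheaf[OF X])
  show "res X V W s \<in> carrier (sec X W)"
    if "openin (pts X) V" "openin (pts X) W" "W \<subseteq> V" "s \<in> carrier (sec X V)" for V W s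
    by (rule ringed_cspace_res_closed[OF X that])
  fix V assume V: "openin (pts X) V"
  interpret cring "sec X V" by (rule ringed_cspace_sections(1)[OF X V])
  have c: "cst X V z \<in> carrier (sec X V)" for z
    using ring_hom_closed[OF ringed_cspace_sections(2)[OF X V], of z] by (simp add: type_ring_def)
  let ?P = "\<lambda>D. (\<forall>a\<in>carrier (sec X V). \<forall>b\<in>carrier (sec X V).
        D (a \<oplus>\<^bsub>sec X V\<^esub> b) = D a \<oplus>\<^bsub>sec X V\<^esub> D b \<and>
        D (a \<otimes>\<^bsub>sec X V\<^esub> b) = a \<otimes>\<^bsub>sec X V\<^esub> D b \<oplus>\<^bsub>sec X V\<^esub> b \<otimes>\<^bsub>sec X V\<^esub> D a) \<and>
      (\<forall>z. D (cst X V z) = \<zero>\<^bsub>sec X V\<^esub>)"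
  show "?P (\<lambda>s\<in>carrier (sec X V). \<zero>\<^bsub>sec X V\<^esub>)" by (simp add: c)
  show "?P (\<lambda>s\<in>carrier (sec X V). D s \<oplus>\<^bsub>sec X V\<^esub> E s)"
    if "?P D" "?P E" "\<And>s. s \<in> carrier (sec X V) \<Longrightarrow> D s \<in> carrier (sec X V)"
      "\<And>s. s \<in> carrier (sec X V) \<Longrightarrow> E s \<in> carrier (sec X V)" for D E
    using that by (simp add: c r_distr a_ac)
  show "?P (\<lambda>s\<in>carrier (sec X V). r \<otimes>\<^bsub>sec X V\<^esub> D s)"
    if "?P D" "r \<in> carrier (sec X V)" "\<And>s. s \<in> carrier (sec X V) \<Longrightarrow> D s \<in> carrier (sec X V)" for D r
    using that by (simp add: c r_distr m_lcomm)
qed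

locale ideal_presheaf =
  fixes X :: "('a, 'r) cspace" and J :: "'a set \<Rightarrow> 'r set"
  assumes ringed: "ringed_cspace X"
    and J_carrier: "\<lbrakk>openin (pts X) V; s \<in> J V\<rbrakk> \<Longrightarrow> s \<in> carrier (sec X V)"
    and J_add: "\<lbrakk>openin (pts X) V; s \<in> J V; t \<in> J V\<rbrakk> \<Longrightarrow> s \<oplus>\<^bsub>sec X V\<^esub> t \<in> J V"
    and J_smult: "\<lbrakk>openin (pts X) V; r \<in> carrier (sec X V); s \<in> J V\<rbrakk> \<Longrightarrow> r \<otimes>\<^bsub>sec X V\<^esub> s \<in> J V"
    and J_res: "\<lbrakk>openin (pts X) V; openin (pts X) W; W \<subseteq> V; s \<in> J V\<rbrakk> \<Longrightarrow> res X V W s \<in> J W"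
begin

lemma module_presheaf_dual_ideal: "module_presheaf X (dual_ideal X J)"
  unfolding dual_ideal_def
proof (rule module_presheaf_map_sheaf[OF ringed J_res])
  fix V assume V: "openin (pts X) V"
  interpret cring "sec X V" by (rule ringed_cspace_sections(1)[OF ringed V])
  note J = J_carrier[OF V] J_add[OF V] J_smult[OF V]
  let ?P = "\<lambda>h. \<forall>s\<in>J V. (\<forall>t\<in>J V. h (s \<oplus>\<^bsub>sec X V\<^esub> t) = h s \<oplus>\<^bsub>sec X V\<^esub> h t) \<and>
      (\<forall>r\<in>carrier (sec X V). h (r \<otimes>\<^bsub>sec X V\<^esub> s) = r \<otimes>\<^bsub>sec X V\<^esub> h s)"
  show "?P (\<lambda>s\<in>J V. \<zero>\<^bsub>sec X V\<^esub>)" by (simp add: J)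
  show "?P (\<lambda>s\<in>J V. h s \<oplus>\<^bsub>sec X V\<^esub> h' s)"
    if "?P h" "?P h'" "\<And>s. s \<in> J V \<Longrightarrow> h s \<in> carrier (sec X V)" "\<And>s. s \<in> J V \<Longrightarrow> h' s \<in> carrier (sec X V)" for h h'
    using that by (simp add: J r_distr a_ac)
  show "?P (\<lambda>s\<in>J V. r \<otimes>\<^bsub>sec X V\<^esub> h s)"
    if "?P h" "r \<in> carrier (sec X V)" "\<And>s. s \<in> J V \<Longrightarrow> h s \<in> carrier (sec X V)" for h r
    using that by (simp add: J r_distr m_lcomm)
qed

lemma canonical_section_closed:
  assumes "openin (pts X) U"
  shows "canonical_section X J U \<in> carrier (msec (dual_ideal X J) U)"
  unfolding dual_ideal_def map_sheaf_carrier
  by (auto simp: canonical_section_def opens_in_iff J_carrier J_add J_smult J_res subset_iff)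

lemma canonical_section_res:
  assumes "V \<subseteq> U"
  shows "mres (dual_ideal X J) U V (canonical_section X J U) = canonical_section X J V"
  using assms by (auto simp: dual_ideal_def mres_map_sheaf canonical_section_def restrict_def opens_in_iff fun_eq_iff)

end

lemma morphism_hom:
  assumes "morphism X Y f fs" "openin (pts Y) V"
  shows "fs V \<in> ring_hom (sec Y V) (sec X (preim X f V))"
    and "fs V (cst Y V c) = cst X (preim X f V) c"
    and "\<lbrakk>openin (pts Y) W; W \<subseteq> V; s \<in> carrier (sec Y V)\<rbrakk> \<Longrightarrow>
      fs W (res Y V W s) = res X (preim X f V) (preim X f W) (fs V s)"
  using assms by (auto simp: morphism_def opens_in_def)

lemma openin_preim: "morphism X Y f fs \<Longrightarrow> openin (pts Y) V \<Longrightarrow> openin (pts X) (preim X f V)"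
  by (auto simp: morphism_def preim_def continuous_map_def)

lemma ideal_presheaf_ideal_sheaf:
  assumes X: "ringed_cspace X" and H: "ringed_cspace H" and h: "morphism H X h hs"
  shows "ideal_presheaf X (ideal_sheaf H X h hs)"
proof
  show "ringed_cspace X" by (rule X)
  fix V assume V: "openin (pts X) V"
  interpret A: cring "sec X V" by (rule ringed_cspace_sections(1)[OF X V])
  interpret B: cring "sec H (preim H h V)" by (rule ringed_cspace_sections(1)[OF H openin_preim[OF h V]])
  note hom = morphism_hom(1)[OF h V]
  note [simp] = ring_hom_add[OF hom] ring_hom_mult[OF hom] ring_hom_closed[OF hom]
  show "s \<in> carrier (sec X V)" if "s \<in> ideal_sheaf H X h hs V" for s
    using that by (simp add: ideal_sheaf_def)
  show "s \<oplus>\<^bsub>sec X V\<^esub> t \<in> ideal_sheaf H X h hs V"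
    if "s \<in> ideal_sheaf H X h hs V" "t \<in> ideal_sheaf H X h hs V" for s t
    using that by (simp add: ideal_sheaf_def)
  show "r \<otimes>\<^bsub>sec X V\<^esub> s \<in> ideal_sheaf H X h hs V"
    if "r \<in> carrier (sec X V)" "s \<in> ideal_sheaf H X h hs V" for r s
    using that by (simp add: ideal_sheaf_def)
  fix W s assume W: "openin (pts X) W" "W \<subseteq> V" and s: "s \<in> ideal_sheaf H X h hs V"
  interpret C: cring "sec H (preim H h W)" by (rule ringed_cspace_sections(1)[OF H openin_preim[OF h W(1)]])
  have sub: "preim H h W \<subseteq> preim H h V" using W(2) by (auto simp: preim_def)
  have "res H (preim H h V) (preim H h W) \<zero>\<^bsub>sec H (preim H h V)\<^esub> = \<zero>\<^bsub>sec H (preim H h W)\<^esub>"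
    by (rule ring_hom_zero[OF ringed_cspace_res(1)[OF H openin_preim[OF h V] openin_preim[OF h W(1)] sub]
        B.ring_axioms C.ring_axioms])
  then show "res X V W s \<in> ideal_sheaf H X h hs W"
    using s W morphism_hom(3)[OF h V W, of s] ringed_cspace_res_closed[OF X V W]
    by (simp add: ideal_sheaf_def)
qed

section \<open>The ideal of a square-zero thickening as a module\<close>

lemma glue_sections:
  assumes Y: "ringed_cspace Y" and o: "\<And>V. V \<in> \<U> \<Longrightarrow> openin (pts Y) V \<and> s V \<in> carrier (sec Y V)"
    and eq: "\<And>V W. \<lbrakk>V \<in> \<U>; W \<in> \<U>\<rbrakk> \<Longrightarrow> res Y V (V \<inter> W) (s V) = res Y W (V \<inter> W) (s W)"
  shows "\<exists>!t. t \<in> carrier (sec Y (\<Union>\<U>)) \<and> (\<forall>V\<in>\<U>. res Y (\<Union>\<U>) V t = s V)"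
  using Y[unfolded ringed_cspace_def, THEN conjunct2, rule_format, of \<U> s] o eq by blast

text \<open>A section is the unique gluing of its own restrictions to any open cover.\<close>

lemma section_eq_local:
  assumes Y: "ringed_cspace Y" and U: "openin (pts Y) U" and s: "s \<in> carrier (sec Y U)" "s' \<in> carrier (sec Y U)"
    and loc: "\<And>p. p \<in> U \<Longrightarrow> \<exists>V. openin (pts Y) V \<and> p \<in> V \<and> V \<subseteq> U \<and> res Y U V s = res Y U V s'"
  shows "s = s'"
proof -
  let ?\<U> = "{V. openin (pts Y) V \<and> V \<subseteq> U \<and> res Y U V s = res Y U V s'}"
  have Un: "\<Union>?\<U> = U" using loc by blast
  have "\<exists>!t. t \<in> carrier (sec Y (\<Union>?\<U>)) \<and> (\<forall>V\<in>?\<U>. res Y (\<Union>?\<U>) V t = res Y U V s)"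
  proof (rule glue_sections[OF Y])
    fix V assume "V \<in> ?\<U>"
    then show "openin (pts Y) V \<and> res Y U V s \<in> carrier (sec Y V)"
      using ringed_cspace_res_closed[OF Y U _ _ s(1)] by blast
  next
    fix V W assume VW: "V \<in> ?\<U>" "W \<in> ?\<U>"
    then have o: "openin (pts Y) V" "V \<subseteq> U" "openin (pts Y) W" "W \<subseteq> U" "openin (pts Y) (V \<inter> W)" by blast+
    show "res Y V (V \<inter> W) (res Y U V s) = res Y W (V \<inter> W) (res Y U W s)"
      unfolding ringed_cspace_res(3)[OF Y U o(1,2,5) Int_lower1 s(1)] ringed_cspace_res(3)[OF Y U o(3,4,5) Int_lower2 s(1)] ..
  qed
  then show ?thesis using s unfolding Un by auto
qed

text \<open>The module structure on the ideal of a double scheme comes from two of its properties: functions on \<open>X\<close> lift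
  locally to the double scheme, and the ideal has square zero.\<close>

locale square_zero_thickening =
  fixes X :: "('a, 'r) cspace" and XX :: "('a, 's) cspace" and \<rho> :: "'a set \<Rightarrow> 's \<Rightarrow> 'r"
  assumes X: "ringed_cspace X" and XX: "ringed_cspace XX" and pts_eq: "pts XX = pts X"
    and immersion: "closed_immersion X XX (\<lambda>p. p) \<rho>"
    and square_zero: "\<lbrakk>openin (pts X) U; a \<in> ideal_sheaf X XX (\<lambda>p. p) \<rho> U; b \<in> ideal_sheaf X XX (\<lambda>p. p) \<rho> U\<rbrakk>
      \<Longrightarrow> a \<otimes>\<^bsub>sec XX U\<^esub> b = \<zero>\<^bsub>sec XX U\<^esub>"
begin

abbreviation "nil \<equiv> ideal_sheaf X XX (\<lambda>p. p) \<rho>"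

lemma preim_id: "openin (pts X) U \<Longrightarrow> preim X (\<lambda>p. p) U = U"
  using openin_subset by (auto simp: preim_def)

lemma \<rho>_morphism: "morphism X XX (\<lambda>p. p) \<rho>"
  using immersion by (simp add: closed_immersion_def)

lemma \<rho>_hom: "openin (pts X) U \<Longrightarrow> \<rho> U \<in> ring_hom (sec XX U) (sec X U)"
  using morphism_hom(1)[OF \<rho>_morphism, of U] by (simp add: pts_eq preim_id)

lemma \<rho>_res: "\<lbrakk>openin (pts X) U; openin (pts X) V; V \<subseteq> U; s \<in> carrier (sec XX U)\<rbrakk> \<Longrightarrow>
    \<rho> V (res XX U V s) = res X U V (\<rho> U s)"
  using morphism_hom(3)[OF \<rho>_morphism, of U V s] by (simp add: pts_eq preim_id)

lemma mem_nil: "openin (pts X) U \<Longrightarrow> s \<in> nil U \<longleftrightarrow> s \<in> carrier (sec XX U) \<and> \<rho> U s = \<zero>\<^bsub>sec X U\<^esub>"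
  by (simp add: ideal_sheaf_def preim_id)

sublocale nil: ideal_presheaf XX nil
  by (rule ideal_presheaf_ideal_sheaf[OF XX X \<rho>_morphism])

lemmas nil_carrier = nil.J_carrier[unfolded pts_eq]
  and nil_add = nil.J_add[unfolded pts_eq]
  and nil_smult = nil.J_smult[unfolded pts_eq]
  and nil_res = nil.J_res[unfolded pts_eq]

lemmas cring_XX = ringed_cspace_sections(1)[OF XX, unfolded pts_eq]
  and res_hom_XX = ringed_cspace_res(1)[OF XX, unfolded pts_eq]
  and res_res_XX = ringed_cspace_res(3)[OF XX, unfolded pts_eq]
  and res_closed_XX = ringed_cspace_res_closed[OF XX, unfolded pts_eq]
  and res_id_XX = ringed_cspace_sections(3)[OF XX, unfolded pts_eq]

definition lift :: "'a set \<Rightarrow> 's \<Rightarrow> 'a set \<Rightarrow> 'r \<Rightarrow> bool" where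
  "lift V b U r \<longleftrightarrow> openin (pts X) V \<and> V \<subseteq> U \<and> b \<in> carrier (sec XX V) \<and> \<rho> V b = res X U V r"

lemma local_lift:
  assumes "openin (pts X) U" "r \<in> carrier (sec X U)" "p \<in> U"
  obtains V b where "p \<in> V" "lift V b U r"
proof -
  have "\<forall>V s q. openin (pts XX) V \<and> s \<in> carrier (sec X (preim X (\<lambda>p. p) V)) \<and> q \<in> V \<longrightarrow>
       (\<exists>W\<in>opens_in XX V. q \<in> W \<and>
          (\<exists>t\<in>carrier (sec XX W). \<rho> W t = res X (preim X (\<lambda>p. p) V) (preim X (\<lambda>p. p) W) s))"
    using immersion unfolding closed_immersion_def by blast
  then obtain W t where "W \<in> opens_in XX U" "p \<in> W" "t \<in> carrier (sec XX W)"
      "\<rho> W t = res X (preim X (\<lambda>p. p) U) (preim X (\<lambda>p. p) W) r"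
    using assms by (metis pts_eq preim_id)
  then show ?thesis using that[of W t] assms by (simp add: lift_def opens_in_iff pts_eq preim_id)
qed

lemma lift_restrict:
  assumes "openin (pts X) U" "r \<in> carrier (sec X U)" "lift V b U r" "openin (pts X) W" "W \<subseteq> V"
  shows "lift W (res XX V W b) U r"
  using assms res_closed_XX[of V W b] \<rho>_res[of V W b] ringed_cspace_res(3)[OF X, of U V W r]
  by (auto simp: lift_def)

text \<open>The difference of the two lifts lies in the ideal, and the ideal annihilates itself.\<close>

lemma lift_unique_on_nil:
  assumes V: "openin (pts X) V" and b: "b \<in> carrier (sec XX V)" "b' \<in> carrier (sec XX V)" "\<rho> V b = \<rho> V b'"
    and m: "m \<in> nil V"
  shows "b \<otimes>\<^bsub>sec XX V\<^esub> m = b' \<otimes>\<^bsub>sec XX V\<^esub> m"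
proof -
  interpret A: cring "sec XX V" by (rule cring_XX[OF V])
  interpret B: cring "sec X V" by (rule ringed_cspace_sections(1)[OF X V])
  interpret h: ring_hom_cring "sec XX V" "sec X V" "\<rho> V"
    by (intro ring_hom_cring.intro ring_hom_cring_axioms.intro \<rho>_hom V A.cring_axioms B.cring_axioms)
  have mc: "m \<in> carrier (sec XX V)" by (rule nil_carrier[OF V m])
  have "b \<ominus>\<^bsub>sec XX V\<^esub> b' \<in> nil V"
    unfolding mem_nil[OF V] using b by (simp add: A.minus_eq B.r_neg)
  then have "(b \<ominus>\<^bsub>sec XX V\<^esub> b') \<otimes>\<^bsub>sec XX V\<^esub> m = \<zero>\<^bsub>sec XX V\<^esub>" using square_zero[OF V _ m] by blast
  then have "b \<otimes>\<^bsub>sec XX V\<^esub> m \<ominus>\<^bsub>sec XX V\<^esub> b' \<otimes>\<^bsub>sec XX V\<^esub> m = \<zero>\<^bsub>sec XX V\<^esub>"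
    using b mc by (simp add: A.minus_eq A.l_distr A.l_minus)
  then show ?thesis using b mc A.r_right_minus_eq by simp
qed

abbreviation "line_bundle \<equiv> associated_line_bundle X XX \<rho>"

lemma line_bundle_simps:
  "carrier (msec line_bundle U) = nil U" "m \<oplus>\<^bsub>msec line_bundle U\<^esub> n = m \<oplus>\<^bsub>sec XX U\<^esub> n"
  "\<zero>\<^bsub>msec line_bundle U\<^esub> = \<zero>\<^bsub>sec XX U\<^esub>" "mres line_bundle = res XX"
  by (simp_all add: associated_line_bundle_def)

lemma nil_eq_local:
  assumes U: "openin (pts X) U" and n: "n \<in> nil U" "n' \<in> nil U"
    and "\<And>p. p \<in> U \<Longrightarrow> \<exists>V. openin (pts X) V \<and> p \<in> V \<and> V \<subseteq> U \<and> res XX U V n = res XX U V n'"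
  shows "n = n'"
  using section_eq_local[OF XX _ nil_carrier[OF U n(1)] nil_carrier[OF U n(2)]] assms(4) U by (simp add: pts_eq)

text \<open>Two lifts of \<open>r\<close> differ by an element of the ideal, which annihilates the ideal. So the products of \<open>m\<close> with local
  lifts of \<open>r\<close> agree on overlaps, and they are glued.\<close>

lemma scalar_product_exists:
  assumes U: "openin (pts X) U" and r: "r \<in> carrier (sec X U)" and m: "m \<in> nil U"
  shows "\<exists>!n. n \<in> nil U \<and> (\<forall>V b. lift V b U r \<longrightarrow> res XX U V n = b \<otimes>\<^bsub>sec XX V\<^esub> res XX U V m)"
proof -
  let ?\<U> = "{V. \<exists>b. lift V b U r}"
  have Un: "\<Union>?\<U> = U"
  proof
    show "\<Union>?\<U> \<subseteq> U" by (auto simp: lift_def)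
    show "U \<subseteq> \<Union>?\<U>"
    proof
      fix p assume "p \<in> U"
      then obtain V b where "p \<in> V" "lift V b U r" by (rule local_lift[OF U r])
      then show "p \<in> \<Union>?\<U>" by blast
    qed
  qed
  define b where "b V = (SOME b. lift V b U r)" for V
  have b: "lift V (b V) U r" if "V \<in> ?\<U>" for V
    using that someI_ex[of "\<lambda>b. lift V b U r"] by (simp add: b_def)
  have mr: "res XX U V m \<in> nil V" if "openin (pts X) V" "V \<subseteq> U" for V
    using nil_res[OF U that m] .
  have res_prod: "res XX V W (c \<otimes>\<^bsub>sec XX V\<^esub> res XX U V m) = res XX V W c \<otimes>\<^bsub>sec XX W\<^esub> res XX U W m"
    if "lift V c U r" "openin (pts X) W" "W \<subseteq> V" for V W c
    using that ring_hom_mult[OF res_hom_XX[of V W]] nil_carrier[OF _ mr] res_res_XX[OF U _ _ _ _ nil_carrier[OF U m]]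
    by (simp add: lift_def)
  have indep: "c \<otimes>\<^bsub>sec XX V\<^esub> res XX U V m = c' \<otimes>\<^bsub>sec XX V\<^esub> res XX U V m"
    if "lift V c U r" "lift V c' U r" for V c c'
    using that by (intro lift_unique_on_nil mr) (auto simp: lift_def)
  have "\<exists>!t. t \<in> carrier (sec XX (\<Union>?\<U>)) \<and> (\<forall>V\<in>?\<U>. res XX (\<Union>?\<U>) V t = b V \<otimes>\<^bsub>sec XX V\<^esub> res XX U V m)"
  proof (rule glue_sections[OF XX])
    fix V assume "V \<in> ?\<U>"
    note b = b[OF this]
    then have o: "openin (pts X) V" "V \<subseteq> U" "b V \<in> carrier (sec XX V)" by (auto simp: lift_def)
    show "openin (pts XX) V \<and> b V \<otimes>\<^bsub>sec XX V\<^esub> res XX U V m \<in> carrier (sec XX V)"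
      using o nil_carrier[OF o(1) nil_smult[OF o(1,3) mr[OF o(1,2)]]] by (simp add: pts_eq)
  next
    fix V W assume V: "V \<in> ?\<U>" and W: "W \<in> ?\<U>"
    note bV = b[OF V] and bW = b[OF W]
    have o: "openin (pts X) (V \<inter> W)" using bV bW by (auto simp: lift_def)
    show "res XX V (V \<inter> W) (b V \<otimes>\<^bsub>sec XX V\<^esub> res XX U V m)
        = res XX W (V \<inter> W) (b W \<otimes>\<^bsub>sec XX W\<^esub> res XX U W m)"
      unfolding res_prod[OF bV o Int_lower1] res_prod[OF bW o Int_lower2]
      by (intro indep lift_restrict[OF U r bV o] lift_restrict[OF U r bW o]) auto
  qed
  then obtain n where n: "n \<in> carrier (sec XX U)"
      and nb: "\<And>V. V \<in> ?\<U> \<Longrightarrow> res XX U V n = b V \<otimes>\<^bsub>sec XX V\<^esub> res XX U V m"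
    unfolding Un by blast
  have nl: "res XX U V n = c \<otimes>\<^bsub>sec XX V\<^esub> res XX U V m" if c: "lift V c U r" for V c
  proof -
    have V: "V \<in> ?\<U>" using c by blast
    show ?thesis using nb[OF V] indep[OF b[OF V] c] by simp
  qed
  interpret B: cring "sec X U" by (rule ringed_cspace_sections(1)[OF X U])
  have "\<rho> U n = \<zero>\<^bsub>sec X U\<^esub>"
  proof (rule section_eq_local[OF X U ring_hom_closed[OF \<rho>_hom[OF U] n] B.zero_closed])
    fix p assume "p \<in> U"
    then obtain V c where V: "p \<in> V" "lift V c U r" by (rule local_lift[OF U r])
    then have o: "openin (pts X) V" "V \<subseteq> U" "c \<in> carrier (sec XX V)" by (auto simp: lift_def)
    interpret C: cring "sec X V" by (rule ringed_cspace_sections(1)[OF X o(1)])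
    have "res X U V (\<rho> U n) = \<rho> V (c \<otimes>\<^bsub>sec XX V\<^esub> res XX U V m)"
      using \<rho>_res[OF U o(1,2) n] nl[OF V(2)] by simp
    also have "\<dots> = \<zero>\<^bsub>sec X V\<^esub>"
      using nil_smult[OF o(1,3) mr[OF o(1,2)]] mem_nil[OF o(1)] by blast
    also have "\<dots> = res X U V \<zero>\<^bsub>sec X U\<^esub>"
      using ring_hom_zero[OF ringed_cspace_res(1)[OF X U o(1,2)] B.ring_axioms C.ring_axioms] by simp
    finally show "\<exists>V. openin (pts X) V \<and> p \<in> V \<and> V \<subseteq> U \<and> res X U V (\<rho> U n) = res X U V \<zero>\<^bsub>sec X U\<^esub>"
      using V o by blast
  qed
  then have nn: "n \<in> nil U" using n mem_nil[OF U] by blast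
  show ?thesis
  proof (rule ex1I[of _ n])
    show "n \<in> nil U \<and> (\<forall>V b. lift V b U r \<longrightarrow> res XX U V n = b \<otimes>\<^bsub>sec XX V\<^esub> res XX U V m)"
      using nn nl by blast
    fix n' assume n': "n' \<in> nil U \<and> (\<forall>V b. lift V b U r \<longrightarrow> res XX U V n' = b \<otimes>\<^bsub>sec XX V\<^esub> res XX U V m)"
    show "n' = n"
    proof (rule nil_eq_local[OF U])
      fix p assume "p \<in> U"
      then obtain V c where V: "p \<in> V" "lift V c U r" by (rule local_lift[OF U r])
      then show "\<exists>V. openin (pts X) V \<and> p \<in> V \<and> V \<subseteq> U \<and> res XX U V n' = res XX U V n"
        using n' nl[OF V(2)] by (intro exI[of _ V]) (auto simp: lift_def)
    qed (use n' nn in auto)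
  qed
qed

lemma line_bundle_smult:
  "r \<odot>\<^bsub>msec line_bundle U\<^esub> m = (THE n. n \<in> nil U \<and> (\<forall>V b. lift V b U r \<longrightarrow> res XX U V n = b \<otimes>\<^bsub>sec XX V\<^esub> res XX U V m))"
  unfolding associated_line_bundle_def lift_def
  by (simp add: Ball_def opens_in_iff) (rule arg_cong[of _ _ The], auto)

lemma smult_spec:
  assumes "openin (pts X) U" "r \<in> carrier (sec X U)" "m \<in> nil U"
  shows smult_nil: "r \<odot>\<^bsub>msec line_bundle U\<^esub> m \<in> nil U"
    and smult_lift: "lift V b U r \<Longrightarrow> res XX U V (r \<odot>\<^bsub>msec line_bundle U\<^esub> m) = b \<otimes>\<^bsub>sec XX V\<^esub> res XX U V m"
  using theI'[OF scalar_product_exists[OF assms]] unfolding line_bundle_smult[symmetric] by blast+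

text \<open>The models are the rings of the thickening, acting on themselves, on open sets where the scalars have lifts.\<close>

lemma module_line_bundle:
  assumes U: "openin (pts X) U"
  shows "module (sec X U) (msec line_bundle U)"
proof (rule locally_modelled.module)
  let ?K = "\<lambda>p. {V. openin (pts X) V \<and> p \<in> V \<and> V \<subseteq> U}"
    and ?scal = "\<lambda>V r b. r \<in> carrier (sec X U) \<and> lift V b U r"
    and ?rep = "\<lambda>V n a. n \<in> nil U \<and> openin (pts X) V \<and> V \<subseteq> U \<and> a = res XX U V n"
  interpret R: cring "sec X U" by (rule ringed_cspace_sections(1)[OF X U])
  interpret SU: cring "sec XX U" by (rule cring_XX[OF U])
  have z: "\<zero>\<^bsub>sec XX U\<^esub> \<in> nil U"
    unfolding mem_nil[OF U] using ring_hom_zero[OF \<rho>_hom[OF U] SU.ring_axioms R.ring_axioms] by simp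
  show "locally_modelled (sec X U) (msec line_bundle U) U ?K (sec XX) (\<lambda>V. self_module (sec XX V)) ?scal ?rep"
  proof (intro locally_modelled.intro, unfold mem_Collect_eq line_bundle_simps)
    fix p V assume V: "openin (pts X) V \<and> p \<in> V \<and> V \<subseteq> U"
    then have o: "openin (pts X) V" "V \<subseteq> U" by auto
    interpret A: cring "sec XX V" by (rule cring_XX[OF o(1)])
    interpret B: cring "sec X V" by (rule ringed_cspace_sections(1)[OF X o(1)])
    note h = \<rho>_hom[OF o(1)] and hX = ringed_cspace_res(1)[OF X U o] and hXX = res_hom_XX[OF U o]
    show "module (sec XX V) (self_module (sec XX V))" by (rule module_self_module[OF A.cring_axioms])
    show "?scal V \<zero>\<^bsub>sec X U\<^esub> \<zero>\<^bsub>sec XX V\<^esub>" "?scal V \<one>\<^bsub>sec X U\<^esub> \<one>\<^bsub>sec XX V\<^esub>"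
      using o ring_hom_zero[OF h A.ring_axioms B.ring_axioms] ring_hom_zero[OF hX R.ring_axioms B.ring_axioms]
        ring_hom_one[OF h] ring_hom_one[OF hX] by (simp_all add: lift_def)
    show "?rep V \<zero>\<^bsub>sec XX U\<^esub> \<zero>\<^bsub>self_module (sec XX V)\<^esub>"
      using o z ring_hom_zero[OF hXX SU.ring_axioms A.ring_axioms] by (simp add: self_module_def)
    fix r b assume r: "?scal V r b"
    show "?scal V (r \<oplus>\<^bsub>sec X U\<^esub> r') (b \<oplus>\<^bsub>sec XX V\<^esub> b')" "?scal V (r \<otimes>\<^bsub>sec X U\<^esub> r') (b \<otimes>\<^bsub>sec XX V\<^esub> b')"
      if "?scal V r' b'" for r' b'
      using r that by (simp_all add: lift_def ring_hom_add[OF h] ring_hom_mult[OF h] ring_hom_add[OF hX] ring_hom_mult[OF hX])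
    fix n a assume n: "?rep V n a"
    then have a: "a \<in> nil V" using nil_res[OF U o] by blast
    show "b \<odot>\<^bsub>self_module (sec XX V)\<^esub> a = b' \<odot>\<^bsub>self_module (sec XX V)\<^esub> a" if "?scal V r b'" for b'
      using r that lift_unique_on_nil[OF o(1) _ _ _ a, of b b'] by (simp add: self_module_def lift_def)
    show "?rep V (r \<odot>\<^bsub>msec line_bundle U\<^esub> n) (b \<odot>\<^bsub>self_module (sec XX V)\<^esub> a)"
      using r n o smult_nil[OF U, of r n] smult_lift[OF U, of r n V b] by (simp add: self_module_def)
  next
    fix p V n a n' a' assume V: "openin (pts X) V \<and> p \<in> V \<and> V \<subseteq> U" and n: "?rep V n a" "?rep V n' a'"
    then show "?rep V (n \<oplus>\<^bsub>sec XX U\<^esub> n') (a \<oplus>\<^bsub>self_module (sec XX V)\<^esub> a')"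
      using ring_hom_add[OF res_hom_XX[OF U, of V]] nil_carrier[OF U] nil_add[OF U] by (simp add: self_module_def)
  next
    fix n n' assume n: "n \<in> nil U" "n' \<in> nil U" and eq: "\<And>p. p \<in> U \<Longrightarrow> \<exists>V\<in>?K p. \<exists>a. ?rep V n a \<and> ?rep V n' a"
    show "n = n'"
    proof (rule nil_eq_local[OF U n])
      fix p assume "p \<in> U"
      from eq[OF this] show "\<exists>V. openin (pts X) V \<and> p \<in> V \<and> V \<subseteq> U \<and> res XX U V n = res XX U V n'" by auto
    qed
  next
    fix p r r' x y z
    assume p: "p \<in> U" and r: "r \<in> carrier (sec X U)" "r' \<in> carrier (sec X U)" and x: "x \<in> nil U" "y \<in> nil U" "z \<in> nil U"
    obtain V b where V: "p \<in> V" "lift V b U r" by (rule local_lift[OF U r(1) p])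
    obtain V' b' where V': "p \<in> V'" "lift V' b' U r'" by (rule local_lift[OF U r(2) p])
    let ?V = "V \<inter> V'"
    have o: "openin (pts X) ?V" "p \<in> ?V" "?V \<subseteq> U" using V V' by (auto simp: lift_def)
    have "lift ?V (res XX V ?V b) U r" "lift ?V (res XX V' ?V b') U r'"
      using lift_restrict[OF U r(1) V(2) o(1)] lift_restrict[OF U r(2) V'(2) o(1)] by auto
    with o r x show "\<exists>V\<in>?K p. \<exists>s s' a b c. ?scal V r s \<and> ?scal V r' s' \<and> ?rep V x a \<and> ?rep V y b \<and> ?rep V z c"
      by (intro bexI[of _ ?V] exI[of _ "res XX V ?V b"] exI[of _ "res XX V' ?V b'"] exI[of _ "res XX U ?V x"]
          exI[of _ "res XX U ?V y"] exI[of _ "res XX U ?V z"]) simp_all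
  qed (use nil_add[OF U] smult_nil[OF U] z R.cring_axioms res_closed_XX[OF U] nil_carrier[OF U]
      in \<open>auto simp: self_module_def lift_def\<close>)
qed

lemma module_presheaf_line_bundle: "module_presheaf X line_bundle"
proof (rule module_presheaf.intro)
  show "ringed_cspace X" by (rule X)
  show "module (sec X U) (msec line_bundle U)" if "openin (pts X) U" for U
    by (rule module_line_bundle[OF that])
  show "mres line_bundle U U m = m" if "openin (pts X) U" "m \<in> carrier (msec line_bundle U)" for U m
    using that res_id_XX nil_carrier by (simp add: line_bundle_simps)
  show "mres line_bundle V W (mres line_bundle U V m) = mres line_bundle U W m"
    if "openin (pts X) U" "openin (pts X) V" "openin (pts X) W" "V \<subseteq> U" "W \<subseteq> V" "m \<in> carrier (msec line_bundle U)" for U V W m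
    using that res_res_XX nil_carrier by (simp add: line_bundle_simps)
  fix U V assume U: "openin (pts X) U" and V: "openin (pts X) V" "V \<subseteq> U"
  show "semilinear (res X U V) (sec X U) (msec line_bundle U) (msec line_bundle V) (mres line_bundle U V)"
  proof (rule semilinearI)
    fix r m assume r: "r \<in> carrier (sec X U)" and "m \<in> carrier (msec line_bundle U)"
    then have m: "m \<in> nil U" by (simp add: line_bundle_simps)
    have r': "res X U V r \<in> carrier (sec X V)" by (rule ringed_cspace_res_closed[OF X U V r])
    show "mres line_bundle U V (r \<odot>\<^bsub>msec line_bundle U\<^esub> m) = res X U V r \<odot>\<^bsub>msec line_bundle V\<^esub> mres line_bundle U V m"
      unfolding line_bundle_simps
    proof (rule nil_eq_local[OF V(1) nil_res[OF U V smult_nil[OF U r m]] smult_nil[OF V(1) r' nil_res[OF U V m]]])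
      fix p assume "p \<in> V"
      then obtain W b where W: "p \<in> W" "lift W b V (res X U V r)" by (rule local_lift[OF V(1) r'])
      then have o: "openin (pts X) W" "W \<subseteq> V" by (auto simp: lift_def)
      have b: "lift W b U r"
        using W V o ringed_cspace_res(3)[OF X U V o r] by (auto simp: lift_def)
      have "res XX V W (res XX U V (r \<odot>\<^bsub>msec line_bundle U\<^esub> m)) = res XX V W (res X U V r \<odot>\<^bsub>msec line_bundle V\<^esub> res XX U V m)"
        using smult_lift[OF U r m b] smult_lift[OF V(1) r' nil_res[OF U V m] W(2)]
          res_res_XX[OF U V o nil_carrier[OF U smult_nil[OF U r m]]] res_res_XX[OF U V o nil_carrier[OF U m]]
        by simp
      then show "\<exists>W. openin (pts X) W \<and> p \<in> W \<and> W \<subseteq> V \<and>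
          res XX V W (res XX U V (r \<odot>\<^bsub>msec line_bundle U\<^esub> m)) = res XX V W (res X U V r \<odot>\<^bsub>msec line_bundle V\<^esub> res XX U V m)"
        using W o by blast
    qed
  qed (use nil_res[OF U V] ring_hom_add[OF res_hom_XX[OF U V]] nil_carrier[OF U] in \<open>simp_all add: line_bundle_simps\<close>)
qed

end

section \<open>Transition automorphisms of a double scheme\<close>

lemma tangent_sheaf_eqI:
  assumes "D \<in> carrier (msec (tangent_sheaf X) U)" "E \<in> carrier (msec (tangent_sheaf X) U)"
    and "\<And>V s. \<lbrakk>V \<in> opens_in X U; s \<in> carrier (sec X V)\<rbrakk> \<Longrightarrow> D V s = E V s"
  shows "D = E"
  using assms unfolding tangent_sheaf_def by (rule map_sheaf_eqI)

lemma dual_numbers_simps: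
  "carrier (dual_numbers R) = carrier R \<times> carrier R"
  "(a, b) \<oplus>\<^bsub>dual_numbers R\<^esub> (c, d) = (a \<oplus>\<^bsub>R\<^esub> c, b \<oplus>\<^bsub>R\<^esub> d)"
  "(a, b) \<otimes>\<^bsub>dual_numbers R\<^esub> (c, d) = (a \<otimes>\<^bsub>R\<^esub> c, a \<otimes>\<^bsub>R\<^esub> d \<oplus>\<^bsub>R\<^esub> b \<otimes>\<^bsub>R\<^esub> c)"
  by (simp_all add: dual_numbers_def)

locale split_atlas = square_zero_thickening X XX \<rho>
  for X :: "('a, 'r) cspace" and XX :: "('a, 's) cspace" and \<rho> :: "'a set \<Rightarrow> 's \<Rightarrow> 'r" +
  fixes I :: "'i set" and U :: "'i \<Rightarrow> 'a set" and \<delta> :: "'i \<Rightarrow> 'a set \<Rightarrow> 'r \<times> 'r \<Rightarrow> 's"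
  assumes chart_open: "i \<in> I \<Longrightarrow> openin (pts X) (U i)"
    and chart: "i \<in> I \<Longrightarrow> split_chart X XX \<rho> (U i) (\<delta> i)"
begin

lemma preim_open_sub: "openin (pts X) V \<Longrightarrow> V \<subseteq> U i \<Longrightarrow> preim (open_sub XX (U i)) (\<lambda>p. p) V = V"
  using openin_subset[of "pts X" V] by (auto simp: preim_def open_sub_def pts_eq)

lemma chart_facts:
  assumes i: "i \<in> I" and V: "openin (pts X) V" "V \<subseteq> U i"
  shows chart_hom: "\<delta> i V \<in> ring_hom (dual_numbers (sec X V)) (sec XX V)"
    and chart_bij: "bij_betw (\<delta> i V) (carrier (dual_numbers (sec X V))) (carrier (sec XX V))"
    and chart_cst: "\<delta> i V (cst X V c, \<zero>\<^bsub>sec X V\<^esub>) = cst XX V c"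
    and chart_res: "\<lbrakk>openin (pts X) W; W \<subseteq> V; w \<in> carrier (dual_numbers (sec X V))\<rbrakk> \<Longrightarrow>
      \<delta> i W (map_prod (res X V W) (res X V W) w) = res XX V W (\<delta> i V w)"
    and chart_\<rho>: "\<lbrakk>u \<in> carrier (sec X V); v \<in> carrier (sec X V)\<rbrakk> \<Longrightarrow> \<rho> V (\<delta> i V (u, v)) = u"
proof -
  let ?A = "open_sub XX (U i)" and ?B = "times_Z2 (open_sub X (U i))"
  have iso: "isomorphism ?A ?B (\<lambda>p. p) (\<delta> i)" using chart[OF i] by (simp add: split_chart_def)
  then have m: "morphism ?A ?B (\<lambda>p. p) (\<delta> i)" by (simp add: isomorphism_def)
  have oB: "openin (pts ?B) W" if "openin (pts X) W" "W \<subseteq> V" for W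
    using that V by (simp add: times_Z2_def open_sub_def openin_open_subtopology[OF chart_open[OF i]])
  have secs: "sec ?A = sec XX" "res ?A = res XX" "cst ?A = cst XX"
    by (simp_all add: open_sub_def)
  have secB: "sec ?B W = dual_numbers (sec X W)" "res ?B W W' = map_prod (res X W W') (res X W W')"
      "cst ?B W c = (cst X W c, \<zero>\<^bsub>sec X W\<^esub>)" for W W' c
    by (simp_all add: times_Z2_def open_sub_def)
  note p = preim_open_sub[OF V]
  show "\<delta> i V \<in> ring_hom (dual_numbers (sec X V)) (sec XX V)"
    using morphism_hom(1)[OF m oB[OF V(1) order_refl]] by (simp add: secs secB p)
  show "bij_betw (\<delta> i V) (carrier (dual_numbers (sec X V))) (carrier (sec XX V))"
    using iso oB[OF V(1) order_refl] unfolding isomorphism_def by (metis secs(1) secB(1) p)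
  show "\<delta> i V (cst X V c, \<zero>\<^bsub>sec X V\<^esub>) = cst XX V c"
    using morphism_hom(2)[OF m oB[OF V(1) order_refl], of c] by (simp add: secs secB p)
  show "\<delta> i W (map_prod (res X V W) (res X V W) w) = res XX V W (\<delta> i V w)"
    if "openin (pts X) W" "W \<subseteq> V" "w \<in> carrier (dual_numbers (sec X V))"
    using morphism_hom(3)[OF m oB[OF V(1) order_refl] oB[OF that(1,2)] that(2), of w] that V
    by (simp add: secs secB p preim_open_sub)
  show "\<rho> V (\<delta> i V (u, v)) = u" if "u \<in> carrier (sec X V)" "v \<in> carrier (sec X V)"
    using chart[OF i] V that by (simp add: split_chart_def opens_in_iff)
qed

abbreviation "\<tau> \<equiv> transition X \<delta>"

text \<open>As the chart \<open>\<delta>\<^sub>i\<close> is injective, a value of the transition can be identified after applying \<open>\<delta>\<^sub>i\<close>.\<close>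

lemma transition_unique:
  assumes "i \<in> I" "openin (pts X) V" "V \<subseteq> U i"
    and "w' \<in> carrier (dual_numbers (sec X V))" "\<delta> i V w' = \<delta> j V w"
  shows "\<tau> i j V w = w'"
  using chart_bij[OF assms(1-3)] assms(4) assms(5)[symmetric]
  by (simp add: transition_def bij_betw_def inv_into_f_f)

context
  fixes i j V
  assumes ij: "i \<in> I" "j \<in> I" and V: "openin (pts X) V" "V \<subseteq> U i" "V \<subseteq> U j"
begin

lemma transition_spec:
  assumes "w \<in> carrier (dual_numbers (sec X V))"
  shows transition_closed: "\<tau> i j V w \<in> carrier (dual_numbers (sec X V))"
    and chart_transition: "\<delta> i V (\<tau> i j V w) = \<delta> j V w"
proof -
  have "\<delta> j V w \<in> \<delta> i V ` carrier (dual_numbers (sec X V))"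
    using chart_bij[OF ij(1) V(1,2)] chart_bij[OF ij(2) V(1,3)] assms unfolding bij_betw_def by blast
  then show "\<tau> i j V w \<in> carrier (dual_numbers (sec X V))" "\<delta> i V (\<tau> i j V w) = \<delta> j V w"
    by (simp_all add: transition_def inv_into_into f_inv_into_f)
qed

text \<open>Both charts induce the identity on \<open>X\<close>, so the transition is the identity modulo \<open>t\<close>.\<close>

lemma fst_transition:
  assumes "w \<in> carrier (dual_numbers (sec X V))"
  shows "fst (\<tau> i j V w) = fst w"
  using chart_\<rho>[OF ij(1) V(1,2), of "fst (\<tau> i j V w)" "snd (\<tau> i j V w)"] chart_\<rho>[OF ij(2) V(1,3), of "fst w" "snd w"]
    transition_closed[OF assms] chart_transition[OF assms] assms
  by (auto simp: dual_numbers_simps mem_Times_iff)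

lemma dual_closed:
  assumes "w \<in> carrier (dual_numbers (sec X V))" "z \<in> carrier (dual_numbers (sec X V))"
  shows "w \<oplus>\<^bsub>dual_numbers (sec X V)\<^esub> z \<in> carrier (dual_numbers (sec X V))"
    and "w \<otimes>\<^bsub>dual_numbers (sec X V)\<^esub> z \<in> carrier (dual_numbers (sec X V))"
proof -
  interpret cring "sec X V" by (rule ringed_cspace_sections(1)[OF X V(1)])
  show "w \<oplus>\<^bsub>dual_numbers (sec X V)\<^esub> z \<in> carrier (dual_numbers (sec X V))"
    "w \<otimes>\<^bsub>dual_numbers (sec X V)\<^esub> z \<in> carrier (dual_numbers (sec X V))"
    using assms by (auto simp: dual_numbers_simps)
qed

lemma transition_ops:
  assumes w: "w \<in> carrier (dual_numbers (sec X V))" and z: "z \<in> carrier (dual_numbers (sec X V))"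
  shows transition_add: "\<tau> i j V (w \<oplus>\<^bsub>dual_numbers (sec X V)\<^esub> z) = \<tau> i j V w \<oplus>\<^bsub>dual_numbers (sec X V)\<^esub> \<tau> i j V z"
    and transition_mult: "\<tau> i j V (w \<otimes>\<^bsub>dual_numbers (sec X V)\<^esub> z) = \<tau> i j V w \<otimes>\<^bsub>dual_numbers (sec X V)\<^esub> \<tau> i j V z"
proof -
  note t = transition_closed[OF w] transition_closed[OF z]
  note hi = chart_hom[OF ij(1) V(1,2)] and hj = chart_hom[OF ij(2) V(1,3)]
  show "\<tau> i j V (w \<oplus>\<^bsub>dual_numbers (sec X V)\<^esub> z) = \<tau> i j V w \<oplus>\<^bsub>dual_numbers (sec X V)\<^esub> \<tau> i j V z"
    by (rule transition_unique[OF ij(1) V(1,2) dual_closed(1)[OF t]])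
      (simp add: ring_hom_add[OF hi t] ring_hom_add[OF hj w z] chart_transition w z)
  show "\<tau> i j V (w \<otimes>\<^bsub>dual_numbers (sec X V)\<^esub> z) = \<tau> i j V w \<otimes>\<^bsub>dual_numbers (sec X V)\<^esub> \<tau> i j V z"
    by (rule transition_unique[OF ij(1) V(1,2) dual_closed(2)[OF t]])
      (simp add: ring_hom_mult[OF hi t] ring_hom_mult[OF hj w z] chart_transition w z)
qed

lemma transition_res:
  assumes w: "w \<in> carrier (dual_numbers (sec X V))" and W: "openin (pts X) W" "W \<subseteq> V"
  shows "\<tau> i j W (map_prod (res X V W) (res X V W) w) = map_prod (res X V W) (res X V W) (\<tau> i j V w)"
proof (rule transition_unique[OF ij(1) W(1)])
  show "W \<subseteq> U i" using W V by blast
  show "map_prod (res X V W) (res X V W) (\<tau> i j V w) \<in> carrier (dual_numbers (sec X W))"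
    using transition_closed[OF w] ringed_cspace_res_closed[OF X V(1) W]
    by (auto simp: dual_numbers_simps)
  show "\<delta> i W (map_prod (res X V W) (res X V W) (\<tau> i j V w)) = \<delta> j W (map_prod (res X V W) (res X V W) w)"
    using chart_res[OF ij(1) V(1,2) W transition_closed[OF w]] chart_res[OF ij(2) V(1,3) W w] chart_transition[OF w]
    by simp
qed

end

definition der :: "'i \<Rightarrow> 'i \<Rightarrow> 'a set \<Rightarrow> 'r \<Rightarrow> 'r" where
  "der i j V u = snd (\<tau> i j V (u, \<zero>\<^bsub>sec X V\<^esub>))"

definition unit :: "'i \<Rightarrow> 'i \<Rightarrow> 'a set \<Rightarrow> 'r" where
  "unit i j V = snd (\<tau> i j V (\<zero>\<^bsub>sec X V\<^esub>, \<one>\<^bsub>sec X V\<^esub>))"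

context
  fixes i j V
  assumes ij: "i \<in> I" "j \<in> I" and V: "openin (pts X) V" "V \<subseteq> U i" "V \<subseteq> U j"
begin

interpretation R: cring "sec X V"
  by (rule ringed_cspace_sections(1)[OF X V(1)])

lemma transition_base:
  assumes "u \<in> carrier (sec X V)"
  shows "\<tau> i j V (u, \<zero>\<^bsub>sec X V\<^esub>) = (u, der i j V u)"
  using fst_transition[OF ij V, of "(u, \<zero>\<^bsub>sec X V\<^esub>)"] assms
  by (simp add: der_def dual_numbers_simps prod_eq_iff)

lemma transition_t: "\<tau> i j V (\<zero>\<^bsub>sec X V\<^esub>, \<one>\<^bsub>sec X V\<^esub>) = (\<zero>\<^bsub>sec X V\<^esub>, unit i j V)"
  using fst_transition[OF ij V, of "(\<zero>\<^bsub>sec X V\<^esub>, \<one>\<^bsub>sec X V\<^esub>)"]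
  by (simp add: unit_def dual_numbers_simps prod_eq_iff)

lemma der_closed: "u \<in> carrier (sec X V) \<Longrightarrow> der i j V u \<in> carrier (sec X V)"
  using transition_closed[OF ij V, of "(u, \<zero>\<^bsub>sec X V\<^esub>)"] transition_base[of u]
  by (simp add: dual_numbers_simps)

lemma unit_closed: "unit i j V \<in> carrier (sec X V)"
  using transition_closed[OF ij V, of "(\<zero>\<^bsub>sec X V\<^esub>, \<one>\<^bsub>sec X V\<^esub>)"] transition_t
  by (simp add: dual_numbers_simps)

lemma der_add:
  assumes "a \<in> carrier (sec X V)" "b \<in> carrier (sec X V)"
  shows "der i j V (a \<oplus>\<^bsub>sec X V\<^esub> b) = der i j V a \<oplus>\<^bsub>sec X V\<^esub> der i j V b"
  using transition_add[OF ij V, of "(a, \<zero>\<^bsub>sec X V\<^esub>)" "(b, \<zero>\<^bsub>sec X V\<^esub>)"] assms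
  by (simp add: dual_numbers_simps transition_base)

text \<open>In \<open>(a + D(a) t) (b + D(b) t)\<close> the coefficient of \<open>t\<close> is \<open>a D(b) + D(a) b\<close>.\<close>

lemma der_mult:
  assumes "a \<in> carrier (sec X V)" "b \<in> carrier (sec X V)"
  shows "der i j V (a \<otimes>\<^bsub>sec X V\<^esub> b) = a \<otimes>\<^bsub>sec X V\<^esub> der i j V b \<oplus>\<^bsub>sec X V\<^esub> b \<otimes>\<^bsub>sec X V\<^esub> der i j V a"
  using transition_mult[OF ij V, of "(a, \<zero>\<^bsub>sec X V\<^esub>)" "(b, \<zero>\<^bsub>sec X V\<^esub>)"] assms
  by (simp add: dual_numbers_simps transition_base der_closed R.m_comm)

lemma der_cst: "der i j V (cst X V c) = \<zero>\<^bsub>sec X V\<^esub>"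
proof -
  have c: "cst X V c \<in> carrier (sec X V)"
    using ring_hom_closed[OF ringed_cspace_sections(2)[OF X V(1)], of c] by (simp add: type_ring_def)
  have "\<tau> i j V (cst X V c, \<zero>\<^bsub>sec X V\<^esub>) = (cst X V c, \<zero>\<^bsub>sec X V\<^esub>)"
    by (rule transition_unique[OF ij(1) V(1,2)])
      (simp_all add: dual_numbers_simps c chart_cst[OF ij(1) V(1,2)] chart_cst[OF ij(2) V(1,3)])
  then show ?thesis using transition_base[OF c] by simp
qed

text \<open>Write \<open>u + v t\<close> as \<open>u + v \<cdot> t\<close>; as \<open>t\<close> goes to a multiple of \<open>t\<close> and \<open>t\<^sup>2 = 0\<close>, the derivative of \<open>v\<close> disappears.\<close>

lemma transition_eq:
  assumes u: "u \<in> carrier (sec X V)" and v: "v \<in> carrier (sec X V)"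
  shows "\<tau> i j V (u, v) = (u, der i j V u \<oplus>\<^bsub>sec X V\<^esub> unit i j V \<otimes>\<^bsub>sec X V\<^esub> v)"
proof -
  let ?z = "\<zero>\<^bsub>sec X V\<^esub>"
  have "\<tau> i j V (?z, v) = \<tau> i j V ((v, ?z) \<otimes>\<^bsub>dual_numbers (sec X V)\<^esub> (?z, \<one>\<^bsub>sec X V\<^esub>))"
    using v by (simp add: dual_numbers_simps)
  also have "\<dots> = (?z, unit i j V \<otimes>\<^bsub>sec X V\<^esub> v)"
    using v by (subst transition_mult[OF ij V])
      (simp_all add: dual_numbers_simps transition_base transition_t der_closed unit_closed R.m_comm)
  finally have t: "\<tau> i j V (?z, v) = (?z, unit i j V \<otimes>\<^bsub>sec X V\<^esub> v)" .
  have "\<tau> i j V (u, v) = \<tau> i j V ((u, ?z) \<oplus>\<^bsub>dual_numbers (sec X V)\<^esub> (?z, v))"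
    using u v by (simp add: dual_numbers_simps)
  also have "\<dots> = (u, der i j V u \<oplus>\<^bsub>sec X V\<^esub> unit i j V \<otimes>\<^bsub>sec X V\<^esub> v)"
    using u v by (subst transition_add[OF ij V]) (simp_all add: dual_numbers_simps transition_base t)
  finally show ?thesis .
qed

lemma der_res:
  assumes W: "openin (pts X) W" "W \<subseteq> V" and u: "u \<in> carrier (sec X V)"
  shows "der i j W (res X V W u) = res X V W (der i j V u)"
proof -
  interpret S: cring "sec X W" by (rule ringed_cspace_sections(1)[OF X W(1)])
  have "res X V W \<zero>\<^bsub>sec X V\<^esub> = \<zero>\<^bsub>sec X W\<^esub>"
    by (rule ring_hom_zero[OF ringed_cspace_res(1)[OF X V(1) W] R.ring_axioms S.ring_axioms])
  then show ?thesis
    using transition_res[OF ij V _ W, of "(u, \<zero>\<^bsub>sec X V\<^esub>)"] u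
    by (simp add: der_def dual_numbers_simps)
qed

lemma unit_res:
  assumes W: "openin (pts X) W" "W \<subseteq> V"
  shows "unit i j W = res X V W (unit i j V)"
proof -
  interpret S: cring "sec X W" by (rule ringed_cspace_sections(1)[OF X W(1)])
  note h = ringed_cspace_res(1)[OF X V(1) W]
  show ?thesis
    using transition_res[OF ij V _ W, of "(\<zero>\<^bsub>sec X V\<^esub>, \<one>\<^bsub>sec X V\<^esub>)"]
      ring_hom_zero[OF h R.ring_axioms S.ring_axioms] ring_hom_one[OF h]
    by (simp add: unit_def dual_numbers_simps)
qed

text \<open>Compare the coefficients of \<open>t\<close> in \<open>\<delta>\<^sub>i\<^sub>k(u) = \<delta>\<^sub>i\<^sub>j(\<delta>\<^sub>j\<^sub>k(u))\<close>.\<close>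

lemma der_cocycle:
  assumes k: "k \<in> I" "V \<subseteq> U k" and u: "u \<in> carrier (sec X V)"
  shows "der i k V u = der i j V u \<oplus>\<^bsub>sec X V\<^esub> unit i j V \<otimes>\<^bsub>sec X V\<^esub> der j k V u"
proof -
  let ?w = "(u, \<zero>\<^bsub>sec X V\<^esub>)"
  have w: "?w \<in> carrier (dual_numbers (sec X V))" using u by (simp add: dual_numbers_simps)
  note jk = transition_closed[OF ij(2) k(1) V(1,3) k(2) w]
  have "\<tau> i k V ?w = \<tau> i j V (\<tau> j k V ?w)"
    by (rule transition_unique[OF ij(1) V(1,2) transition_closed[OF ij V jk]])
      (simp add: chart_transition[OF ij V jk] chart_transition[OF ij(2) k(1) V(1,3) k(2) w])
  moreover have "\<tau> j k V ?w = (u, der j k V u)"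
    using fst_transition[OF ij(2) k(1) V(1,3) k(2) w] by (simp add: der_def prod_eq_iff)
  moreover from this have "der j k V u \<in> carrier (sec X V)"
    using jk by (simp add: dual_numbers_simps)
  ultimately have "\<tau> i k V ?w = (u, der i j V u \<oplus>\<^bsub>sec X V\<^esub> unit i j V \<otimes>\<^bsub>sec X V\<^esub> der j k V u)"
    using transition_eq[OF u] by simp
  then show ?thesis by (simp add: der_def[of i k])
qed

end

lemma transition_der_eq:
  "transition_der X U \<delta> i j = (\<lambda>V\<in>opens_in X (U i \<inter> U j). \<lambda>u\<in>carrier (sec X V). der i j V u)"
  by (simp add: transition_der_def der_def)

lemma transition_unit_eq: "transition_unit X U \<delta> i j = unit i j (U i \<inter> U j)"
  by (simp add: transition_unit_def unit_def Let_def)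

lemma transition_der_tangent:
  assumes ij: "i \<in> I" "j \<in> I"
  shows "transition_der X U \<delta> i j \<in> carrier (msec (tangent_sheaf X) (U i \<inter> U j))"
  unfolding tangent_sheaf_def map_sheaf_carrier
proof (intro conjI ballI allI)
  fix V assume "V \<in> opens_in X (U i \<inter> U j)"
  then have V: "openin (pts X) V" "V \<subseteq> U i" "V \<subseteq> U j" and Vo: "V \<in> opens_in X (U i \<inter> U j)"
    by (auto simp: opens_in_iff)
  interpret cring "sec X V" by (rule ringed_cspace_sections(1)[OF X V(1)])
  have c: "cst X V c \<in> carrier (sec X V)" for c
    using ring_hom_closed[OF ringed_cspace_sections(2)[OF X V(1)], of c] by (simp add: type_ring_def)
  note [simp] = transition_der_eq Vo
  show "transition_der X U \<delta> i j V \<in> extensional (carrier (sec X V))" by simp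
  show "transition_der X U \<delta> i j V (cst X V c) = \<zero>\<^bsub>sec X V\<^esub>" for c
    by (simp add: c der_cst[OF ij V])
  fix a assume a: "a \<in> carrier (sec X V)"
  show "transition_der X U \<delta> i j V a \<in> carrier (sec X V)" using a by (simp add: der_closed[OF ij V])
  show "transition_der X U \<delta> i j V (a \<oplus>\<^bsub>sec X V\<^esub> b)
      = transition_der X U \<delta> i j V a \<oplus>\<^bsub>sec X V\<^esub> transition_der X U \<delta> i j V b"
    "transition_der X U \<delta> i j V (a \<otimes>\<^bsub>sec X V\<^esub> b)
      = a \<otimes>\<^bsub>sec X V\<^esub> transition_der X U \<delta> i j V b \<oplus>\<^bsub>sec X V\<^esub> b \<otimes>\<^bsub>sec X V\<^esub> transition_der X U \<delta> i j V a"
    if "b \<in> carrier (sec X V)" for b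
    using a that by (simp_all add: der_add[OF ij V] der_mult[OF ij V])
  fix W assume "W \<in> opens_in X V"
  then have W: "openin (pts X) W" "W \<subseteq> V" "W \<in> opens_in X (U i \<inter> U j)"
    using V by (auto simp: opens_in_iff)
  show "transition_der X U \<delta> i j W (res X V W a) = res X V W (transition_der X U \<delta> i j V a)"
    using a W ringed_cspace_res_closed[OF X V(1) W(1,2) a] by (simp add: der_res[OF ij V])
qed (simp add: transition_der_eq)

end

section \<open>Frames and the blowing-up\<close>

lemma triv_frame:
  assumes t: "trivialization X M U a" and V: "V \<in> opens_in X U" and one: "\<one>\<^bsub>sec X V\<^esub> \<in> carrier (sec X V)"
  shows "triv_frame X M a V \<in> carrier (msec M V)" and "a V (triv_frame X M a V) = \<one>\<^bsub>sec X V\<^esub>"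
proof -
  have "\<one>\<^bsub>sec X V\<^esub> \<in> a V ` carrier (msec M V)"
    using t V one unfolding trivialization_def bij_betw_def by blast
  then show "triv_frame X M a V \<in> carrier (msec M V)" "a V (triv_frame X M a V) = \<one>\<^bsub>sec X V\<^esub>"
    by (simp_all add: triv_frame_def inv_into_into f_inv_into_f)
qed

lemma trivializationD:
  assumes "trivialization X M U a" "V \<in> opens_in X U"
  shows "inj_on (a V) (carrier (msec M V))"
    and "\<lbrakk>m \<in> carrier (msec M V); r \<in> carrier (sec X V)\<rbrakk> \<Longrightarrow> a V (r \<odot>\<^bsub>msec M V\<^esub> m) = r \<otimes>\<^bsub>sec X V\<^esub> a V m"
    and "\<lbrakk>m \<in> carrier (msec M V); W \<in> opens_in X V\<rbrakk> \<Longrightarrow> a W (mres M V W m) = res X V W (a V m)"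
  using assms by (auto simp: trivialization_def bij_betw_def)

context module_presheaf begin

lemma frame_closed:
  assumes "trivialization X M U a" "openin (pts X) V" "V \<subseteq> U"
  shows "triv_frame X M a V \<in> carrier (msec M V)" and "a V (triv_frame X M a V) = \<one>\<^bsub>sec X V\<^esub>"
proof -
  interpret R: cring "sec X V" by (rule ringed_cspace_sections(1)[OF ringed assms(2)])
  show "triv_frame X M a V \<in> carrier (msec M V)" "a V (triv_frame X M a V) = \<one>\<^bsub>sec X V\<^esub>"
    using triv_frame[OF assms(1) _ R.one_closed] assms by (simp_all add: opens_in_iff)
qed

text \<open>A trivialization is injective, and both sides have coordinate \<open>r\<close>.\<close>

lemma frame_coordinate:
  assumes t: "trivialization X M U a" and V: "openin (pts X) V" "V \<subseteq> U"
    and m: "m \<in> carrier (msec M V)" and r: "r \<in> carrier (sec X V)" "a V m = r"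
  shows "m = r \<odot>\<^bsub>msec M V\<^esub> triv_frame X M a V"
proof (rule inj_onD[OF trivializationD(1)[OF t]])
  interpret R: cring "sec X V" by (rule ringed_cspace_sections(1)[OF ringed V(1)])
  show V': "V \<in> opens_in X U" using V by (simp add: opens_in_iff)
  show "m \<in> carrier (msec M V)" by (rule m)
  show "r \<odot>\<^bsub>msec M V\<^esub> triv_frame X M a V \<in> carrier (msec M V)"
    by (rule smult_closed[OF V(1) r(1) frame_closed(1)[OF t V]])
  show "a V m = a V (r \<odot>\<^bsub>msec M V\<^esub> triv_frame X M a V)"
    using trivializationD(2)[OF t V' frame_closed(1)[OF t V] r(1)] frame_closed(2)[OF t V] r by simp
qed

lemma frame_res:
  assumes t: "trivialization X M U a" and V: "openin (pts X) V" "V \<subseteq> U" and W: "openin (pts X) W" "W \<subseteq> V"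
  shows "mres M V W (triv_frame X M a V) = triv_frame X M a W"
proof -
  interpret R: cring "sec X W" by (rule ringed_cspace_sections(1)[OF ringed W(1)])
  have WU: "W \<subseteq> U" using V W by blast
  have "a W (mres M V W (triv_frame X M a V)) = \<one>\<^bsub>sec X W\<^esub>"
    using trivializationD(3)[OF t _ frame_closed(1)[OF t V], of W] frame_closed(2)[OF t V]
      ring_hom_one[OF ringed_cspace_res(1)[OF ringed V(1) W]] V W by (simp add: opens_in_iff)
  from frame_coordinate[OF t W(1) WU res_closed[OF V(1) W frame_closed(1)[OF t V]] R.one_closed this]
  show ?thesis
    using module.smult_one[OF module_sections[OF W(1)] frame_closed(1)[OF t W(1) WU]] by simp
qed

text \<open>Families indexed by a whole type may differ outside \<open>I\<close>, while the class is determined by the values on \<open>I\<close>.\<close>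

lemma cech_class_cong:
  assumes c: "cech_cocycle X M I U c" and cd: "\<And>i j. \<lbrakk>i \<in> I; j \<in> I\<rbrakk> \<Longrightarrow> c i j = d i j"
  shows "cech_cocycle X M I U d" and "cech_class X M I U c = cech_class X M I U d"
proof -
  show d: "cech_cocycle X M I U d" using c cd by (simp add: cech_cocycle_def)
  obtain W s t b where comp: "cech_comparison I U c I U c W s t b"
    using cech_cohomologous_refl[OF c] unfolding cech_cohomologous_iff by blast
  note W = cech_comparisonD(1)[OF comp] and eq = cech_comparisonD(2)[OF comp]
  have "cech_cohomologous X M I U c I U d"
    by (rule cech_cohomologousI[OF c d W]) (use eq W cd in \<open>simp_all\<close>)
  then show "cech_class X M I U c = cech_class X M I U d" by (rule cech_class_eq)
qed

end

context split_atlas begin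

text \<open>Let \<open>f\<^sub>i = \<alpha>\<^sub>i\<inverse>(1)\<close>. The hypothesis on \<open>\<alpha>\<close> says \<open>f\<^sub>j = \<alpha>\<^sub>i\<^sub>j f\<^sub>i\<close>, so
  \<open>D\<^sub>i\<^sub>j \<otimes> f\<^sub>i + D\<^sub>j\<^sub>k \<otimes> f\<^sub>j = (D\<^sub>i\<^sub>j + \<alpha>\<^sub>i\<^sub>j D\<^sub>j\<^sub>k) \<otimes> f\<^sub>i = D\<^sub>i\<^sub>k \<otimes> f\<^sub>i\<close>.\<close>

lemma cech_cocycle_transition_der:
  assumes cover: "open_cover X I U"
    and triv: "\<And>i. i \<in> I \<Longrightarrow> trivialization X line_bundle (U i) (\<alpha> i)"
    and \<alpha>: "\<And>i j. \<lbrakk>i \<in> I; j \<in> I\<rbrakk> \<Longrightarrow>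
      \<alpha> i (U i \<inter> U j) (triv_frame X line_bundle (\<alpha> j) (U i \<inter> U j)) = transition_unit X U \<delta> i j"
  shows "cech_cocycle X (tensor_sheaf X (tangent_sheaf X) line_bundle) I U
    (\<lambda>i j. tensor_section X (tangent_sheaf X) line_bundle (U i \<inter> U j) (transition_der X U \<delta> i j)
      (triv_frame X line_bundle (\<alpha> i) (U i \<inter> U j)))"
proof -
  let ?T = "tangent_sheaf X" and ?fr = "\<lambda>i V. triv_frame X line_bundle (\<alpha> i) V"
  interpret TL: presheaf_pair X ?T line_bundle
    by (intro presheaf_pair.intro module_presheaf_tangent_sheaf[OF X] module_presheaf_line_bundle)
  have oij: "openin (pts X) (U i \<inter> U j)" if "i \<in> I" "j \<in> I" for i j
    using that chart_open by blast
  have closed: "tensor_section X ?T line_bundle (U i \<inter> U j) (transition_der X U \<delta> i j) (?fr i (U i \<inter> U j))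
      \<in> carrier (msec (tensor_sheaf X ?T line_bundle) (U i \<inter> U j))" if "i \<in> I" "j \<in> I" for i j
    using that by (intro TL.tensor_section_closed oij transition_der_tangent TL.N.frame_closed(1)[OF triv]) auto
  show ?thesis
    unfolding cech_cocycle_def Let_def
  proof (intro conjI ballI closed cover)
    fix i j k assume ijk: "i \<in> I" "j \<in> I" "k \<in> I"
    let ?W = "U i \<inter> U j \<inter> U k"
    have o: "openin (pts X) ?W" using ijk chart_open by blast
    have W: "?W \<subseteq> U i" "?W \<subseteq> U j" "?W \<subseteq> U k" by auto
    interpret R: cring "sec X ?W" by (rule ringed_cspace_sections(1)[OF X o])
    have D: "mres ?T (U i \<inter> U j) ?W (transition_der X U \<delta> i j) \<in> carrier (msec ?T ?W)"
      if "i \<in> I" "j \<in> I" "?W \<subseteq> U i \<inter> U j" for i j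
      by (rule TL.M.res_closed[OF oij[OF that(1,2)] o that(3) transition_der_tangent[OF that(1,2)]])
    have c: "mres (tensor_sheaf X ?T line_bundle) (U i \<inter> U j) ?W
          (tensor_section X ?T line_bundle (U i \<inter> U j) (transition_der X U \<delta> i j) (?fr i (U i \<inter> U j)))
        = tensor_section X ?T line_bundle ?W (mres ?T (U i \<inter> U j) ?W (transition_der X U \<delta> i j)) (?fr i ?W)"
      if "i \<in> I" "j \<in> I" "?W \<subseteq> U i \<inter> U j" for i j
      using TL.tensor_section_res[OF oij[OF that(1,2)] o that(3) transition_der_tangent[OF that(1,2)]
          TL.N.frame_closed(1)[OF triv[OF that(1)] oij[OF that(1,2)] Int_lower1]]
        TL.N.frame_res[OF triv[OF that(1)] oij[OF that(1,2)] Int_lower1 o that(3)] by simp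
    let ?u = "unit i j ?W"
    have u: "?u \<in> carrier (sec X ?W)" by (rule unit_closed[OF ijk(1,2) o W(1,2)])
    \<comment> \<open>The coordinate of the second frame in the first trivialization is the transition unit, restricted to the triple intersection.\<close>
    have "\<alpha> i ?W (?fr j ?W) = \<alpha> i ?W (mres line_bundle (U i \<inter> U j) ?W (?fr j (U i \<inter> U j)))"
      using TL.N.frame_res[OF triv[OF ijk(2)] oij[OF ijk(1,2)] Int_lower2 o Int_lower1] by simp
    also have "\<dots> = res X (U i \<inter> U j) ?W (unit i j (U i \<inter> U j))"
      using trivializationD(3)[OF triv[OF ijk(1)], of "U i \<inter> U j" "?fr j (U i \<inter> U j)" ?W]
        TL.N.frame_closed(1)[OF triv[OF ijk(2)] oij[OF ijk(1,2)] Int_lower2] oij[OF ijk(1,2)] o \<alpha>[OF ijk(1,2)] W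
      by (simp add: opens_in_iff transition_unit_eq)
    also have "\<dots> = ?u"
      by (rule unit_res[symmetric, OF ijk(1,2) oij[OF ijk(1,2)] Int_lower1 Int_lower2 o Int_lower1])
    finally have f: "?fr j ?W = ?u \<odot>\<^bsub>msec line_bundle ?W\<^esub> ?fr i ?W"
      by (rule TL.N.frame_coordinate[OF triv[OF ijk(1)] o W(1) TL.N.frame_closed(1)[OF triv[OF ijk(2)] o W(2)] u])
    let ?D1 = "mres ?T (U i \<inter> U j) ?W (transition_der X U \<delta> i j)"
      and ?D2 = "mres ?T (U j \<inter> U k) ?W (transition_der X U \<delta> j k)"
      and ?D3 = "mres ?T (U i \<inter> U k) ?W (transition_der X U \<delta> i k)"
    have s: "?W \<subseteq> U i \<inter> U j" "?W \<subseteq> U j \<inter> U k" "?W \<subseteq> U i \<inter> U k" by auto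
    have D1: "?D1 \<in> carrier (msec ?T ?W)" by (rule D[OF ijk(1,2) s(1)])
    have D2: "?D2 \<in> carrier (msec ?T ?W)" by (rule D[OF ijk(2,3) s(2)])
    have D3: "?D3 \<in> carrier (msec ?T ?W)" by (rule D[OF ijk(1,3) s(3)])
    have fi: "?fr i ?W \<in> carrier (msec line_bundle ?W)" by (rule TL.N.frame_closed(1)[OF triv[OF ijk(1)] o W(1)])
    have sum: "?D1 \<oplus>\<^bsub>msec ?T ?W\<^esub> ?u \<odot>\<^bsub>msec ?T ?W\<^esub> ?D2 = ?D3"
    proof (rule tangent_sheaf_eqI)
      show "?D1 \<oplus>\<^bsub>msec ?T ?W\<^esub> ?u \<odot>\<^bsub>msec ?T ?W\<^esub> ?D2 \<in> carrier (msec ?T ?W)"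
        by (rule TL.M.add_closed[OF o D1 TL.M.smult_closed[OF o u D2]])
      show "?D3 \<in> carrier (msec ?T ?W)" by (rule D3)
      fix V a assume V: "V \<in> opens_in X ?W" and a: "a \<in> carrier (sec X V)"
      then have Vo: "openin (pts X) V" "V \<subseteq> U i" "V \<subseteq> U j" "V \<subseteq> U k" "V \<subseteq> ?W" by (auto simp: opens_in_iff)
      then have Vs: "V \<in> opens_in X (U i \<inter> U j)" "V \<in> opens_in X (U j \<inter> U k)" "V \<in> opens_in X (U i \<inter> U k)"
        by (auto simp: opens_in_iff)
      have "res X ?W V ?u = unit i j V"
        by (rule unit_res[symmetric, OF ijk(1,2) o W(1,2) Vo(1,5)])
      then show "(?D1 \<oplus>\<^bsub>msec ?T ?W\<^esub> ?u \<odot>\<^bsub>msec ?T ?W\<^esub> ?D2) V a = ?D3 V a"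
        unfolding tangent_sheaf_def using V a Vs
        by (simp add: map_sheaf_ops mres_map_sheaf transition_der_eq
            der_cocycle[OF ijk(1,2) Vo(1,2,3) ijk(3) Vo(4)])
    qed
    show "mres (tensor_sheaf X ?T line_bundle) (U i \<inter> U j) ?W
          (tensor_section X ?T line_bundle (U i \<inter> U j) (transition_der X U \<delta> i j) (?fr i (U i \<inter> U j)))
        \<oplus>\<^bsub>msec (tensor_sheaf X ?T line_bundle) ?W\<^esub> mres (tensor_sheaf X ?T line_bundle) (U j \<inter> U k) ?W
          (tensor_section X ?T line_bundle (U j \<inter> U k) (transition_der X U \<delta> j k) (?fr j (U j \<inter> U k)))
        = mres (tensor_sheaf X ?T line_bundle) (U i \<inter> U k) ?W
          (tensor_section X ?T line_bundle (U i \<inter> U k) (transition_der X U \<delta> i k) (?fr i (U i \<inter> U k)))"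
      unfolding c[OF ijk(1,2) s(1)] c[OF ijk(2,3) s(2)] c[OF ijk(1,3) s(3)] f
        TL.tensor_section_balanced[OF o u D2 fi, symmetric]
        TL.tensor_section_add_left[OF o D1 TL.M.smult_closed[OF o u D2] fi, symmetric] sum ..
  qed
qed

end

text \<open>The maps \<open>\<chi>\<close> fix the functions without \<open>t\<close>. Hence \<open>\<gamma>\<^sub>i\<^sub>j \<circ> \<chi>\<^sub>x\<^sub>j = \<chi>\<^sub>x\<^sub>i \<circ> \<delta>\<^sub>i\<^sub>j\<close>, evaluated at such
  a function \<open>u\<close>, reads \<open>u + E\<^sub>i\<^sub>j(u) t = u + x\<^sub>i D\<^sub>i\<^sub>j(u) t\<close>.\<close>

lemma transition_der_blowing_up:
  assumes X: "ringed_cspace X" and blow: "blowing_up X I U x \<delta> B \<rho>B \<epsilon>" and ij: "i \<in> I" "j \<in> I"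
    and U: "openin (pts X) (U i)" "openin (pts X) (U j)" and x: "x i \<in> carrier (sec X (U i))" "x j \<in> carrier (sec X (U j))"
  shows "transition_der X U \<epsilon> i j
    = res X (U i) (U i \<inter> U j) (x i) \<odot>\<^bsub>msec (tangent_sheaf X) (U i \<inter> U j)\<^esub> transition_der X U \<delta> i j"
proof -
  have "snd (transition X \<epsilon> i j V (u, \<zero>\<^bsub>sec X V\<^esub>)) = res X (U i \<inter> U j) V (res X (U i) (U i \<inter> U j) (x i))
      \<otimes>\<^bsub>sec X V\<^esub> snd (transition X \<delta> i j V (u, \<zero>\<^bsub>sec X V\<^esub>))"
    if V: "V \<in> opens_in X (U i \<inter> U j)" and u: "u \<in> carrier (sec X V)" for V u
  proof -
    have o: "openin (pts X) V" "V \<subseteq> U i" "V \<subseteq> U j" "openin (pts X) (U i \<inter> U j)" "V \<subseteq> U i \<inter> U j"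
      using V U by (auto simp: opens_in_iff)
    interpret R: cring "sec X V" by (rule ringed_cspace_sections(1)[OF X o(1)])
    have "transition X \<epsilon> i j V (chi (sec X V) (res X (U j) V (x j)) (u, \<zero>\<^bsub>sec X V\<^esub>))
        = chi (sec X V) (res X (U i) V (x i)) (transition X \<delta> i j V (u, \<zero>\<^bsub>sec X V\<^esub>))"
      using blow ij V u by (simp add: blowing_up_def dual_numbers_simps)
    moreover have "res X (U j) V (x j) \<in> carrier (sec X V)"
      by (rule ringed_cspace_res_closed[OF X U(2) o(1,3) x(2)])
    ultimately have "snd (transition X \<epsilon> i j V (u, \<zero>\<^bsub>sec X V\<^esub>))
        = res X (U i) V (x i) \<otimes>\<^bsub>sec X V\<^esub> snd (transition X \<delta> i j V (u, \<zero>\<^bsub>sec X V\<^esub>))"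
      by (simp add: chi_def split_beta)
    then show ?thesis
      using ringed_cspace_res(3)[OF X U(1) o(4) Int_lower1 o(1,5) x(1)] by simp
  qed
  then show ?thesis
    unfolding tangent_sheaf_def map_sheaf_def transition_der_def
    by (auto intro!: restrict_ext)
qed

section \<open>The class of the blowing-up\<close>

lemma presheaf_morphism_id:
  assumes "module_presheaf X M"
  shows "presheaf_morphism X M M (\<lambda>V m. m)"
proof -
  interpret module_presheaf X M by fact
  show ?thesis
    by unfold_locales (auto intro: semilinearI)
qed

lemma twist_morphism:
  assumes L: "module_presheaf X L" and J: "ideal_presheaf X J"
  shows "presheaf_morphism X (tensor_sheaf X (tangent_sheaf X) L)
      (tensor_sheaf X (tangent_sheaf X) (tensor_sheaf X L (dual_ideal X J))) (twist_morphism X L J)"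
    and "\<lbrakk>openin (pts X) V; D \<in> carrier (msec (tangent_sheaf X) V); l \<in> carrier (msec L V)\<rbrakk> \<Longrightarrow>
      twist_morphism X L J V (tensor_section X (tangent_sheaf X) L V D l)
      = tensor_section X (tangent_sheaf X) (tensor_sheaf X L (dual_ideal X J)) V D
          (tensor_section X L (dual_ideal X J) V l (canonical_section X J V))"
proof -
  interpret J: ideal_presheaf X J by fact
  interpret LO: presheaf_pair X L "dual_ideal X J"
    by (intro presheaf_pair.intro L J.module_presheaf_dual_ideal)
  interpret tw: two_presheaf_morphisms X "tangent_sheaf X" "tangent_sheaf X" "\<lambda>V D. D"
      L "tensor_sheaf X L (dual_ideal X J)" "\<lambda>V l. tensor_section X L (dual_ideal X J) V l (canonical_section X J V)"
    by (intro two_presheaf_morphisms.intro presheaf_morphism_id module_presheaf_tangent_sheaf J.ringed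
        LO.presheaf_morphism_tensor_section J.canonical_section_closed J.canonical_section_res)
  show "presheaf_morphism X (tensor_sheaf X (tangent_sheaf X) L)
      (tensor_sheaf X (tangent_sheaf X) (tensor_sheaf X L (dual_ideal X J))) (twist_morphism X L J)"
    unfolding twist_morphism_def by (rule tw.presheaf_morphism_tensor_sheaf)
  show "twist_morphism X L J V (tensor_section X (tangent_sheaf X) L V D l)
      = tensor_section X (tangent_sheaf X) (tensor_sheaf X L (dual_ideal X J)) V D
          (tensor_section X L (dual_ideal X J) V l (canonical_section X J V))"
    if "openin (pts X) V" "D \<in> carrier (msec (tangent_sheaf X) V)" "l \<in> carrier (msec L V)"
    unfolding twist_morphism_def by (rule tw.tensor_morphism_section[OF that])
qed

lemma smooth_variety_ringed: "smooth_variety X \<Longrightarrow> ringed_cspace X"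
  by (simp add: smooth_variety_def variety_def cscheme_def)

lemma square_zero_thickening_double_scheme:
  assumes "primitive_double_scheme X XX \<rho>"
  shows "square_zero_thickening X XX \<rho>"
  using assms smooth_variety_ringed[of X]
  by (auto simp: primitive_double_scheme_def square_zero_thickening_def cscheme_def)

theorem proposition6p3p1:
  fixes X :: "('a, 'r) cspace"
    and XX :: "('a, 's) cspace" and \<rho> :: "'a set \<Rightarrow> 's \<Rightarrow> 'r"
    and L :: "('a, 'r, 's) omod"
    and H :: "('h, 'k) cspace" and h :: "'h \<Rightarrow> 'a" and hs :: "'a set \<Rightarrow> 'r \<Rightarrow> 'k"
    and J :: "'a set \<Rightarrow> 'r set"
    and I :: "'i set" and U :: "'i \<Rightarrow> 'a set" and x :: "'i \<Rightarrow> 'r"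
    and \<delta> :: "'i \<Rightarrow> 'a set \<Rightarrow> 'r \<times> 'r \<Rightarrow> 's"
    and \<alpha> :: "'i \<Rightarrow> 'a set \<Rightarrow> 's \<Rightarrow> 'r"
    and B :: "('a, 'b) cspace" and \<rho>B :: "'a set \<Rightarrow> 'b \<Rightarrow> 'r"
    and \<epsilon> :: "'i \<Rightarrow> 'a set \<Rightarrow> 'r \<times> 'r \<Rightarrow> 'b"
    and \<beta> :: "'i \<Rightarrow> 'a set \<Rightarrow> ('a \<Rightarrow> ('a set \<times> ('s \<times> ('a set \<Rightarrow> 'r \<Rightarrow> 'r) \<Rightarrow>\<^sub>0 int) set) set) \<Rightarrow> 'r"
  assumes "smooth_variety X" and "projective X"
    and "primitive_double_scheme X XX \<rho>"
    and L: "L = associated_line_bundle X XX \<rho>"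
    and "hypersurface X H h hs"
    and J: "J = ideal_sheaf H X h hs"
    and "open_cover X I U" and "\<forall>i\<in>I. affine_open X (U i)"
    and "\<forall>i\<in>I. split_chart X XX \<rho> (U i) (\<delta> i)"
    and "\<forall>i\<in>I. generates_ideal X J (U i) (x i)"
    and "\<forall>i\<in>I. trivialization X L (U i) (\<alpha> i)"
    and "\<forall>i\<in>I. \<forall>j\<in>I. \<alpha> i (U i \<inter> U j) (triv_frame X L (\<alpha> j) (U i \<inter> U j))
           = transition_unit X U \<delta> i j"
    and "blowing_up X I U x \<delta> B \<rho>B \<epsilon>"
    and "\<forall>i\<in>I. trivialization X (tensor_sheaf X L (dual_ideal X J)) (U i) (\<beta> i)"
    and "\<forall>i\<in>I. \<forall>V\<in>opens_in X (U i).
           \<forall>l\<in>carrier (msec L V). \<forall>s\<in>carrier (msec (dual_ideal X J) V).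
             \<beta> i V (tensor_section X L (dual_ideal X J) V l s)
             = \<alpha> i V l \<otimes>\<^bsub>sec X V\<^esub> s V (res X (U i) V (x i))"
  shows "represented_class X L I U \<alpha> (transition_der X U \<delta>)
           \<in> H1 X (tensor_sheaf X (tangent_sheaf X) L) \<and>
         represented_class X (tensor_sheaf X L (dual_ideal X J)) I U \<beta> (transition_der X U \<epsilon>)
           \<in> H1 X (tensor_sheaf X (tangent_sheaf X) (tensor_sheaf X L (dual_ideal X J))) \<and>
         represented_class X (tensor_sheaf X L (dual_ideal X J)) I U \<beta> (transition_der X U \<epsilon>)
         = H1_map X (tensor_sheaf X (tangent_sheaf X) (tensor_sheaf X L (dual_ideal X J)))
             (twist_morphism X L J)
             (represented_class X L I U \<alpha> (transition_der X U \<delta>))"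
proof -
  have X: "ringed_cspace X" using assms(1) by (rule smooth_variety_ringed)
  let ?T = "tangent_sheaf X" and ?O = "dual_ideal X J"
  let ?LO = "tensor_sheaf X L ?O" and ?U = "\<lambda>i j. U i \<inter> U j"
  interpret thick: square_zero_thickening X XX \<rho>
    by (rule square_zero_thickening_double_scheme) fact
  have oU: "openin (pts X) (U i)" if "i \<in> I" for i
    using assms(7) that by (simp add: open_cover_def)
  interpret atlas: split_atlas X XX \<rho> I U \<delta>
    by unfold_locales (use oU assms(9) in auto)
  interpret J: ideal_presheaf X J
    unfolding J using assms(5) X
    by (intro ideal_presheaf_ideal_sheaf) (simp_all add: hypersurface_def cscheme_def closed_immersion_def)
  have L_mod: "module_presheaf X L" unfolding L by (rule thick.module_presheaf_line_bundle)
  interpret LO: presheaf_pair X L ?O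
    by (intro presheaf_pair.intro L_mod J.module_presheaf_dual_ideal)
  interpret TLO: presheaf_pair X ?T ?LO
    by (intro presheaf_pair.intro module_presheaf_tangent_sheaf[OF X] LO.module_presheaf_tensor_sheaf)
  interpret TL: presheaf_pair X ?T L
    by (intro presheaf_pair.intro module_presheaf_tangent_sheaf[OF X] L_mod)
  interpret TLs: module_presheaf X "tensor_sheaf X ?T L" by (rule TL.module_presheaf_tensor_sheaf)
  interpret TLOs: module_presheaf X "tensor_sheaf X ?T ?LO" by (rule TLO.module_presheaf_tensor_sheaf)
  interpret twist: presheaf_morphism X "tensor_sheaf X ?T L" "tensor_sheaf X ?T ?LO" "twist_morphism X L J"
    by (rule twist_morphism(1)[OF L_mod J.ideal_presheaf_axioms])
  define c where "c i j = tensor_section X ?T L (?U i j) (transition_der X U \<delta> i j) (triv_frame X L (\<alpha> i) (?U i j))" for i j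
  define e where "e i j = tensor_section X ?T ?LO (?U i j) (transition_der X U \<epsilon> i j) (triv_frame X ?LO (\<beta> i) (?U i j))" for i j
  have c: "cech_cocycle X (tensor_sheaf X ?T L) I U c"
    unfolding c_def[abs_def] L using assms(7,11,12) unfolding L by (intro atlas.cech_cocycle_transition_der) auto
  have twist_c: "twist_morphism X L J (?U i j) (c i j) = e i j" if ij: "i \<in> I" "j \<in> I" for i j
  proof -
    have o: "openin (pts X) (?U i j)" using oU ij by blast
    have V: "?U i j \<in> opens_in X (U i)" using o by (simp add: opens_in_iff)
    interpret R: cring "sec X (?U i j)" by (rule ringed_cspace_sections(1)[OF X o])
    have gen: "generates_ideal X J (U i) (x i)" and x: "x k \<in> carrier (sec X (U k))" if "k \<in> I" for k
      using assms(10) ij that by (auto simp: generates_ideal_def)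
    let ?x = "res X (U i) (?U i j) (x i)"
    have xc: "?x \<in> carrier (sec X (?U i j))"
      by (rule ringed_cspace_res_closed[OF X oU[OF ij(1)] o Int_lower1 x[OF ij(1)]])
    have xJ: "?x \<in> J (?U i j)"
      using gen[OF ij(1)] V R.cgenideal_self[OF xc] by (simp add: generates_ideal_def)
    have triv\<alpha>: "trivialization X L (U i) (\<alpha> i)" and triv\<beta>: "trivialization X ?LO (U i) (\<beta> i)"
      using assms(11,14) ij by auto
    let ?l = "triv_frame X L (\<alpha> i) (?U i j)" and ?f = "triv_frame X ?LO (\<beta> i) (?U i j)"
      and ?can = "canonical_section X J (?U i j)"
    note l = LO.M.frame_closed[OF triv\<alpha> o Int_lower1]
    note f = TLO.N.frame_closed[OF triv\<beta> o Int_lower1]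
    note can = J.canonical_section_closed[OF o]
    \<comment> \<open>In the trivialization of \<open>L \<otimes> \<O>(H)\<close>, the section \<open>\<alpha>\<^sub>i\<inverse>(1) \<otimes> 1\<close> has coordinate \<open>1 \<cdot> x\<^sub>i\<close>, as the canonical section is the inclusion of the ideal.\<close>
    have "\<beta> i (?U i j) (tensor_section X L ?O (?U i j) ?l ?can) = \<alpha> i (?U i j) ?l \<otimes>\<^bsub>sec X (?U i j)\<^esub> ?can (?U i j) ?x"
      using assms(15) ij V l(1) can by blast
    also have "\<dots> = ?x"
      using l(2) xc xJ o by (simp add: canonical_section_def opens_in_iff)
    finally have lf: "tensor_section X L ?O (?U i j) ?l ?can = ?x \<odot>\<^bsub>msec ?LO (?U i j)\<^esub> ?f"
      by (rule TLO.N.frame_coordinate[OF triv\<beta> o Int_lower1 LO.tensor_section_closed[OF o l(1) can] xc])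
    note D = atlas.transition_der_tangent[OF ij]
    have "twist_morphism X L J (?U i j) (c i j)
        = tensor_section X ?T ?LO (?U i j) (transition_der X U \<delta> i j) (tensor_section X L ?O (?U i j) ?l ?can)"
      unfolding c_def by (rule twist_morphism(2)[OF L_mod J.ideal_presheaf_axioms o D l(1)])
    also have "\<dots> = tensor_section X ?T ?LO (?U i j) (?x \<odot>\<^bsub>msec ?T (?U i j)\<^esub> transition_der X U \<delta> i j) ?f"
      unfolding lf by (rule TLO.tensor_section_balanced[OF o xc D f(1), symmetric])
    also have "\<dots> = e i j"
      unfolding e_def
      using transition_der_blowing_up[OF X assms(13) ij oU[OF ij(1)] oU[OF ij(2)] x[OF ij(1)] x[OF ij(2)]] by simp
    finally show ?thesis .
  qed
  have reps: "represented_class X L I U \<alpha> (transition_der X U \<delta>) = cech_class X (tensor_sheaf X ?T L) I U c"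
      "represented_class X ?LO I U \<beta> (transition_der X U \<epsilon>) = cech_class X (tensor_sheaf X ?T ?LO) I U e"
    by (simp_all add: represented_class_def c_def[abs_def] e_def[abs_def])
  \<comment> \<open>The family \<open>e\<close> is a cocycle because it is the image of the cocycle \<open>c\<close>.\<close>
  note e = TLOs.cech_class_cong[OF twist.cech_cocycle_map[OF c] twist_c]
  show ?thesis
    unfolding reps using TLs.cech_class_in_H1[OF c] TLOs.cech_class_in_H1[OF e(1)] twist.H1_map_cech_class[OF c] e(2)
    by simp
qed

end
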